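(* Let $D(a,\sigma)$ be a generalized Weyl algebra of degree $\alpha$ and base ring $D$, where $\alpha$ is an infinite ordinal. Assume that $D$ does not have any nonzero proper $\sigma$-stable ideal; that the subgroup generated by the $\sigma_i$ ($i<\alpha$) in the factor group $\mathrm{Aut}\,D/\mathrm{Inn}\,D$ is isomorphic to $\mathbb{Z}^{\oplus\alpha}$; and that for each $i\in\alpha$ and each $m\geq1$, $Da_i+D\sigma_i^m(a_i)=D$. Then $D(a,\sigma)$ is a simple ring.
   Context: Rings are $\mathsf{k}$-algebras over an arbitrary field $\mathsf{k}$. Generalized Weyl algebra (GWA): let $D$ be a ring, $\alpha$ an ordinal, $\sigma=\langle\sigma_\beta\rangle_{\beta<\alpha}$ a sequence of commuting automorphisms of $D$, and $a=\langle a_\beta\rangle_{\beta<\alpha}$ a sequence of nonzero elements of the center of $D$ with $\sigma_\beta(a_\gamma)=a_\gamma$ for $\gamma\neq\beta$. The GWA $D(a,\sigma)$ of degree $\alpha$ and base ring $D$ is generated over $D$ by $X_\beta^+,X_\beta^-$ ($\beta<\alpha$) with relations $X_\beta^{+}d=\sigma_\beta(d)X_\beta^{+}$, $X_\beta^{-}d=\sigma_\beta^{-1}(d)X_\beta^{-}$ for all $d\in D$; $[X_\beta^+,X_\gamma^+]=[X_\beta^-,X_\gamma^-]=[X_\beta^+,X_\gamma^-]=0$ for $\beta\neq\gamma$; $X_\beta^-X_\beta^+=a_\beta$, $X_\beta^+X_\beta^-=\sigma_\beta(a_\beta)$. $\mathbb{Z}^{\oplus\alpha}$ is the group of finitely supported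 sequences $(z_\beta)_{\beta<\alpha}$ of integers. A subset $S\subset D$ is $\sigma$-stable if $\sigma_\beta^j(S)\subset S$ for all $\beta<\alpha$, $j\in\mathbb{Z}$. $\mathrm{Aut}\,D$ is the group of automorphisms of $D$ and $\mathrm{Inn}\,D$ its subgroup of inner automorphisms.
   Formalization: The subgroup generated by the σ_i in Aut D/Inn D is required to be isomorphic to Z^{⊕α} via the canonical map sending e_i to the class of σ_i; with a merely abstract isomorphism the claim fails (e.g. D = k(x_0,x_1,...), char k = 0, a_i = 1, σ_0 = σ_1, the other σ_i independent shifts). *)

theory Defs
  imports "HOL-Algebra.Algebra"
begin

text \<open>Associative unital algebras over a field. The library's \<^locale>\<open>algebra\<close> does not apply, as it
  requires the algebra to be commutative.\<close>

locale assoc_algebra = K?: field K + D?: ring D + module K D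
    for K :: "('k, 'm) ring_scheme" (structure) and D :: "('k, 'd, 'n) module_scheme" (structure) +
  assumes smult_mult_left:
      "\<lbrakk>c \<in> carrier K; x \<in> carrier D; y \<in> carrier D\<rbrakk>
        \<Longrightarrow> (c \<odot>\<^bsub>D\<^esub> x) \<otimes>\<^bsub>D\<^esub> y = c \<odot>\<^bsub>D\<^esub> (x \<otimes>\<^bsub>D\<^esub> y)"
    and smult_mult_right:
      "\<lbrakk>c \<in> carrier K; x \<in> carrier D; y \<in> carrier D\<rbrakk>
        \<Longrightarrow> x \<otimes>\<^bsub>D\<^esub> (c \<odot>\<^bsub>D\<^esub> y) = c \<odot>\<^bsub>D\<^esub> (x \<otimes>\<^bsub>D\<^esub> y)"

text \<open>As in \<^const>\<open>AutoGroup\<close>, automorphisms are extensional functions, so that equality of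
  automorphisms is equality in HOL.\<close>

definition alg_auto :: "('k, 'm) ring_scheme \<Rightarrow> ('k, 'd, 'n) module_scheme \<Rightarrow> ('d \<Rightarrow> 'd) set" where
  "alg_auto K D = {f \<in> ring_hom D D \<inter> Bij (carrier D).
     \<forall>c\<in>carrier K. \<forall>x\<in>carrier D. f (c \<odot>\<^bsub>D\<^esub> x) = c \<odot>\<^bsub>D\<^esub> f x}"

definition Aut :: "('k, 'm) ring_scheme \<Rightarrow> ('k, 'd, 'n) module_scheme \<Rightarrow> ('d \<Rightarrow> 'd) monoid" where
  "Aut K D = BijGroup (carrier D) \<lparr>carrier := alg_auto K D\<rparr>"

definition Inn :: "('d, 'n) ring_scheme \<Rightarrow> ('d \<Rightarrow> 'd) set" where
  "Inn D = {\<lambda>x\<in>carrier D. u \<otimes>\<^bsub>D\<^esub> x \<otimes>\<^bsub>D\<^esub> inv\<^bsub>D\<^esub> u | u. u \<in> Units D}"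

text \<open>An ordinal is represented by a well-order \<open>\<alpha>\<close>; \<open>\<beta> < \<alpha>\<close> then reads \<open>\<beta> \<in> Field \<alpha>\<close>.\<close>

locale gwa_datum = assoc_algebra K D
    for K :: "('k, 'm) ring_scheme" (structure) and D :: "('k, 'd, 'n) module_scheme" (structure) +
  fixes \<alpha> :: "'i rel" and \<sigma> :: "'i \<Rightarrow> 'd \<Rightarrow> 'd" and a :: "'i \<Rightarrow> 'd"
  assumes ordinal: "Well_order \<alpha>"
    and \<sigma>_auto: "\<beta> \<in> Field \<alpha> \<Longrightarrow> \<sigma> \<beta> \<in> carrier (Aut K D)"
    and \<sigma>_commute: "\<lbrakk>\<beta> \<in> Field \<alpha>; \<gamma> \<in> Field \<alpha>\<rbrakk>
      \<Longrightarrow> \<sigma> \<beta> \<otimes>\<^bsub>Aut K D\<^esub> \<sigma> \<gamma> = \<sigma> \<gamma> \<otimes>\<^bsub>Aut K D\<^esub> \<sigma> \<beta>"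
    and a_carrier: "\<beta> \<in> Field \<alpha> \<Longrightarrow> a \<beta> \<in> carrier D"
    and a_central: "\<lbrakk>\<beta> \<in> Field \<alpha>; d \<in> carrier D\<rbrakk> \<Longrightarrow> a \<beta> \<otimes>\<^bsub>D\<^esub> d = d \<otimes>\<^bsub>D\<^esub> a \<beta>"
    and a_nonzero: "\<beta> \<in> Field \<alpha> \<Longrightarrow> a \<beta> \<noteq> \<zero>\<^bsub>D\<^esub>"
    and \<sigma>_fixes_a: "\<lbrakk>\<beta> \<in> Field \<alpha>; \<gamma> \<in> Field \<alpha>; \<gamma> \<noteq> \<beta>\<rbrakk> \<Longrightarrow> \<sigma> \<beta> (a \<gamma>) = a \<gamma>"

text \<open>The generalized Weyl algebra is the algebra presented by generators and relations over \<open>D\<close>: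
  expressions in the language of algebras, in the elements of \<open>D\<close> and the symbols
  \<open>X\<^sub>\<beta>\<^sup>+\<close>, \<open>X\<^sub>\<beta>\<^sup>-\<close>, modulo the least congruence which makes the quotient an algebra, makes the
  inclusion of \<open>D\<close> a homomorphism of algebras, and contains the defining relations.
  The zero and the identity of the algebra are those of \<open>D\<close>.\<close>

datatype ('k, 'd, 'i) gwa_expr =
    Base 'd
  | XPlus 'i
  | XMinus 'i
  | Add "('k, 'd, 'i) gwa_expr" "('k, 'd, 'i) gwa_expr"
  | Neg "('k, 'd, 'i) gwa_expr"
  | Mul "('k, 'd, 'i) gwa_expr" "('k, 'd, 'i) gwa_expr"
  | Scal 'k "('k, 'd, 'i) gwa_expr"

inductive_set gwa_exprs ::
  "('k, 'm) ring_scheme \<Rightarrow> ('k, 'd, 'n) module_scheme \<Rightarrow> 'i rel \<Rightarrow> ('k, 'd, 'i) gwa_expr set"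
  for K D \<alpha> where
  "d \<in> carrier D \<Longrightarrow> Base d \<in> gwa_exprs K D \<alpha>"
| "\<beta> \<in> Field \<alpha> \<Longrightarrow> XPlus \<beta> \<in> gwa_exprs K D \<alpha>"
| "\<beta> \<in> Field \<alpha> \<Longrightarrow> XMinus \<beta> \<in> gwa_exprs K D \<alpha>"
| "\<lbrakk>s \<in> gwa_exprs K D \<alpha>; t \<in> gwa_exprs K D \<alpha>\<rbrakk> \<Longrightarrow> Add s t \<in> gwa_exprs K D \<alpha>"
| "s \<in> gwa_exprs K D \<alpha> \<Longrightarrow> Neg s \<in> gwa_exprs K D \<alpha>"
| "\<lbrakk>s \<in> gwa_exprs K D \<alpha>; t \<in> gwa_exprs K D \<alpha>\<rbrakk> \<Longrightarrow> Mul s t \<in> gwa_exprs K D \<alpha>"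
| "\<lbrakk>c \<in> carrier K; s \<in> gwa_exprs K D \<alpha>\<rbrakk> \<Longrightarrow> Scal c s \<in> gwa_exprs K D \<alpha>"

inductive gwa_cong ::
  "('k, 'm) ring_scheme \<Rightarrow> ('k, 'd, 'n) module_scheme \<Rightarrow> 'i rel \<Rightarrow> ('i \<Rightarrow> 'd \<Rightarrow> 'd) \<Rightarrow> ('i \<Rightarrow> 'd)
    \<Rightarrow> ('k, 'd, 'i) gwa_expr \<Rightarrow> ('k, 'd, 'i) gwa_expr \<Rightarrow> bool"
  for K D \<alpha> \<sigma> a where
  refl: "t \<in> gwa_exprs K D \<alpha> \<Longrightarrow> gwa_cong K D \<alpha> \<sigma> a t t"
| sym: "gwa_cong K D \<alpha> \<sigma> a s t \<Longrightarrow> gwa_cong K D \<alpha> \<sigma> a t s"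
| trans: "\<lbrakk>gwa_cong K D \<alpha> \<sigma> a s t; gwa_cong K D \<alpha> \<sigma> a t u\<rbrakk> \<Longrightarrow> gwa_cong K D \<alpha> \<sigma> a s u"
| add: "\<lbrakk>gwa_cong K D \<alpha> \<sigma> a s s'; gwa_cong K D \<alpha> \<sigma> a t t'\<rbrakk>
    \<Longrightarrow> gwa_cong K D \<alpha> \<sigma> a (Add s t) (Add s' t')"
| neg: "gwa_cong K D \<alpha> \<sigma> a s s' \<Longrightarrow> gwa_cong K D \<alpha> \<sigma> a (Neg s) (Neg s')"
| mul: "\<lbrakk>gwa_cong K D \<alpha> \<sigma> a s s'; gwa_cong K D \<alpha> \<sigma> a t t'\<rbrakk>
    \<Longrightarrow> gwa_cong K D \<alpha> \<sigma> a (Mul s t) (Mul s' t')"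
| scal: "\<lbrakk>c \<in> carrier K; gwa_cong K D \<alpha> \<sigma> a s s'\<rbrakk>
    \<Longrightarrow> gwa_cong K D \<alpha> \<sigma> a (Scal c s) (Scal c s')"
| add_assoc: "\<lbrakk>s \<in> gwa_exprs K D \<alpha>; t \<in> gwa_exprs K D \<alpha>; u \<in> gwa_exprs K D \<alpha>\<rbrakk>
    \<Longrightarrow> gwa_cong K D \<alpha> \<sigma> a (Add (Add s t) u) (Add s (Add t u))"
| add_comm: "\<lbrakk>s \<in> gwa_exprs K D \<alpha>; t \<in> gwa_exprs K D \<alpha>\<rbrakk>
    \<Longrightarrow> gwa_cong K D \<alpha> \<sigma> a (Add s t) (Add t s)"
| add_zero: "s \<in> gwa_exprs K D \<alpha> \<Longrightarrow> gwa_cong K D \<alpha> \<sigma> a (Add (Base \<zero>\<^bsub>D\<^esub>) s) s"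
| add_neg: "s \<in> gwa_exprs K D \<alpha> \<Longrightarrow> gwa_cong K D \<alpha> \<sigma> a (Add (Neg s) s) (Base \<zero>\<^bsub>D\<^esub>)"
| mul_assoc: "\<lbrakk>s \<in> gwa_exprs K D \<alpha>; t \<in> gwa_exprs K D \<alpha>; u \<in> gwa_exprs K D \<alpha>\<rbrakk>
    \<Longrightarrow> gwa_cong K D \<alpha> \<sigma> a (Mul (Mul s t) u) (Mul s (Mul t u))"
| one_mul: "s \<in> gwa_exprs K D \<alpha> \<Longrightarrow> gwa_cong K D \<alpha> \<sigma> a (Mul (Base \<one>\<^bsub>D\<^esub>) s) s"
| mul_one: "s \<in> gwa_exprs K D \<alpha> \<Longrightarrow> gwa_cong K D \<alpha> \<sigma> a (Mul s (Base \<one>\<^bsub>D\<^esub>)) s"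
| distrib_right: "\<lbrakk>s \<in> gwa_exprs K D \<alpha>; t \<in> gwa_exprs K D \<alpha>; u \<in> gwa_exprs K D \<alpha>\<rbrakk>
    \<Longrightarrow> gwa_cong K D \<alpha> \<sigma> a (Mul (Add s t) u) (Add (Mul s u) (Mul t u))"
| distrib_left: "\<lbrakk>s \<in> gwa_exprs K D \<alpha>; t \<in> gwa_exprs K D \<alpha>; u \<in> gwa_exprs K D \<alpha>\<rbrakk>
    \<Longrightarrow> gwa_cong K D \<alpha> \<sigma> a (Mul s (Add t u)) (Add (Mul s t) (Mul s u))"
| scal_add_left: "\<lbrakk>c \<in> carrier K; e \<in> carrier K; s \<in> gwa_exprs K D \<alpha>\<rbrakk>
    \<Longrightarrow> gwa_cong K D \<alpha> \<sigma> a (Scal (c \<oplus>\<^bsub>K\<^esub> e) s) (Add (Scal c s) (Scal e s))"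
| scal_add_right: "\<lbrakk>c \<in> carrier K; s \<in> gwa_exprs K D \<alpha>; t \<in> gwa_exprs K D \<alpha>\<rbrakk>
    \<Longrightarrow> gwa_cong K D \<alpha> \<sigma> a (Scal c (Add s t)) (Add (Scal c s) (Scal c t))"
| scal_assoc: "\<lbrakk>c \<in> carrier K; e \<in> carrier K; s \<in> gwa_exprs K D \<alpha>\<rbrakk>
    \<Longrightarrow> gwa_cong K D \<alpha> \<sigma> a (Scal (c \<otimes>\<^bsub>K\<^esub> e) s) (Scal c (Scal e s))"
| scal_one: "s \<in> gwa_exprs K D \<alpha> \<Longrightarrow> gwa_cong K D \<alpha> \<sigma> a (Scal \<one>\<^bsub>K\<^esub> s) s"
| scal_mul_left: "\<lbrakk>c \<in> carrier K; s \<in> gwa_exprs K D \<alpha>; t \<in> gwa_exprs K D \<alpha>\<rbrakk>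
    \<Longrightarrow> gwa_cong K D \<alpha> \<sigma> a (Mul (Scal c s) t) (Scal c (Mul s t))"
| scal_mul_right: "\<lbrakk>c \<in> carrier K; s \<in> gwa_exprs K D \<alpha>; t \<in> gwa_exprs K D \<alpha>\<rbrakk>
    \<Longrightarrow> gwa_cong K D \<alpha> \<sigma> a (Mul s (Scal c t)) (Scal c (Mul s t))"
| base_add: "\<lbrakk>d \<in> carrier D; e \<in> carrier D\<rbrakk>
    \<Longrightarrow> gwa_cong K D \<alpha> \<sigma> a (Base (d \<oplus>\<^bsub>D\<^esub> e)) (Add (Base d) (Base e))"
| base_mul: "\<lbrakk>d \<in> carrier D; e \<in> carrier D\<rbrakk>
    \<Longrightarrow> gwa_cong K D \<alpha> \<sigma> a (Base (d \<otimes>\<^bsub>D\<^esub> e)) (Mul (Base d) (Base e))"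
| base_scal: "\<lbrakk>c \<in> carrier K; d \<in> carrier D\<rbrakk>
    \<Longrightarrow> gwa_cong K D \<alpha> \<sigma> a (Base (c \<odot>\<^bsub>D\<^esub> d)) (Scal c (Base d))"
| plus_base: "\<lbrakk>\<beta> \<in> Field \<alpha>; d \<in> carrier D\<rbrakk>
    \<Longrightarrow> gwa_cong K D \<alpha> \<sigma> a (Mul (XPlus \<beta>) (Base d)) (Mul (Base (\<sigma> \<beta> d)) (XPlus \<beta>))"
| minus_base: "\<lbrakk>\<beta> \<in> Field \<alpha>; d \<in> carrier D\<rbrakk>
    \<Longrightarrow> gwa_cong K D \<alpha> \<sigma> a (Mul (XMinus \<beta>) (Base d))
          (Mul (Base ((inv\<^bsub>Aut K D\<^esub> (\<sigma> \<beta>)) d)) (XMinus \<beta>))"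
| plus_plus: "\<lbrakk>\<beta> \<in> Field \<alpha>; \<gamma> \<in> Field \<alpha>; \<beta> \<noteq> \<gamma>\<rbrakk>
    \<Longrightarrow> gwa_cong K D \<alpha> \<sigma> a (Mul (XPlus \<beta>) (XPlus \<gamma>)) (Mul (XPlus \<gamma>) (XPlus \<beta>))"
| minus_minus: "\<lbrakk>\<beta> \<in> Field \<alpha>; \<gamma> \<in> Field \<alpha>; \<beta> \<noteq> \<gamma>\<rbrakk>
    \<Longrightarrow> gwa_cong K D \<alpha> \<sigma> a (Mul (XMinus \<beta>) (XMinus \<gamma>)) (Mul (XMinus \<gamma>) (XMinus \<beta>))"
| plus_minus: "\<lbrakk>\<beta> \<in> Field \<alpha>; \<gamma> \<in> Field \<alpha>; \<beta> \<noteq> \<gamma>\<rbrakk>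
    \<Longrightarrow> gwa_cong K D \<alpha> \<sigma> a (Mul (XPlus \<beta>) (XMinus \<gamma>)) (Mul (XMinus \<gamma>) (XPlus \<beta>))"
| minus_plus_same: "\<beta> \<in> Field \<alpha>
    \<Longrightarrow> gwa_cong K D \<alpha> \<sigma> a (Mul (XMinus \<beta>) (XPlus \<beta>)) (Base (a \<beta>))"
| plus_minus_same: "\<beta> \<in> Field \<alpha>
    \<Longrightarrow> gwa_cong K D \<alpha> \<sigma> a (Mul (XPlus \<beta>) (XMinus \<beta>)) (Base (\<sigma> \<beta> (a \<beta>)))"

definition gwa ::
  "('k, 'm) ring_scheme \<Rightarrow> ('k, 'd, 'n) module_scheme \<Rightarrow> 'i rel \<Rightarrow> ('i \<Rightarrow> 'd \<Rightarrow> 'd) \<Rightarrow> ('i \<Rightarrow> 'd)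
    \<Rightarrow> ('k, ('k, 'd, 'i) gwa_expr set) module" where
  "gwa K D \<alpha> \<sigma> a = (let r = {(s, t). gwa_cong K D \<alpha> \<sigma> a s t} in
     \<lparr>carrier = gwa_exprs K D \<alpha> // r,
      monoid.mult = (\<lambda>S T. \<Union>s\<in>S. \<Union>t\<in>T. r `` {Mul s t}),
      one = r `` {Base \<one>\<^bsub>D\<^esub>},
      ring.zero = r `` {Base \<zero>\<^bsub>D\<^esub>},
      add = (\<lambda>S T. \<Union>s\<in>S. \<Union>t\<in>T. r `` {Add s t}),
      smult = (\<lambda>c S. \<Union>s\<in>S. r `` {Scal c s})\<rparr>)"

definition sigma_stable ::
  "('k, 'm) ring_scheme \<Rightarrow> ('k, 'd, 'n) module_scheme \<Rightarrow> 'i rel \<Rightarrow> ('i \<Rightarrow> 'd \<Rightarrow> 'd) \<Rightarrow> 'd set \<Rightarrow> bool"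
  where
  "sigma_stable K D \<alpha> \<sigma> S \<longleftrightarrow>
     S \<subseteq> carrier D \<and> (\<forall>\<beta>\<in>Field \<alpha>. \<forall>j::int. (\<sigma> \<beta> [^]\<^bsub>Aut K D\<^esub> j) ` S \<subseteq> S)"

text \<open>The subgroup generated by the classes of the \<open>\<sigma>\<^sub>\<beta>\<close> in \<open>Aut D / Inn D\<close> is isomorphic to
  \<open>\<int>\<^bsup>\<oplus>\<alpha>\<^esup>\<close> along the canonical map, which sends the standard basis vector \<open>e\<^sub>\<beta>\<close> to the class of
  \<open>\<sigma>\<^sub>\<beta>\<close>. For infinite \<open>\<alpha>\<close> an abstract isomorphism does not imply this (e.g. if \<open>\<sigma>\<^sub>0 = \<sigma>\<^sub>1\<close> and
  the remaining classes are independent), and does not suffice for the simplicity of the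
  generalized Weyl algebra.\<close>

definition outer_class ::
  "('k, 'm) ring_scheme \<Rightarrow> ('k, 'd, 'n) module_scheme \<Rightarrow> ('d \<Rightarrow> 'd) \<Rightarrow> ('d \<Rightarrow> 'd) set" where
  "outer_class K D f = Inn D #>\<^bsub>Aut K D\<^esub> f"

definition outer_free ::
  "('k, 'm) ring_scheme \<Rightarrow> ('k, 'd, 'n) module_scheme \<Rightarrow> 'i rel \<Rightarrow> ('i \<Rightarrow> 'd \<Rightarrow> 'd) \<Rightarrow> bool" where
  "outer_free K D \<alpha> \<sigma> \<longleftrightarrow>
     (\<exists>h \<in> iso (sum_group (Field \<alpha>) (\<lambda>_. integer_group))
               (subgroup_generated (Aut K D Mod Inn D)
                  ((\<lambda>\<beta>. outer_class K D (\<sigma> \<beta>)) ` Field \<alpha>)).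
        \<forall>\<beta>\<in>Field \<alpha>. h (\<lambda>\<gamma>\<in>Field \<alpha>. if \<gamma> = \<beta> then 1 else 0) = outer_class K D (\<sigma> \<beta>))"

definition simple_ring :: "('r, 'm) ring_scheme \<Rightarrow> bool" where
  "simple_ring R \<longleftrightarrow> ring R \<and> carrier R \<noteq> {\<zero>\<^bsub>R\<^esub>} \<and>
     (\<forall>J. ideal J R \<longrightarrow> J = {\<zero>\<^bsub>R\<^esub>} \<or> J = carrier R)"

end

theory Submission
  imports Defs
begin

text \<open>Letting the algebra act on itself shows that it is free as a left \<open>D\<close>-module on the monomials \<open>X\<^sup>z\<close>,
  so an element is a finitely supported coefficient function \<open>f\<close> of \<open>z\<close>. Take a nonzero ideal and a
  nonzero element \<open>f\<close> of smallest support in it. Multiplying by generators, whose contraction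
  factors \<open>\<sigma>\<^sub>i\<^sup>m(a\<^sub>i)\<close> are regular, moves \<open>0\<close> into its support \<open>T\<close>. The constant terms of the elements
  of the ideal supported in \<open>T\<close> form an ideal \<open>C\<close> of \<open>D\<close>. The \<open>d\<close> with \<open>s d \<in> C\<close> for some product \<open>s\<close> of
  elements \<open>\<sigma>\<^sub>i\<^sup>m(a\<^sub>i)\<close> form a \<open>\<sigma>\<close>-stable ideal, so \<open>C\<close> contains such an \<open>s\<close>. Conjugating by high powers of
  \<open>X\<^sub>i\<^sup>+\<close> and of \<open>X\<^sub>i\<^sup>-\<close> replaces the factors of \<open>s\<close> belonging to \<open>i\<close> by translates with \<open>m > 0\<close>, respectively
  \<open>m \<le> 0\<close>; as these are comaximal, the factors belonging to \<open>i\<close> can be cancelled, and \<open>1 \<in> C\<close>. The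
  same argument with \<open>C = 0\<close> gives the regularity of the \<open>\<sigma>\<^sub>i\<^sup>m(a\<^sub>i)\<close>.

  Hence the ideal has an element \<open>y\<close> of minimal support with constant term \<open>1\<close>. By minimality it
  commutes with \<open>D\<close> and with all generators, so each nonzero coefficient \<open>u\<close> of \<open>y\<close> at \<open>z\<close> is fixed by all
  \<open>\<sigma>\<^sub>i\<close> and satisfies \<open>d u = u \<sigma>\<^sup>z(d)\<close>. Then \<open>D u\<close> is a \<open>\<sigma>\<close>-stable ideal, \<open>u\<close> is a unit, \<open>\<sigma>\<^sup>z\<close> is inner and
  \<open>z = 0\<close>. Thus \<open>y = 1\<close>.\<close>

section \<open>Monomials in commuting families\<close>

text \<open>Off the carrier the factor is skipped, so that the fold is over commuting functions on the
  whole type.\<close>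

definition commuting_prod :: "('a, 'b) monoid_scheme \<Rightarrow> ('i \<Rightarrow> 'a) \<Rightarrow> 'i set \<Rightarrow> 'a" where
  "commuting_prod G x F =
     Finite_Set.fold (\<lambda>i y. if x i \<in> carrier G \<and> y \<in> carrier G then x i \<otimes>\<^bsub>G\<^esub> y else y) \<one>\<^bsub>G\<^esub> F"

text \<open>Folding over the larger set requires commutation on all of \<open>insert k F\<close>, so
  both claims share one interpretation over that set. Closure makes the guard in the fold true,
  which the insertion formula needs.\<close>

lemma (in monoid) commuting_prod_insert_closed:
  assumes "finite F" and x: "\<And>i. i \<in> insert k F \<Longrightarrow> x i \<in> carrier G"
    and comm: "\<And>i j. \<lbrakk>i \<in> insert k F; j \<in> insert k F\<rbrakk> \<Longrightarrow> x i \<otimes> x j = x j \<otimes> x i"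
  shows "commuting_prod G x F \<in> carrier G"
    and "k \<notin> F \<Longrightarrow> commuting_prod G x (insert k F) = x k \<otimes> commuting_prod G x F"
proof -
  interpret comp_fun_commute_on "insert k F"
    "\<lambda>i y. if x i \<in> carrier G \<and> y \<in> carrier G then x i \<otimes> y else y"
  proof
    fix i j assume ij: "i \<in> insert k F" "j \<in> insert k F"
    have "x i \<otimes> (x j \<otimes> y) = x j \<otimes> (x i \<otimes> y)" if "y \<in> carrier G" for y
      using that x ij comm[OF ij] by (metis m_assoc)
    then show "(\<lambda>y. if x j \<in> carrier G \<and> y \<in> carrier G then x j \<otimes> y else y) \<circ>
        (\<lambda>y. if x i \<in> carrier G \<and> y \<in> carrier G then x i \<otimes> y else y) =
        (\<lambda>y. if x i \<in> carrier G \<and> y \<in> carrier G then x i \<otimes> y else y) \<circ>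
        (\<lambda>y. if x j \<in> carrier G \<and> y \<in> carrier G then x j \<otimes> y else y)"
      using x ij by (auto simp: fun_eq_iff)
  qed
  have "commuting_prod G x E \<in> carrier G" if "finite E" "E \<subseteq> insert k F" for E
    using that
  proof (induction E rule: finite_induct)
    case empty
    then show ?case by (simp add: commuting_prod_def)
  next
    case (insert i E)
    then show ?case using x by (simp add: commuting_prod_def)
  qed
  then show F: "commuting_prod G x F \<in> carrier G" using assms(1) by blast
  show "commuting_prod G x (insert k F) = x k \<otimes> commuting_prod G x F" if "k \<notin> F"
    using that F x assms(1) by (simp add: commuting_prod_def)
qed

text \<open>The group of finitely supported integer families on \<open>I\<close>, as total functions
  vanishing off \<open>I\<close>; the zero exponent is then the constant function for every
  \<open>I\<close>. \<open>restrict\<close> translates to the extensional elements of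
  \<open>sum_group\<close>.\<close>

definition exponents :: "'i set \<Rightarrow> ('i \<Rightarrow> int) set" where
  "exponents I = {z. finite {i. z i \<noteq> 0} \<and> {i. z i \<noteq> 0} \<subseteq> I}"

lemma zero_exponents: "(\<lambda>_. 0) \<in> exponents I"
  by (simp add: exponents_def)

lemma exponents_update:
  assumes "z \<in> exponents I" "i \<in> I"
  shows "z(i := n) \<in> exponents I"
proof -
  have "{j. (z(i := n)) j \<noteq> 0} \<subseteq> insert i {j. z j \<noteq> 0}" by auto
  from finite_subset[OF this] show ?thesis using assms by (auto simp: exponents_def)
qed

lemma exponents_update_iff:
  assumes "i \<in> I"
  shows "z(i := n) \<in> exponents I \<longleftrightarrow> z \<in> exponents I"
  using exponents_update[OF _ assms, of z n] exponents_update[OF _ assms, of "z(i := n)" "z i"]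
  by auto

text \<open>Every exponent is reached from 0 by unit steps that move a single coordinate away from
  0. The coordinates are filled one after another, by induction on the support.\<close>

lemma exponents_induct [consumes 1, case_names zero Suc pred]:
  assumes "z \<in> exponents I" and zero: "P (\<lambda>_. 0)"
    and up: "\<And>z i. \<lbrakk>z \<in> exponents I; i \<in> I; z i \<ge> 0; P z\<rbrakk> \<Longrightarrow> P (z(i := z i + 1))"
    and down: "\<And>z i. \<lbrakk>z \<in> exponents I; i \<in> I; z i \<le> 0; P z\<rbrakk> \<Longrightarrow> P (z(i := z i - 1))"
  shows "P z"
proof -
  \<comment> \<open>A coordinate that is still 0 can be filled with any integer, counting up or down
    from 0.\<close>
  have one: "P (z(i := n))" if "z \<in> exponents I" "i \<in> I" "z i = 0" "P z" for z i n
  proof (induction n rule: int_induct[where k = 0])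
    case base
    then show ?case using that by (simp add: fun_upd_idem)
  next
    case (step1 n)
    then show ?case using up[OF exponents_update[OF that(1,2)] that(2), of n]
      by (simp add: fun_upd_same del: fun_upd_apply)
  next
    case (step2 n)
    then show ?case using down[OF exponents_update[OF that(1,2)] that(2), of n]
      by (simp add: fun_upd_same del: fun_upd_apply)
  qed
  have "finite F \<Longrightarrow> \<forall>z. z \<in> exponents I \<and> {i. z i \<noteq> 0} = F \<longrightarrow> P z" for F
  proof (induction F rule: finite_induct)
    case empty
    have "z = (\<lambda>_. 0)" if "{i. z i \<noteq> 0} = {}" for z :: "'a \<Rightarrow> int" using that by auto
    then show ?case using zero by blast
  next
    case (insert i F)
    show ?case
    proof (intro allI impI, elim conjE)
      fix z assume z: "z \<in> exponents I" "{j. z j \<noteq> 0} = insert i F"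
      have i: "i \<in> I" using z unfolding exponents_def by auto
      moreover have "{j. (z(i := 0)) j \<noteq> 0} = F" using z(2) insert.hyps by auto
      ultimately have "P (z(i := 0))" using insert.IH exponents_update[OF z(1)] by blast
      then show "P z"
        using one[of "z(i := 0)" i "z i"] exponents_update[OF z(1) i] i by simp
    qed
  qed
  then show ?thesis using assms(1) unfolding exponents_def by auto
qed

text \<open>Only \<open>x i 0 = \<one>\<close> is asked of the family, not additivity in the
  exponent. This covers the powers of \<open>\<sigma> i\<close> in \<open>Aut K D\<close> as well as
  the signed powers of the generators, for which \<open>X_i^+ X_i^-\<close> need not be 1.\<close>

locale commuting_powers = monoid G
  for G :: "('a, 'b) monoid_scheme" (structure) +
  fixes I :: "'i set" and x :: "'i \<Rightarrow> int \<Rightarrow> 'a"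
  assumes x_closed: "i \<in> I \<Longrightarrow> x i n \<in> carrier G"
    and x_zero: "i \<in> I \<Longrightarrow> x i 0 = \<one>"
    and x_commute: "\<lbrakk>i \<in> I; j \<in> I; i \<noteq> j\<rbrakk> \<Longrightarrow> x i m \<otimes> x j n = x j n \<otimes> x i m"
begin

definition monomial :: "('i \<Rightarrow> int) \<Rightarrow> 'a" where
  "monomial z = commuting_prod G (\<lambda>i. x i (z i)) {i. z i \<noteq> 0}"

lemma monomial_closed:
  assumes "z \<in> exponents I"
  shows "monomial z \<in> carrier G"
proof (cases "{i. z i \<noteq> 0} = {}")
  case True
  then show ?thesis by (simp add: monomial_def commuting_prod_def)
next
  case False
  then obtain k where k: "k \<in> {i. z i \<noteq> 0}" by blast
  have S: "insert k {i. z i \<noteq> 0} \<subseteq> I" using k assms unfolding exponents_def by blast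
  show ?thesis unfolding monomial_def
  proof (rule commuting_prod_insert_closed(1)[of _ k])
    show "x i (z i) \<otimes> x j (z j) = x j (z j) \<otimes> x i (z i)"
      if "i \<in> insert k {i. z i \<noteq> 0}" "j \<in> insert k {i. z i \<noteq> 0}" for i j
      using that S x_commute by (cases "i = j") blast+
  qed (use S x_closed assms in \<open>auto simp: exponents_def\<close>)
qed

lemma monomial_zero [simp]: "monomial (\<lambda>_. 0) = \<one>"
  by (simp add: monomial_def commuting_prod_def)

text \<open>Since the factors commute, the one at \<open>i\<close> can be moved to the front. All
  monomials that differ only at \<open>i\<close> thus share a cofactor; for \<open>n = 0\<close> the
  index has left the support and \<open>x_zero\<close> supplies the missing factor.\<close>

lemma monomial_update:
  assumes z: "z \<in> exponents I" and i: "i \<in> I"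
  shows "monomial (z(i := n)) = x i n \<otimes> monomial (z(i := 0))"
proof (cases "n = 0")
  case True
  then show ?thesis using monomial_closed[OF exponents_update[OF z i]] x_zero[OF i] by simp
next
  case False
  let ?F = "{j. j \<noteq> i \<and> z j \<noteq> 0}" and ?x = "\<lambda>j. x j ((z(i := n)) j)"
  have F: "{j. (z(i := n)) j \<noteq> 0} = insert i ?F" "{j. (z(i := 0)) j \<noteq> 0} = ?F"
    using False by auto
  have S: "insert i ?F \<subseteq> I" using z i unfolding exponents_def by auto
  have fin: "finite ?F" using z unfolding exponents_def by (auto elim: finite_subset[rotated])
  have eq: "commuting_prod G (\<lambda>j. x j ((z(i := 0)) j)) ?F = commuting_prod G ?x ?F"
    unfolding commuting_prod_def by (rule Finite_Set.fold_closed_eq[where B = UNIV]) auto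
  have "commuting_prod G ?x (insert i ?F) = ?x i \<otimes> commuting_prod G ?x ?F"
  proof (rule commuting_prod_insert_closed(2)[OF fin])
    show "?x j \<otimes> ?x k = ?x k \<otimes> ?x j" if "j \<in> insert i ?F" "k \<in> insert i ?F" for j k
      using that S x_commute by (cases "j = k") blast+
  qed (use S x_closed in auto)
  then show ?thesis unfolding monomial_def F eq by simp
qed

lemma monomial_split:
  assumes "z \<in> exponents I" "i \<in> I"
  shows "monomial z = x i (z i) \<otimes> monomial (z(i := 0))"
  using monomial_update[OF assms, of "z i"] by simp

end

section \<open>Automorphisms\<close>

lemma (in assoc_algebra) subgroup_alg_auto: "subgroup (alg_auto K D) (BijGroup (carrier D))"
proof (intro group.subgroupI[OF group_BijGroup])
  show "alg_auto K D \<subseteq> carrier (BijGroup (carrier D))"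
    by (auto simp: alg_auto_def BijGroup_def)
  have "(\<lambda>x\<in>carrier D. x) \<in> alg_auto K D"
    by (auto simp: alg_auto_def id_Bij ring_hom_def)
  then show "alg_auto K D \<noteq> {}" by blast
next
  fix f assume f: "f \<in> alg_auto K D"
  then have B: "f \<in> Bij (carrier D)" and h: "f \<in> ring_hom D D" by (auto simp: alg_auto_def)
  let ?g = "inv_into (carrier D) f"
  have f_closed: "\<And>x. x \<in> carrier D \<Longrightarrow> f x \<in> carrier D" using ring_hom_closed[OF h] .
  have g: "\<And>x. x \<in> carrier D \<Longrightarrow> ?g x \<in> carrier D" using Bij_inv_into_mem[OF B] .
  have fg: "\<And>x. x \<in> carrier D \<Longrightarrow> f (?g x) = x"
    using bij_betw_inv_into_right[of f "carrier D" "carrier D"] B by (simp add: Bij_def)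
  have inj: "inj_on f (carrier D)" using B unfolding Bij_def bij_betw_def by blast
  \<comment> \<open>Identities for the inverse are tested by applying \<open>f\<close>, which is
    injective.\<close>
  have eqI: "?g y = x" if "x \<in> carrier D" "f x = y" for x y using that inj by auto
  have "(\<lambda>x\<in>carrier D. ?g x) \<in> ring_hom D D"
  proof (rule ring_hom_memI)
    fix x y assume xy: "x \<in> carrier D" "y \<in> carrier D"
    show "(\<lambda>x\<in>carrier D. ?g x) (x \<otimes>\<^bsub>D\<^esub> y) = (\<lambda>x\<in>carrier D. ?g x) x \<otimes>\<^bsub>D\<^esub> (\<lambda>x\<in>carrier D. ?g x) y"
      using xy g fg ring_hom_mult[OF h] by (auto intro!: eqI)
    show "(\<lambda>x\<in>carrier D. ?g x) (x \<oplus>\<^bsub>D\<^esub> y) = (\<lambda>x\<in>carrier D. ?g x) x \<oplus>\<^bsub>D\<^esub> (\<lambda>x\<in>carrier D. ?g x) y"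
      using xy g fg ring_hom_add[OF h] by (auto intro!: eqI)
  qed (use g ring_hom_one[OF h] in \<open>auto intro!: eqI\<close>)
  moreover have "?g (c \<odot>\<^bsub>D\<^esub> x) = c \<odot>\<^bsub>D\<^esub> ?g x" if "c \<in> carrier K" "x \<in> carrier D" for c x
    using that g fg f by (auto intro!: eqI simp: alg_auto_def)
  ultimately have "(\<lambda>x\<in>carrier D. ?g x) \<in> alg_auto K D"
    using restrict_inv_into_Bij[OF B] by (auto simp: alg_auto_def)
  then show "inv\<^bsub>BijGroup (carrier D)\<^esub> f \<in> alg_auto K D" by (simp only: inv_BijGroup[OF B])
next
  fix f g assume fg: "f \<in> alg_auto K D" "g \<in> alg_auto K D"
  then have B: "f \<in> Bij (carrier D)" "g \<in> Bij (carrier D)"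
    and h: "f \<in> ring_hom D D" "g \<in> ring_hom D D" by (auto simp: alg_auto_def)
  have "compose (carrier D) f g \<in> alg_auto K D"
    using fg compose_Bij[OF B] ring_hom_closed[OF h(1)] ring_hom_closed[OF h(2)]
    by (auto simp: alg_auto_def compose_def ring_hom_def Pi_iff)
  then show "f \<otimes>\<^bsub>BijGroup (carrier D)\<^esub> g \<in> alg_auto K D"
    using B by (simp add: BijGroup_def)
qed

lemma (in assoc_algebra) group_Aut: "group (Aut K D)"
  unfolding Aut_def using subgroup.subgroup_is_group[OF subgroup_alg_auto group_BijGroup] .

lemma carrier_Aut: "carrier (Aut K D) = alg_auto K D"
  by (simp add: Aut_def)

lemma one_Aut: "\<one>\<^bsub>Aut K D\<^esub> = (\<lambda>x\<in>carrier D. x)"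
  by (simp add: Aut_def BijGroup_def)

lemma mult_Aut:
  assumes "f \<in> carrier (Aut K D)" "g \<in> carrier (Aut K D)"
  shows "f \<otimes>\<^bsub>Aut K D\<^esub> g = compose (carrier D) f g"
  using assms by (simp add: Aut_def BijGroup_def alg_auto_def)

lemma mult_Aut_apply:
  assumes "f \<in> carrier (Aut K D)" "g \<in> carrier (Aut K D)" "x \<in> carrier D"
  shows "(f \<otimes>\<^bsub>Aut K D\<^esub> g) x = f (g x)"
  using assms(3) by (simp add: mult_Aut[OF assms(1,2)] compose_eq)

context
  fixes f and K :: "('k, 'm) ring_scheme" and D :: "('k, 'd, 'n) module_scheme"
  assumes f: "f \<in> carrier (Aut K D)"
begin

lemma Aut_ring_hom: "f \<in> ring_hom D D"
  using f by (simp add: carrier_Aut alg_auto_def)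

lemma Aut_extensional: "f \<in> extensional (carrier D)"
  using f by (simp add: carrier_Aut alg_auto_def Bij_def)

lemma Aut_smult: "\<lbrakk>c \<in> carrier K; x \<in> carrier D\<rbrakk> \<Longrightarrow> f (c \<odot>\<^bsub>D\<^esub> x) = c \<odot>\<^bsub>D\<^esub> f x"
  using f by (simp add: carrier_Aut alg_auto_def)

end

section \<open>Inner automorphisms\<close>

lemma (in ring) Units_conj_ring_hom:
  assumes u: "u \<in> Units R"
  shows "(\<lambda>x\<in>carrier R. u \<otimes> x \<otimes> inv u) \<in> ring_hom R R"
proof (rule ring_hom_memI)
  have uc: "u \<in> carrier R" "inv u \<in> carrier R" using u by auto
  then show "(\<lambda>x\<in>carrier R. u \<otimes> x \<otimes> inv u) x \<in> carrier R" if "x \<in> carrier R" for x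
    using that by simp
  show "(\<lambda>x\<in>carrier R. u \<otimes> x \<otimes> inv u) \<one> = \<one>" using u uc by simp
  fix x y assume xy: "x \<in> carrier R" "y \<in> carrier R"
  show "(\<lambda>x\<in>carrier R. u \<otimes> x \<otimes> inv u) (x \<oplus> y) =
      (\<lambda>x\<in>carrier R. u \<otimes> x \<otimes> inv u) x \<oplus> (\<lambda>x\<in>carrier R. u \<otimes> x \<otimes> inv u) y"
    using xy uc by (simp add: l_distr r_distr)
  have "(u \<otimes> x \<otimes> inv u) \<otimes> (u \<otimes> y \<otimes> inv u) = u \<otimes> x \<otimes> (inv u \<otimes> u) \<otimes> y \<otimes> inv u"
    using uc xy by (simp only: m_assoc m_closed)
  also have "\<dots> = u \<otimes> (x \<otimes> y) \<otimes> inv u" using u uc xy by (simp add: m_assoc)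
  finally show "(\<lambda>x\<in>carrier R. u \<otimes> x \<otimes> inv u) (x \<otimes> y) =
      (\<lambda>x\<in>carrier R. u \<otimes> x \<otimes> inv u) x \<otimes> (\<lambda>x\<in>carrier R. u \<otimes> x \<otimes> inv u) y"
    using xy uc by simp
qed

context assoc_algebra
begin

lemma conj_conj:
  assumes "u \<in> Units D" "v \<in> Units D" "x \<in> carrier D"
  shows "u \<otimes>\<^bsub>D\<^esub> (v \<otimes>\<^bsub>D\<^esub> x \<otimes>\<^bsub>D\<^esub> inv\<^bsub>D\<^esub> v) \<otimes>\<^bsub>D\<^esub> inv\<^bsub>D\<^esub> u =
    (u \<otimes>\<^bsub>D\<^esub> v) \<otimes>\<^bsub>D\<^esub> x \<otimes>\<^bsub>D\<^esub> inv\<^bsub>D\<^esub> (u \<otimes>\<^bsub>D\<^esub> v)"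
proof -
  have uv: "u \<in> carrier D" "v \<in> carrier D" "inv\<^bsub>D\<^esub> u \<in> carrier D" "inv\<^bsub>D\<^esub> v \<in> carrier D"
    using assms by auto
  have "u \<otimes>\<^bsub>D\<^esub> v \<otimes>\<^bsub>D\<^esub> (inv\<^bsub>D\<^esub> v \<otimes>\<^bsub>D\<^esub> inv\<^bsub>D\<^esub> u) = u \<otimes>\<^bsub>D\<^esub> (v \<otimes>\<^bsub>D\<^esub> inv\<^bsub>D\<^esub> v) \<otimes>\<^bsub>D\<^esub> inv\<^bsub>D\<^esub> u"
    "inv\<^bsub>D\<^esub> v \<otimes>\<^bsub>D\<^esub> inv\<^bsub>D\<^esub> u \<otimes>\<^bsub>D\<^esub> (u \<otimes>\<^bsub>D\<^esub> v) = inv\<^bsub>D\<^esub> v \<otimes>\<^bsub>D\<^esub> (inv\<^bsub>D\<^esub> u \<otimes>\<^bsub>D\<^esub> u) \<otimes>\<^bsub>D\<^esub> v"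
    using uv by (simp_all only: D.m_assoc D.m_closed)
  then have "inv\<^bsub>D\<^esub> v \<otimes>\<^bsub>D\<^esub> inv\<^bsub>D\<^esub> u = inv\<^bsub>D\<^esub> (u \<otimes>\<^bsub>D\<^esub> v)"
    using assms uv by (intro D.inv_unique') simp_all
  then show ?thesis using assms uv by (simp add: D.m_assoc flip: \<open>inv\<^bsub>D\<^esub> v \<otimes>\<^bsub>D\<^esub> inv\<^bsub>D\<^esub> u = _\<close>)
qed

lemma Inn_alg_auto: "Inn D \<subseteq> alg_auto K D"
proof
  fix f assume "f \<in> Inn D"
  then obtain u where u: "u \<in> Units D" and f: "f = (\<lambda>x\<in>carrier D. u \<otimes>\<^bsub>D\<^esub> x \<otimes>\<^bsub>D\<^esub> inv\<^bsub>D\<^esub> u)"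
    unfolding Inn_def by blast
  have uc: "u \<in> carrier D" "inv\<^bsub>D\<^esub> u \<in> carrier D" using u by auto
  have "bij_betw f (carrier D) (carrier D)"
    by (rule bij_betw_byWitness[where f' = "\<lambda>x. inv\<^bsub>D\<^esub> u \<otimes>\<^bsub>D\<^esub> x \<otimes>\<^bsub>D\<^esub> u"])
      (use u uc conj_conj[of "inv\<^bsub>D\<^esub> u" u] conj_conj[of u "inv\<^bsub>D\<^esub> u"] in \<open>simp_all add: f image_subset_iff\<close>)
  moreover have "f (c \<odot>\<^bsub>D\<^esub> x) = c \<odot>\<^bsub>D\<^esub> f x" if "c \<in> carrier K" "x \<in> carrier D" for c x
    using that uc by (simp add: f smult_mult_left smult_mult_right)
  ultimately show "f \<in> alg_auto K D"
    using D.Units_conj_ring_hom[OF u] by (auto simp: alg_auto_def Bij_def f)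
qed

text \<open>If \<open>h\<close> is conjugation by \<open>u\<close>, then \<open>f h = k f\<close>
  where \<open>k\<close> is conjugation by \<open>f u\<close>, so \<open>f h f^-1\<close> is again
  inner. Normality makes the factor group in \<open>outer_free\<close> a group.\<close>

lemma Inn_normal: "Inn D \<lhd> Aut K D"
proof -
  interpret G: group "Aut K D" by (rule group_Aut)
  have sub: "Inn D \<subseteq> carrier (Aut K D)" using Inn_alg_auto by (simp add: carrier_Aut)
  have mult: "(\<lambda>x\<in>carrier D. u \<otimes>\<^bsub>D\<^esub> x \<otimes>\<^bsub>D\<^esub> inv\<^bsub>D\<^esub> u) \<otimes>\<^bsub>Aut K D\<^esub> (\<lambda>x\<in>carrier D. v \<otimes>\<^bsub>D\<^esub> x \<otimes>\<^bsub>D\<^esub> inv\<^bsub>D\<^esub> v)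
      = (\<lambda>x\<in>carrier D. (u \<otimes>\<^bsub>D\<^esub> v) \<otimes>\<^bsub>D\<^esub> x \<otimes>\<^bsub>D\<^esub> inv\<^bsub>D\<^esub> (u \<otimes>\<^bsub>D\<^esub> v))"
    if "u \<in> Units D" "v \<in> Units D" for u v
  proof -
    have "(\<lambda>x\<in>carrier D. u \<otimes>\<^bsub>D\<^esub> x \<otimes>\<^bsub>D\<^esub> inv\<^bsub>D\<^esub> u) \<in> carrier (Aut K D)"
      "(\<lambda>x\<in>carrier D. v \<otimes>\<^bsub>D\<^esub> x \<otimes>\<^bsub>D\<^esub> inv\<^bsub>D\<^esub> v) \<in> carrier (Aut K D)"
      using that sub unfolding Inn_def by blast+
    then show ?thesis
      using that by (auto simp: mult_Aut compose_def conj_conj D.Units_closed intro!: restrict_ext)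
  qed
  have one: "(\<lambda>x\<in>carrier D. \<one>\<^bsub>D\<^esub> \<otimes>\<^bsub>D\<^esub> x \<otimes>\<^bsub>D\<^esub> inv\<^bsub>D\<^esub> \<one>\<^bsub>D\<^esub>) = \<one>\<^bsub>Aut K D\<^esub>"
    by (simp add: one_Aut cong: restrict_cong)
  show ?thesis
  proof (rule G.normal_invI)
    show "subgroup (Inn D) (Aut K D)"
    proof (rule G.subgroupI[OF sub])
      show "Inn D \<noteq> {}" unfolding Inn_def by blast
      fix f assume "f \<in> Inn D"
      then obtain u where u: "u \<in> Units D" and f: "f = (\<lambda>x\<in>carrier D. u \<otimes>\<^bsub>D\<^esub> x \<otimes>\<^bsub>D\<^esub> inv\<^bsub>D\<^esub> u)"
        unfolding Inn_def by blast
      let ?g = "\<lambda>x\<in>carrier D. inv\<^bsub>D\<^esub> u \<otimes>\<^bsub>D\<^esub> x \<otimes>\<^bsub>D\<^esub> inv\<^bsub>D\<^esub> (inv\<^bsub>D\<^esub> u)"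
      have g: "?g \<in> Inn D" using u unfolding Inn_def by blast
      have "?g \<otimes>\<^bsub>Aut K D\<^esub> f = \<one>\<^bsub>Aut K D\<^esub>" using u mult[of "inv\<^bsub>D\<^esub> u" u] one by (simp add: f)
      then have "inv\<^bsub>Aut K D\<^esub> f = ?g" using g sub \<open>f \<in> Inn D\<close> by (intro G.inv_equality) auto
      with g show "inv\<^bsub>Aut K D\<^esub> f \<in> Inn D" by simp
      fix h assume "h \<in> Inn D"
      then obtain v where v: "v \<in> Units D" and h: "h = (\<lambda>x\<in>carrier D. v \<otimes>\<^bsub>D\<^esub> x \<otimes>\<^bsub>D\<^esub> inv\<^bsub>D\<^esub> v)"
        unfolding Inn_def by blast
      show "f \<otimes>\<^bsub>Aut K D\<^esub> h \<in> Inn D"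
        using u v mult[OF u v] unfolding f h Inn_def by auto
    qed
  next
    fix f h assume f: "f \<in> carrier (Aut K D)" and "h \<in> Inn D"
    then obtain u where u: "u \<in> Units D" and h: "h = (\<lambda>x\<in>carrier D. u \<otimes>\<^bsub>D\<^esub> x \<otimes>\<^bsub>D\<^esub> inv\<^bsub>D\<^esub> u)"
      unfolding Inn_def by blast
    have hA: "h \<in> carrier (Aut K D)" using \<open>h \<in> Inn D\<close> sub by blast
    note hom = Aut_ring_hom[OF f]
    have uc: "u \<in> carrier D" "inv\<^bsub>D\<^esub> u \<in> carrier D" using u by auto
    have fuc: "f u \<in> carrier D" "f (inv\<^bsub>D\<^esub> u) \<in> carrier D" using ring_hom_closed[OF hom] uc by auto
    have l: "f (inv\<^bsub>D\<^esub> u) \<otimes>\<^bsub>D\<^esub> f u = \<one>\<^bsub>D\<^esub>" and r: "f u \<otimes>\<^bsub>D\<^esub> f (inv\<^bsub>D\<^esub> u) = \<one>\<^bsub>D\<^esub>"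
      using u uc ring_hom_mult[OF hom, symmetric] ring_hom_one[OF hom] by auto
    have fu: "f u \<in> Units D" using l r fuc unfolding Units_def by blast
    have fi: "inv\<^bsub>D\<^esub> (f u) = f (inv\<^bsub>D\<^esub> u)" using D.inv_unique'[OF fuc r l] by simp
    let ?k = "\<lambda>x\<in>carrier D. f u \<otimes>\<^bsub>D\<^esub> x \<otimes>\<^bsub>D\<^esub> inv\<^bsub>D\<^esub> (f u)"
    have k: "?k \<in> Inn D" using fu unfolding Inn_def by blast
    have "f \<otimes>\<^bsub>Aut K D\<^esub> h = ?k \<otimes>\<^bsub>Aut K D\<^esub> f"
    proof -
      have "f (h x) = ?k (f x)" if "x \<in> carrier D" for x
        using that uc ring_hom_closed[OF hom] ring_hom_mult[OF hom] by (simp add: h fi)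
      then show ?thesis
        using f hA subsetD[OF sub k] by (auto simp: mult_Aut compose_def intro!: restrict_ext)
    qed
    then have "?k = f \<otimes>\<^bsub>Aut K D\<^esub> h \<otimes>\<^bsub>Aut K D\<^esub> inv\<^bsub>Aut K D\<^esub> f"
      by (rule G.inv_solve_right[OF subsetD[OF sub k] G.m_closed[OF f hA] f, THEN iffD2])
    with k show "f \<otimes>\<^bsub>Aut K D\<^esub> h \<otimes>\<^bsub>Aut K D\<^esub> inv\<^bsub>Aut K D\<^esub> f \<in> Inn D" by simp
  qed
qed

end

section \<open>Powers of the automorphisms \<open>\<sigma> i\<close>\<close>

lemma (in group) commute_int_pow:
  assumes "x \<in> carrier G" "y \<in> carrier G" "x \<otimes> y = y \<otimes> x"
  shows "x [^] (m::int) \<otimes> y = y \<otimes> x [^] m"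
proof (induction m rule: int_induct[where k = 0])
  case base
  then show ?case using assms by simp
next
  case (step1 m)
  have "x [^] (m + 1) \<otimes> y = x [^] m \<otimes> (x \<otimes> y)"
    using assms by (simp add: int_pow_mult m_assoc)
  also have "\<dots> = x [^] m \<otimes> y \<otimes> x" using assms by (simp add: m_assoc)
  also have "\<dots> = y \<otimes> x [^] (m + 1)" using assms step1 by (simp add: int_pow_mult m_assoc)
  finally show ?case .
next
  case (step2 m)
  have "inv x \<otimes> y \<otimes> x = y"
    using assms by (metis inv_closed inv_solve_left m_assoc m_closed)
  then have inv: "inv x \<otimes> y = y \<otimes> inv x" using assms by (metis inv_closed inv_solve_right m_closed)
  have pow: "x [^] (m - 1) = x [^] m \<otimes> inv x"
    using assms int_pow_mult[of x m "-1"] by (simp add: int_pow_neg)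
  have "x [^] (m - 1) \<otimes> y = x [^] m \<otimes> y \<otimes> inv x" using assms inv by (simp add: pow m_assoc)
  also have "\<dots> = y \<otimes> x [^] (m - 1)" using assms step2 by (simp add: pow m_assoc)
  finally show ?case .
qed

context gwa_datum
begin

sublocale AutD: group "Aut K D" by (rule group_Aut)

sublocale twist: commuting_powers "Aut K D" "Field \<alpha>" "\<lambda>i n::int. \<sigma> i [^]\<^bsub>Aut K D\<^esub> n"
proof
  show "\<sigma> i [^]\<^bsub>Aut K D\<^esub> (m::int) \<otimes>\<^bsub>Aut K D\<^esub> \<sigma> j [^]\<^bsub>Aut K D\<^esub> (n::int) =
      \<sigma> j [^]\<^bsub>Aut K D\<^esub> n \<otimes>\<^bsub>Aut K D\<^esub> \<sigma> i [^]\<^bsub>Aut K D\<^esub> m" if "i \<in> Field \<alpha>" "j \<in> Field \<alpha>" for i j m n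
    using that \<sigma>_auto \<sigma>_commute
    by (intro AutD.commute_int_pow AutD.commute_int_pow[symmetric]) auto
qed (use \<sigma>_auto in auto)

definition \<sigma>_pow :: "'i \<Rightarrow> int \<Rightarrow> 'd \<Rightarrow> 'd" where
  "\<sigma>_pow i n = \<sigma> i [^]\<^bsub>Aut K D\<^esub> n"

lemma \<sigma>_pow_Aut: "i \<in> Field \<alpha> \<Longrightarrow> \<sigma>_pow i n \<in> carrier (Aut K D)"
  using \<sigma>_auto by (simp add: \<sigma>_pow_def)

lemmas \<sigma>_pow_hom = Aut_ring_hom[OF \<sigma>_pow_Aut]

lemma \<sigma>_pow_closed [simp]: "\<lbrakk>i \<in> Field \<alpha>; d \<in> carrier D\<rbrakk> \<Longrightarrow> \<sigma>_pow i n d \<in> carrier D"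
  using ring_hom_closed[OF \<sigma>_pow_hom] .

lemma \<sigma>_pow_mult: "\<lbrakk>i \<in> Field \<alpha>; d \<in> carrier D; e \<in> carrier D\<rbrakk>
    \<Longrightarrow> \<sigma>_pow i n (d \<otimes>\<^bsub>D\<^esub> e) = \<sigma>_pow i n d \<otimes>\<^bsub>D\<^esub> \<sigma>_pow i n e"
  using ring_hom_mult[OF \<sigma>_pow_hom] .

lemma \<sigma>_pow_add: "\<lbrakk>i \<in> Field \<alpha>; d \<in> carrier D; e \<in> carrier D\<rbrakk>
    \<Longrightarrow> \<sigma>_pow i n (d \<oplus>\<^bsub>D\<^esub> e) = \<sigma>_pow i n d \<oplus>\<^bsub>D\<^esub> \<sigma>_pow i n e"
  using ring_hom_add[OF \<sigma>_pow_hom] .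

lemma \<sigma>_pow_one [simp]: "i \<in> Field \<alpha> \<Longrightarrow> \<sigma>_pow i n \<one>\<^bsub>D\<^esub> = \<one>\<^bsub>D\<^esub>"
  using ring_hom_one[OF \<sigma>_pow_hom] .

lemma \<sigma>_pow_zero [simp]: "i \<in> Field \<alpha> \<Longrightarrow> \<sigma>_pow i n \<zero>\<^bsub>D\<^esub> = \<zero>\<^bsub>D\<^esub>"
  using ring_hom_zero[OF \<sigma>_pow_hom D.ring_axioms D.ring_axioms] .

lemma \<sigma>_pow_smult: "\<lbrakk>i \<in> Field \<alpha>; c \<in> carrier K; d \<in> carrier D\<rbrakk>
    \<Longrightarrow> \<sigma>_pow i n (c \<odot>\<^bsub>D\<^esub> d) = c \<odot>\<^bsub>D\<^esub> \<sigma>_pow i n d"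
  using Aut_smult[OF \<sigma>_pow_Aut] .

lemma \<sigma>_pow_0 [simp]: "d \<in> carrier D \<Longrightarrow> \<sigma>_pow i 0 d = d"
  by (simp add: \<sigma>_pow_def one_Aut)

lemma \<sigma>_pow_1: "i \<in> Field \<alpha> \<Longrightarrow> \<sigma>_pow i 1 = \<sigma> i"
  using \<sigma>_auto by (simp add: \<sigma>_pow_def)

lemma \<sigma>_pow_minus_1: "i \<in> Field \<alpha> \<Longrightarrow> \<sigma>_pow i (-1) = inv\<^bsub>Aut K D\<^esub> (\<sigma> i)"
  using \<sigma>_auto by (simp add: \<sigma>_pow_def AutD.int_pow_neg)

lemma \<sigma>_pow_nat: "\<sigma>_pow i (int n) = \<sigma> i [^]\<^bsub>Aut K D\<^esub> n"
  by (simp add: \<sigma>_pow_def int_pow_int)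

lemma \<sigma>_pow_\<sigma>_pow: "\<lbrakk>i \<in> Field \<alpha>; d \<in> carrier D\<rbrakk> \<Longrightarrow> \<sigma>_pow i m (\<sigma>_pow i n d) = \<sigma>_pow i (m + n) d"
  using \<sigma>_auto by (simp add: \<sigma>_pow_def AutD.int_pow_mult mult_Aut_apply)

lemma \<sigma>_pow_commute: "\<lbrakk>i \<in> Field \<alpha>; j \<in> Field \<alpha>; d \<in> carrier D\<rbrakk>
    \<Longrightarrow> \<sigma>_pow i m (\<sigma>_pow j n d) = \<sigma>_pow j n (\<sigma>_pow i m d)"
  using twist.x_commute[of i j m n] \<sigma>_pow_\<sigma>_pow[of i d]
  by (cases "i = j") (auto simp: \<sigma>_pow_def add.commute simp flip: mult_Aut_apply[OF \<sigma>_pow_Aut \<sigma>_pow_Aut, unfolded \<sigma>_pow_def])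

lemma \<sigma>_pow_fixes:
  assumes i: "i \<in> Field \<alpha>" and d: "d \<in> carrier D" and "\<sigma> i d = d"
  shows "\<sigma>_pow i n d = d"
proof (induction n rule: int_induct[where k = 0])
  case base
  then show ?case using d by simp
next
  case (step1 n)
  then show ?case using assms \<sigma>_pow_\<sigma>_pow[OF i d, of 1 n] by (simp add: \<sigma>_pow_1 add.commute)
next
  case (step2 n)
  have "\<sigma>_pow i (-1) d = d" using assms \<sigma>_pow_\<sigma>_pow[OF i d, of "-1" 1] by (simp add: \<sigma>_pow_1)
  then show ?case using step2 \<sigma>_pow_\<sigma>_pow[OF i d, of "-1" n] by simp
qed

lemma \<sigma>_pow_fixes_a [simp]:
  "\<lbrakk>i \<in> Field \<alpha>; j \<in> Field \<alpha>; i \<noteq> j\<rbrakk> \<Longrightarrow> \<sigma>_pow i n (a j) = a j"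
  using \<sigma>_pow_fixes \<sigma>_fixes_a a_carrier by metis

text \<open>An automorphism preserves the center: \<open>d\<close> is the image of
  \<open>?e\<close>, and \<open>a i\<close> commutes with \<open>?e\<close>.\<close>

lemma \<sigma>_pow_a_central:
  assumes "i \<in> Field \<alpha>" "d \<in> carrier D"
  shows "\<sigma>_pow i n (a i) \<otimes>\<^bsub>D\<^esub> d = d \<otimes>\<^bsub>D\<^esub> \<sigma>_pow i n (a i)"
proof -
  let ?e = "\<sigma>_pow i (-n) d"
  have "\<sigma>_pow i n (a i \<otimes>\<^bsub>D\<^esub> ?e) = \<sigma>_pow i n (?e \<otimes>\<^bsub>D\<^esub> a i)" using assms a_central by simp
  then show ?thesis using assms a_carrier by (simp add: \<sigma>_pow_mult \<sigma>_pow_\<sigma>_pow)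
qed

text \<open>The automorphism by which elements of \<open>D\<close> pass a monomial:
  \<open>X^z d = twist z d X^z\<close>.\<close>

definition twist :: "('i \<Rightarrow> int) \<Rightarrow> 'd \<Rightarrow> 'd" where
  "twist z = twist.monomial z"

lemma twist_Aut: "z \<in> exponents (Field \<alpha>) \<Longrightarrow> twist z \<in> carrier (Aut K D)"
  using twist.monomial_closed by (simp add: twist_def)

lemmas twist_hom = Aut_ring_hom[OF twist_Aut]

lemma twist_closed [simp]:
  "\<lbrakk>z \<in> exponents (Field \<alpha>); d \<in> carrier D\<rbrakk> \<Longrightarrow> twist z d \<in> carrier D"
  using ring_hom_closed[OF twist_hom] .

lemma twist_0: "d \<in> carrier D \<Longrightarrow> twist (\<lambda>_. 0) d = d"
  by (simp add: twist_def one_Aut)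

text \<open>Powers of one automorphism add up, so no contraction factor appears, in contrast to the
  monomials in the generators. The identity is stated in the group because
  \<open>twist_not_inner\<close> computes with cosets.\<close>

lemma twist_update_Aut:
  assumes z: "z \<in> exponents (Field \<alpha>)" and i: "i \<in> Field \<alpha>"
  shows "twist (z(i := z i + n)) = \<sigma>_pow i n \<otimes>\<^bsub>Aut K D\<^esub> twist z"
proof -
  have z0: "twist (z(i := 0)) \<in> carrier (Aut K D)" using twist_Aut exponents_update[OF z i] by blast
  have s: "\<sigma>_pow i (z i) \<in> carrier (Aut K D)" "\<sigma>_pow i n \<in> carrier (Aut K D)"
    using \<sigma>_pow_Aut[OF i] by auto
  have "twist (z(i := z i + n)) = \<sigma>_pow i (n + z i) \<otimes>\<^bsub>Aut K D\<^esub> twist (z(i := 0))"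
    unfolding twist_def \<sigma>_pow_def using twist.monomial_update[OF z i, of "z i + n"]
    by (simp only: add.commute[of n])
  also have "\<sigma>_pow i (n + z i) = \<sigma>_pow i n \<otimes>\<^bsub>Aut K D\<^esub> \<sigma>_pow i (z i)"
    using \<sigma>_auto[OF i] by (simp add: \<sigma>_pow_def AutD.int_pow_mult)
  also have "\<dots> \<otimes>\<^bsub>Aut K D\<^esub> twist (z(i := 0)) =
      \<sigma>_pow i n \<otimes>\<^bsub>Aut K D\<^esub> (\<sigma>_pow i (z i) \<otimes>\<^bsub>Aut K D\<^esub> twist (z(i := 0)))"
    using s z0 by (simp add: AutD.m_assoc)
  also have "\<sigma>_pow i (z i) \<otimes>\<^bsub>Aut K D\<^esub> twist (z(i := 0)) = twist z"
    unfolding twist_def \<sigma>_pow_def by (rule twist.monomial_split[OF z i, symmetric])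
  finally show ?thesis .
qed

lemma twist_update:
  assumes "z \<in> exponents (Field \<alpha>)" "i \<in> Field \<alpha>" "d \<in> carrier D"
  shows "twist (z(i := z i + n)) d = \<sigma>_pow i n (twist z d)"
  using mult_Aut_apply[OF \<sigma>_pow_Aut twist_Aut assms(3)] twist_update_Aut assms by simp

text \<open>The isomorphism sends the basis vector at \<open>i\<close> to the class of
  \<open>\<sigma> i\<close>, hence \<open>z\<close> to the class of \<open>twist z\<close>, by
  walking to \<open>z\<close> in unit steps. An inner \<open>twist z\<close> has trivial class, and
  injectivity gives \<open>z = 0\<close>.\<close>

lemma twist_not_inner:
  assumes free: "outer_free K D \<alpha> \<sigma>" and z: "z \<in> exponents (Field \<alpha>)" and inn: "twist z \<in> Inn D"
  shows "z = (\<lambda>_. 0)"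
proof -
  define S where "S = sum_group (Field \<alpha>) (\<lambda>_. integer_group)"
  define Q where "Q = Aut K D Mod Inn D"
  define H where "H = subgroup_generated Q ((\<lambda>i. outer_class K D (\<sigma> i)) ` Field \<alpha>)"
  interpret N: normal "Inn D" "Aut K D" by (rule Inn_normal)
  interpret Q: group Q unfolding Q_def by (rule N.factorgroup_is_group)
  interpret S: group S unfolding S_def by simp
  interpret H: group H unfolding H_def by simp
  obtain h where iso: "h \<in> iso S H"
    and h: "\<And>i. i \<in> Field \<alpha> \<Longrightarrow>
        h (\<lambda>j\<in>Field \<alpha>. if j = i then 1 else 0) = outer_class K D (\<sigma> i)"
    using free unfolding outer_free_def S_def H_def Q_def by blast
  have hom: "h \<in> hom S H" and inj: "inj_on h (carrier S)"
    using iso by (auto simp: iso_def bij_betw_def)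
  have H_mult: "x \<otimes>\<^bsub>H\<^esub> y = x <#>\<^bsub>Aut K D\<^esub> y" for x y
    by (simp add: H_def Q_def FactGroup_def subgroup_generated_def)
  have S: "restrict w (Field \<alpha>) \<in> carrier S" if "w \<in> exponents (Field \<alpha>)" for w
    using that by (auto simp: S_def carrier_sum_group exponents_def elim: finite_subset[rotated])
  have e: "(\<lambda>j\<in>Field \<alpha>. if j = i then 1 else (0::int)) \<in> carrier S" if "i \<in> Field \<alpha>" for i
    using S[OF exponents_update[OF zero_exponents that, of 1]] by (simp add: fun_upd_def)
  have class_mult: "outer_class K D f <#>\<^bsub>Aut K D\<^esub> outer_class K D g = outer_class K D (f \<otimes>\<^bsub>Aut K D\<^esub> g)"
    if "f \<in> carrier (Aut K D)" "g \<in> carrier (Aut K D)" for f g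
    unfolding outer_class_def using N.rcos_sum[OF that] .
  have class_one: "outer_class K D f = \<one>\<^bsub>H\<^esub>" if "f \<in> Inn D" for f
    unfolding outer_class_def H_def Q_def
    using that AutD.coset_join2[OF _ N.subgroup_axioms] N.subset by (auto simp: FactGroup_def)
  have step: "h (restrict (w(i := w i + 1)) (Field \<alpha>)) =
      outer_class K D (\<sigma> i) \<otimes>\<^bsub>H\<^esub> h (restrict w (Field \<alpha>))"
    if "w \<in> exponents (Field \<alpha>)" "i \<in> Field \<alpha>" for w i
  proof -
    have "restrict (w(i := w i + 1)) (Field \<alpha>) =
        (\<lambda>j\<in>Field \<alpha>. if j = i then 1 else 0) \<otimes>\<^bsub>S\<^esub> restrict w (Field \<alpha>)"
      by (auto simp: S_def)
    then show ?thesis using hom_mult[OF hom e S] that h by simp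
  qed
  have "h (restrict z (Field \<alpha>)) = outer_class K D (twist z)"
    using z
  proof (induction rule: exponents_induct)
    case zero
    have "twist (\<lambda>_. 0) \<in> Inn D" using N.one_closed by (simp add: twist_def)
    moreover have "restrict (\<lambda>_. 0) (Field \<alpha>) = \<one>\<^bsub>S\<^esub>" by (simp add: S_def)
    ultimately show ?case
      using hom_one[OF hom S.is_group H.is_group] class_one by simp
  next
    case (Suc z i)
    then show ?case
      by (simp only: step twist_update_Aut class_mult[OF \<sigma>_auto twist_Aut] H_mult \<sigma>_pow_1)
  next
    case (pred z i)
    let ?w = "z(i := z i - 1)"
    have w: "?w \<in> exponents (Field \<alpha>)" by (rule exponents_update) fact+
    have tw: "twist ?w \<in> carrier (Aut K D)" using twist_Aut w .
    have c: "outer_class K D (\<sigma> i) \<in> carrier H"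
      using hom_in_carrier[OF hom e[OF \<open>i \<in> Field \<alpha>\<close>]] h[OF \<open>i \<in> Field \<alpha>\<close>] by (simp only:)
    \<comment> \<open>The step down is the step up from \<open>?w\<close> to \<open>z\<close>
      followed by cancelling the class of \<open>\<sigma> i\<close>. The cancellation is done in
      \<open>Q\<close>, since the class of \<open>twist ?w\<close> is not yet known to lie in
      \<open>H\<close>.\<close>
    have "outer_class K D (\<sigma> i) \<otimes>\<^bsub>H\<^esub> h (restrict ?w (Field \<alpha>)) = outer_class K D (twist z)"
      using step[OF w \<open>i \<in> Field \<alpha>\<close>] pred by (simp add: fun_upd_same del: fun_upd_apply)
    also have "\<dots> = outer_class K D (\<sigma> i) \<otimes>\<^bsub>H\<^esub> outer_class K D (twist ?w)"
      using twist_update_Aut[OF w \<open>i \<in> Field \<alpha>\<close>, of 1] class_mult[OF \<sigma>_auto tw] pred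
      by (simp add: H_mult \<sigma>_pow_1 fun_upd_same del: fun_upd_apply)
    finally have eq: "outer_class K D (\<sigma> i) \<otimes>\<^bsub>Q\<^esub> h (restrict ?w (Field \<alpha>)) =
        outer_class K D (\<sigma> i) \<otimes>\<^bsub>Q\<^esub> outer_class K D (twist ?w)"
      by (simp add: H_def subgroup_generated_def)
    have HQ: "carrier H \<subseteq> carrier Q" unfolding H_def by (rule Q.carrier_subgroup_generated_subset)
    have "outer_class K D (twist ?w) \<in> carrier Q"
      using tw unfolding Q_def outer_class_def by (auto simp: FactGroup_def RCOSETS_def)
    then show ?case
      using eq Q.l_cancel subsetD[OF HQ c] subsetD[OF HQ hom_in_carrier[OF hom S[OF w]]]
      by blast
  qed
  then have "h (restrict z (Field \<alpha>)) = h \<one>\<^bsub>S\<^esub>"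
    using hom_one[OF hom S.is_group H.is_group] class_one[OF inn] by simp
  then have "restrict z (Field \<alpha>) = \<one>\<^bsub>S\<^esub>" using inj S[OF z] by (auto dest: inj_onD)
  then have "z i = 0" if "i \<in> Field \<alpha>" for i
    using that by (metis S_def one_integer_group one_sum_group restrict_apply')
  then show ?thesis using z by (auto simp: exponents_def)
qed

section \<open>The regular representation\<close>

text \<open>With \<open>X\<^sup>z\<close> the product of the powers \<open>(X\<^sub>i\<^sup>+)\<^bsup>z i\<^esup>\<close> (\<open>z i \<ge> 0\<close>) and \<open>(X\<^sub>i\<^sup>-)\<^bsup>-z i\<^esup>\<close> (\<open>z i < 0\<close>), a function
  \<open>f\<close> stands for \<open>\<Sum>z. f z X\<^sup>z\<close>. For \<open>\<epsilon> = \<plusminus>1\<close>, the generator \<open>X\<^sub>i\<^sup>\<epsilon>\<close> multiplies \<open>X\<^sup>z\<close> into \<open>X\<close> to the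
  power \<open>z\<close> shifted by \<open>\<epsilon>\<close> at \<open>i\<close>, up to the scalar \<open>left_coeff\<close> (from the left) or \<open>right_coeff\<close>
  (from the right), which is nontrivial when an \<open>X\<^sub>i\<^sup>+\<close> meets an \<open>X\<^sub>i\<^sup>-\<close>.\<close>

definition left_coeff :: "'i \<Rightarrow> int \<Rightarrow> int \<Rightarrow> 'd" where
  "left_coeff i \<epsilon> n = (if \<epsilon> * n \<ge> 0 then \<one>\<^bsub>D\<^esub> else \<sigma>_pow i (max \<epsilon> 0) (a i))"

text \<open>The contraction takes place at the right end of \<open>X_i^n\<close>, and its value must
  pass the remaining \<open>|n| - 1\<close> factors to reach the left; hence the dependence on
  \<open>n\<close>.\<close>

definition right_coeff :: "'i \<Rightarrow> int \<Rightarrow> int \<Rightarrow> 'd" where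
  "right_coeff i \<epsilon> n = (if \<epsilon> * n \<ge> 0 then \<one>\<^bsub>D\<^esub> else \<sigma>_pow i (n + max \<epsilon> 0) (a i))"

text \<open>Both shift operators are read at the target exponent: the value at \<open>z\<close>
  comes from \<open>z\<close> with \<open>\<epsilon>\<close> subtracted at \<open>i\<close>. Left
  multiplication moves the generator past the coefficient and so applies
  \<open>\<sigma>_pow i \<epsilon>\<close>; right multiplication does not.\<close>

definition left_X :: "'i \<Rightarrow> int \<Rightarrow> (('i \<Rightarrow> int) \<Rightarrow> 'd) \<Rightarrow> ('i \<Rightarrow> int) \<Rightarrow> 'd" where
  "left_X i \<epsilon> f = (\<lambda>z. \<sigma>_pow i \<epsilon> (f (z(i := z i - \<epsilon>))) \<otimes>\<^bsub>D\<^esub> left_coeff i \<epsilon> (z i - \<epsilon>))"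

definition right_X :: "'i \<Rightarrow> int \<Rightarrow> (('i \<Rightarrow> int) \<Rightarrow> 'd) \<Rightarrow> ('i \<Rightarrow> int) \<Rightarrow> 'd" where
  "right_X i \<epsilon> f = (\<lambda>z. f (z(i := z i - \<epsilon>)) \<otimes>\<^bsub>D\<^esub> right_coeff i \<epsilon> (z i - \<epsilon>))"

definition left_D :: "'d \<Rightarrow> (('i \<Rightarrow> int) \<Rightarrow> 'd) \<Rightarrow> ('i \<Rightarrow> int) \<Rightarrow> 'd" where
  "left_D d f = (\<lambda>z. d \<otimes>\<^bsub>D\<^esub> f z)"

text \<open>The rule \<open>X^z d = twist z d X^z\<close> on coefficients. Outside the exponents
  \<open>twist z\<close> has no meaning and the value is set to zero.\<close>

definition right_D :: "'d \<Rightarrow> (('i \<Rightarrow> int) \<Rightarrow> 'd) \<Rightarrow> ('i \<Rightarrow> int) \<Rightarrow> 'd" where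
  "right_D d f = (\<lambda>z. if z \<in> exponents (Field \<alpha>) then f z \<otimes>\<^bsub>D\<^esub> twist z d else \<zero>\<^bsub>D\<^esub>)"

definition supp :: "(('i \<Rightarrow> int) \<Rightarrow> 'd) \<Rightarrow> ('i \<Rightarrow> int) set" where
  "supp f = {z. f z \<noteq> \<zero>\<^bsub>D\<^esub>}"

definition fin_coeffs :: "(('i \<Rightarrow> int) \<Rightarrow> 'd) set" where
  "fin_coeffs = {f. range f \<subseteq> carrier D \<and> finite (supp f) \<and> supp f \<subseteq> exponents (Field \<alpha>)}"

definition unit_coeff :: "('i \<Rightarrow> int) \<Rightarrow> 'd" where
  "unit_coeff = (\<lambda>z. if z = (\<lambda>_. 0) then \<one>\<^bsub>D\<^esub> else \<zero>\<^bsub>D\<^esub>)"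

lemma left_coeff_closed [simp]: "i \<in> Field \<alpha> \<Longrightarrow> left_coeff i \<epsilon> n \<in> carrier D"
  by (simp add: left_coeff_def a_carrier)

lemma right_coeff_closed [simp]: "i \<in> Field \<alpha> \<Longrightarrow> right_coeff i \<epsilon> n \<in> carrier D"
  by (simp add: right_coeff_def a_carrier)

lemma left_coeff_central:
  "\<lbrakk>i \<in> Field \<alpha>; d \<in> carrier D\<rbrakk> \<Longrightarrow> left_coeff i \<epsilon> n \<otimes>\<^bsub>D\<^esub> d = d \<otimes>\<^bsub>D\<^esub> left_coeff i \<epsilon> n"
  by (simp add: left_coeff_def \<sigma>_pow_a_central)

lemma right_coeff_central:
  "\<lbrakk>i \<in> Field \<alpha>; d \<in> carrier D\<rbrakk> \<Longrightarrow> right_coeff i \<epsilon> n \<otimes>\<^bsub>D\<^esub> d = d \<otimes>\<^bsub>D\<^esub> right_coeff i \<epsilon> n"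
  by (simp add: right_coeff_def \<sigma>_pow_a_central)

lemma \<sigma>_pow_left_coeff:
  "\<lbrakk>i \<in> Field \<alpha>; j \<in> Field \<alpha>; i \<noteq> j\<rbrakk> \<Longrightarrow> \<sigma>_pow i m (left_coeff j \<epsilon> n) = left_coeff j \<epsilon> n"
  using \<sigma>_pow_commute[of i j "a j" m "max \<epsilon> 0"] by (simp add: left_coeff_def a_carrier)

lemma \<sigma>_pow_right_coeff:
  "\<lbrakk>i \<in> Field \<alpha>; j \<in> Field \<alpha>; i \<noteq> j\<rbrakk> \<Longrightarrow> \<sigma>_pow i m (right_coeff j \<epsilon> n) = right_coeff j \<epsilon> n"
  using \<sigma>_pow_commute[of i j "a j" m "n + max \<epsilon> 0"] by (simp add: right_coeff_def a_carrier)

text \<open>For every \<open>n\<close> exactly one of the two coefficients falls under the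
  contracting case: a step that does not contract is undone by one that does, and conversely. So the
  product does not depend on \<open>n\<close>.\<close>

lemma left_coeff_cancel:
  assumes "i \<in> Field \<alpha>" "\<epsilon> \<in> {1, -1}"
  shows "\<sigma>_pow i (-\<epsilon>) (left_coeff i \<epsilon> n) \<otimes>\<^bsub>D\<^esub> left_coeff i (-\<epsilon>) (n + \<epsilon>) = \<sigma>_pow i (max (-\<epsilon>) 0) (a i)"
  using assms a_carrier by (auto simp: left_coeff_def \<sigma>_pow_\<sigma>_pow)

text \<open>Associativity of \<open>X_i^\<epsilon> X_i^n X_i^\<eta>\<close>, read off on
  coefficients.\<close>

lemma left_right_coeff:
  assumes "i \<in> Field \<alpha>" "\<epsilon> \<in> {1, -1}" "\<eta> \<in> {1, -1}"
  shows "\<sigma>_pow i \<epsilon> (right_coeff i \<eta> n) \<otimes>\<^bsub>D\<^esub> left_coeff i \<epsilon> (n + \<eta>) =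
    left_coeff i \<epsilon> n \<otimes>\<^bsub>D\<^esub> right_coeff i \<eta> (n + \<epsilon>)"
proof -
  have comm: "\<sigma>_pow i k (a i) \<otimes>\<^bsub>D\<^esub> \<sigma>_pow i m (a i) = \<sigma>_pow i m (a i) \<otimes>\<^bsub>D\<^esub> \<sigma>_pow i k (a i)"
    "a i \<otimes>\<^bsub>D\<^esub> \<sigma>_pow i m (a i) = \<sigma>_pow i m (a i) \<otimes>\<^bsub>D\<^esub> a i" for k m
    using assms a_carrier a_central by (blast intro: \<sigma>_pow_a_central \<sigma>_pow_closed)+
  \<comment> \<open>A shift by one can change which case of the coefficients applies only for
    \<open>n\<close> between -1 and 1.\<close>
  consider "n \<le> -2" | "n = -1" | "n = 0" | "n = 1" | "n \<ge> 2" by linarith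
  then show ?thesis
    using assms a_carrier
    by cases (auto simp: left_coeff_def right_coeff_def \<sigma>_pow_\<sigma>_pow comm add.commute)
qed

section \<open>The defining relations for the left operators\<close>

lemma left_X_closed [simp]:
  "\<lbrakk>i \<in> Field \<alpha>; range f \<subseteq> carrier D\<rbrakk> \<Longrightarrow> range (left_X i \<epsilon> f) \<subseteq> carrier D"
  by (simp add: left_X_def image_subset_iff)

lemma left_D_closed [simp]:
  "\<lbrakk>d \<in> carrier D; range f \<subseteq> carrier D\<rbrakk> \<Longrightarrow> range (left_D d f) \<subseteq> carrier D"
  by (simp add: left_D_def image_subset_iff)

lemma left_X_left_D:
  assumes "i \<in> Field \<alpha>" "d \<in> carrier D" "range f \<subseteq> carrier D"
  shows "left_X i \<epsilon> (left_D d f) = left_D (\<sigma>_pow i \<epsilon> d) (left_X i \<epsilon> f)"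
  using assms by (simp add: left_X_def left_D_def \<sigma>_pow_mult D.m_assoc image_subset_iff)

lemma left_X_commute:
  assumes i: "i \<in> Field \<alpha>" and j: "j \<in> Field \<alpha>" and ij: "i \<noteq> j" and f: "range f \<subseteq> carrier D"
  shows "left_X i \<epsilon> (left_X j \<eta> f) = left_X j \<eta> (left_X i \<epsilon> f)"
proof
  fix z
  let ?w = "z(i := z i - \<epsilon>, j := z j - \<eta>)"
  have w: "z(j := z j - \<eta>, i := z i - \<epsilon>) = ?w" using ij by auto
  let ?f = "\<sigma>_pow i \<epsilon> (\<sigma>_pow j \<eta> (f ?w))"
  have fw: "f ?w \<in> carrier D" using f by auto
  have "left_X i \<epsilon> (left_X j \<eta> f) z =
      ?f \<otimes>\<^bsub>D\<^esub> left_coeff j \<eta> (z j - \<eta>) \<otimes>\<^bsub>D\<^esub> left_coeff i \<epsilon> (z i - \<epsilon>)"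
    using i j ij fw by (simp add: left_X_def \<sigma>_pow_mult \<sigma>_pow_left_coeff)
  also have "\<dots> = ?f \<otimes>\<^bsub>D\<^esub> left_coeff i \<epsilon> (z i - \<epsilon>) \<otimes>\<^bsub>D\<^esub> left_coeff j \<eta> (z j - \<eta>)"
    using i j fw left_coeff_central[of i "left_coeff j \<eta> (z j - \<eta>)" \<epsilon> "z i - \<epsilon>"]
    by (simp add: D.m_assoc)
  also have "\<dots> = left_X j \<eta> (left_X i \<epsilon> f) z"
    using i j ij fw \<sigma>_pow_commute[of j i "f ?w" \<eta> \<epsilon>]
    by (simp add: left_X_def \<sigma>_pow_mult \<sigma>_pow_left_coeff w)
  finally show "left_X i \<epsilon> (left_X j \<eta> f) z = left_X j \<eta> (left_X i \<epsilon> f) z" .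
qed

lemma left_X_cancel:
  assumes i: "i \<in> Field \<alpha>" and \<epsilon>: "\<epsilon> \<in> {1, -1}" and f: "range f \<subseteq> carrier D"
  shows "left_X i (-\<epsilon>) (left_X i \<epsilon> f) = left_D (\<sigma>_pow i (max (-\<epsilon>) 0) (a i)) f"
proof
  fix z
  have fz: "f z \<in> carrier D" using f by auto
  have "left_X i (-\<epsilon>) (left_X i \<epsilon> f) z =
      \<sigma>_pow i (-\<epsilon>) (\<sigma>_pow i \<epsilon> (f z) \<otimes>\<^bsub>D\<^esub> left_coeff i \<epsilon> (z i)) \<otimes>\<^bsub>D\<^esub> left_coeff i (-\<epsilon>) (z i + \<epsilon>)"
    by (simp add: left_X_def)
  also have "\<dots> = f z \<otimes>\<^bsub>D\<^esub> (\<sigma>_pow i (-\<epsilon>) (left_coeff i \<epsilon> (z i)) \<otimes>\<^bsub>D\<^esub> left_coeff i (-\<epsilon>) (z i + \<epsilon>))"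
    using i fz by (simp add: \<sigma>_pow_mult \<sigma>_pow_\<sigma>_pow D.m_assoc)
  also have "\<dots> = left_D (\<sigma>_pow i (max (-\<epsilon>) 0) (a i)) f z"
    using i fz by (simp only: left_coeff_cancel[OF i \<epsilon>] left_D_def \<sigma>_pow_a_central)
  finally show "left_X i (-\<epsilon>) (left_X i \<epsilon> f) z = left_D (\<sigma>_pow i (max (-\<epsilon>) 0) (a i)) f z" .
qed

section \<open>The action of expressions on coefficient functions\<close>

primrec rep :: "('k, 'd, 'i) gwa_expr \<Rightarrow> (('i \<Rightarrow> int) \<Rightarrow> 'd) \<Rightarrow> ('i \<Rightarrow> int) \<Rightarrow> 'd" where
  "rep (Base d) f = left_D d f"
| "rep (XPlus i) f = left_X i 1 f"
| "rep (XMinus i) f = left_X i (-1) f"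
| "rep (Add s t) f = (\<lambda>z. rep s f z \<oplus>\<^bsub>D\<^esub> rep t f z)"
| "rep (Neg s) f = (\<lambda>z. \<ominus>\<^bsub>D\<^esub> rep s f z)"
| "rep (Mul s t) f = rep s (rep t f)"
| "rep (Scal c s) f = (\<lambda>z. c \<odot>\<^bsub>D\<^esub> rep s f z)"

lemma rep_closed:
  assumes "s \<in> gwa_exprs K D \<alpha>" "range f \<subseteq> carrier D"
  shows "range (rep s f) \<subseteq> carrier D"
  using assms
proof (induction s arbitrary: f rule: gwa_exprs.induct)
  case (4 s t)
  then show ?case by (simp add: image_subset_iff)
next
  case (5 s)
  then show ?case by (simp add: image_subset_iff)
next
  case (7 c s)
  then show ?case by (simp add: image_subset_iff)
qed auto

lemma rep_closed_apply:
  "\<lbrakk>s \<in> gwa_exprs K D \<alpha>; range f \<subseteq> carrier D\<rbrakk> \<Longrightarrow> rep s f z \<in> carrier D"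
  using rep_closed by (simp add: image_subset_iff)

text \<open>Additivity of the operators is what the clause \<open>distrib_left\<close> of the
  congruence requires; \<open>rep_smult\<close> serves \<open>scal_mul_right\<close> in the same
  way.\<close>

lemma rep_add:
  assumes "s \<in> gwa_exprs K D \<alpha>" "range f \<subseteq> carrier D" "range g \<subseteq> carrier D"
  shows "rep s (\<lambda>z. f z \<oplus>\<^bsub>D\<^esub> g z) = (\<lambda>z. rep s f z \<oplus>\<^bsub>D\<^esub> rep s g z)"
  using assms
proof (induction s arbitrary: f g rule: gwa_exprs.induct)
  case (1 d)
  then show ?case by (simp add: left_D_def D.r_distr image_subset_iff)
next
  case (2 i)
  then show ?case by (simp add: left_X_def \<sigma>_pow_add D.l_distr image_subset_iff)
next
  case (3 i)
  then show ?case by (simp add: left_X_def \<sigma>_pow_add D.l_distr image_subset_iff)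
next
  case (4 s t)
  then show ?case by (simp add: rep_closed_apply D.a_ac)
next
  case (5 s)
  then show ?case by (simp add: rep_closed_apply D.minus_add)
next
  case (6 s t)
  then show ?case by (simp add: rep_closed)
next
  case (7 c s)
  then show ?case by (simp add: rep_closed_apply smult_r_distr)
qed

lemma rep_smult:
  assumes "s \<in> gwa_exprs K D \<alpha>" "range f \<subseteq> carrier D" "c \<in> carrier K"
  shows "rep s (\<lambda>z. c \<odot>\<^bsub>D\<^esub> f z) = (\<lambda>z. c \<odot>\<^bsub>D\<^esub> rep s f z)"
  using assms
proof (induction s arbitrary: f rule: gwa_exprs.induct)
  case (1 d)
  then show ?case by (simp add: left_D_def smult_mult_right image_subset_iff)
next
  case (2 i)
  then show ?case by (simp add: left_X_def \<sigma>_pow_smult smult_mult_left image_subset_iff)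
next
  case (3 i)
  then show ?case by (simp add: left_X_def \<sigma>_pow_smult smult_mult_left image_subset_iff)
next
  case (4 s t)
  then show ?case by (simp add: rep_closed_apply smult_r_distr)
next
  case (5 s)
  then show ?case by (simp add: rep_closed_apply smult_r_minus)
next
  case (6 s t)
  then show ?case by (simp add: rep_closed)
next
  case (7 e s)
  then show ?case by (simp add: rep_closed_apply K.m_comm flip: smult_assoc1)
qed

lemma gwa_cong_exprs:
  "gwa_cong K D \<alpha> \<sigma> a s t \<Longrightarrow> s \<in> gwa_exprs K D \<alpha> \<and> t \<in> gwa_exprs K D \<alpha>"
proof (induction rule: gwa_cong.induct)
  case (minus_base i d)
  then have "(inv\<^bsub>Aut K D\<^esub> \<sigma> i) d \<in> carrier D" by (simp flip: \<sigma>_pow_minus_1)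
  with minus_base show ?case by (auto intro!: gwa_exprs.intros)
next
  case (plus_base i d)
  then have "\<sigma> i d \<in> carrier D" by (simp flip: \<sigma>_pow_1)
  with plus_base show ?case by (auto intro!: gwa_exprs.intros)
next
  case (plus_minus_same i)
  then have "\<sigma> i (a i) \<in> carrier D" using a_carrier by (simp flip: \<sigma>_pow_1)
  with plus_minus_same show ?case by (auto intro!: gwa_exprs.intros)
qed (auto intro!: gwa_exprs.intros simp: a_carrier)

text \<open>The operators satisfy every relation of the presentation, so the action is one of the
  algebra itself. Classes can then be told apart by their action, which is how
  \<open>1 \<noteq> 0\<close> is proved.\<close>

lemma rep_cong:
  "\<lbrakk>gwa_cong K D \<alpha> \<sigma> a s t; range f \<subseteq> carrier D\<rbrakk> \<Longrightarrow> rep s f = rep t f"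
proof (induction arbitrary: f rule: gwa_cong.induct)
  case (mul s s' t t')
  have "range (rep t f) \<subseteq> carrier D"
    using rep_closed[OF _ mul.prems] gwa_cong_exprs[OF mul.hyps(2)] by blast
  then show ?case using mul by simp
next
  case (add_assoc s t u)
  then show ?case by (simp add: rep_closed_apply D.a_assoc)
next
  case (add_comm s t)
  then show ?case by (simp add: rep_closed_apply D.a_comm)
next
  case (add_zero s)
  then show ?case by (simp add: rep_closed_apply left_D_def range_subsetD)
next
  case (add_neg s)
  then show ?case by (simp add: rep_closed_apply left_D_def range_subsetD D.l_neg)
next
  case (one_mul s)
  then show ?case by (simp add: rep_closed_apply left_D_def)
next
  case (mul_one s)
  then show ?case by (simp add: left_D_def range_subsetD)
next
  case (distrib_left s t u)
  then show ?case by (simp add: rep_add rep_closed)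
next
  case (scal_add_left c e s)
  then show ?case by (simp add: rep_closed_apply smult_l_distr)
next
  case (scal_add_right c s t)
  then show ?case by (simp add: rep_closed_apply smult_r_distr)
next
  case (scal_assoc c e s)
  then show ?case by (simp add: rep_closed_apply smult_assoc1)
next
  case (scal_one s)
  then show ?case by (simp add: rep_closed_apply)
next
  case (scal_mul_right c s t)
  then show ?case by (simp add: rep_smult rep_closed)
next
  case (base_add d e)
  then show ?case by (simp add: left_D_def range_subsetD D.l_distr)
next
  case (base_mul d e)
  then show ?case by (simp add: left_D_def range_subsetD D.m_assoc)
next
  case (base_scal c d)
  then show ?case by (simp add: left_D_def range_subsetD smult_mult_left)
next
  case (plus_base i d)
  then show ?case by (simp add: left_X_left_D \<sigma>_pow_1)
next
  case (minus_base i d)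
  then show ?case by (simp add: left_X_left_D \<sigma>_pow_minus_1)
next
  case (plus_plus i j)
  then show ?case using left_X_commute by simp
next
  case (minus_minus i j)
  then show ?case using left_X_commute by simp
next
  case (plus_minus i j)
  then show ?case using left_X_commute by simp
next
  case (minus_plus_same i)
  then show ?case using left_X_cancel[of i 1 f] a_carrier by simp
next
  case (plus_minus_same i)
  then show ?case using left_X_cancel[of i "-1" f] a_carrier by (simp add: \<sigma>_pow_1)
qed simp_all

section \<open>Finitely supported coefficient functions\<close>

lemma fin_coeffs_closed: "f \<in> fin_coeffs \<Longrightarrow> f z \<in> carrier D"
  by (auto simp: fin_coeffs_def)

lemma fin_coeffs_range: "f \<in> fin_coeffs \<Longrightarrow> range f \<subseteq> carrier D"
  by (simp add: fin_coeffs_def)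

lemma fin_coeffs_supp: "f \<in> fin_coeffs \<Longrightarrow> finite (supp f)"
  by (simp add: fin_coeffs_def)

lemma fin_coeffsI:
  assumes "\<And>z. f z \<in> carrier D" "finite S" "supp f \<subseteq> S" "S \<subseteq> exponents (Field \<alpha>)"
  shows "f \<in> fin_coeffs"
  using assms(1) finite_subset[OF assms(3,2)] subset_trans[OF assms(3,4)]
  by (simp add: fin_coeffs_def image_subset_iff)

lemma fin_coeffs_exponents: "f \<in> fin_coeffs \<Longrightarrow> supp f \<subseteq> exponents (Field \<alpha>)"
  by (simp add: fin_coeffs_def)

lemmas fin_coeffs_simps [simp] = fin_coeffs_closed fin_coeffs_supp fin_coeffs_exponents

lemma unit_coeff_fin [simp]: "unit_coeff \<in> fin_coeffs"
  by (rule fin_coeffsI[of _ "{\<lambda>_. 0}"]) (auto simp: unit_coeff_def supp_def zero_exponents)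

lemma supp_left_D: "\<lbrakk>d \<in> carrier D; f \<in> fin_coeffs\<rbrakk> \<Longrightarrow> supp (left_D d f) \<subseteq> supp f"
  by (auto simp: supp_def left_D_def)

lemma supp_right_D: "\<lbrakk>d \<in> carrier D; f \<in> fin_coeffs\<rbrakk> \<Longrightarrow> supp (right_D d f) \<subseteq> supp f"
  by (auto simp: supp_def right_D_def)

lemma supp_left_X:
  assumes "i \<in> Field \<alpha>"
  shows "supp (left_X i \<epsilon> f) \<subseteq> (\<lambda>z. z(i := z i + \<epsilon>)) ` supp f"
proof
  fix z assume "z \<in> supp (left_X i \<epsilon> f)"
  then have "z(i := z i - \<epsilon>) \<in> supp f" using assms by (auto simp: supp_def left_X_def)
  then show "z \<in> (\<lambda>z. z(i := z i + \<epsilon>)) ` supp f" by (auto intro!: image_eqI)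
qed

lemma supp_right_X:
  assumes "i \<in> Field \<alpha>"
  shows "supp (right_X i \<epsilon> f) \<subseteq> (\<lambda>z. z(i := z i + \<epsilon>)) ` supp f"
proof
  fix z assume "z \<in> supp (right_X i \<epsilon> f)"
  then have "z(i := z i - \<epsilon>) \<in> supp f" using assms by (auto simp: supp_def right_X_def)
  then show "z \<in> (\<lambda>z. z(i := z i + \<epsilon>)) ` supp f" by (auto intro!: image_eqI)
qed

lemma shift_image_exponents:
  assumes "i \<in> Field \<alpha>" "f \<in> fin_coeffs"
  shows "(\<lambda>z. z(i := z i + \<epsilon>)) ` supp f \<subseteq> exponents (Field \<alpha>)"
  using exponents_update[OF subsetD[OF fin_coeffs_exponents[OF assms(2)]] assms(1)]
  by (simp add: image_subset_iff)

lemma left_D_fin [simp]: "\<lbrakk>d \<in> carrier D; f \<in> fin_coeffs\<rbrakk> \<Longrightarrow> left_D d f \<in> fin_coeffs"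
  by (rule fin_coeffsI[OF _ _ supp_left_D]) (auto simp: left_D_def)

lemma right_D_fin [simp]: "\<lbrakk>d \<in> carrier D; f \<in> fin_coeffs\<rbrakk> \<Longrightarrow> right_D d f \<in> fin_coeffs"
  by (rule fin_coeffsI[OF _ _ supp_right_D]) (auto simp: right_D_def)

lemma left_X_fin [simp]: "\<lbrakk>i \<in> Field \<alpha>; f \<in> fin_coeffs\<rbrakk> \<Longrightarrow> left_X i \<epsilon> f \<in> fin_coeffs"
  by (rule fin_coeffsI[OF _ _ supp_left_X shift_image_exponents])
    (auto simp: left_X_def)

lemma right_X_fin [simp]: "\<lbrakk>i \<in> Field \<alpha>; f \<in> fin_coeffs\<rbrakk> \<Longrightarrow> right_X i \<epsilon> f \<in> fin_coeffs"
  by (rule fin_coeffsI[OF _ _ supp_right_X shift_image_exponents])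
    (auto simp: right_X_def)

lemma add_fin [simp]: "\<lbrakk>f \<in> fin_coeffs; g \<in> fin_coeffs\<rbrakk> \<Longrightarrow> (\<lambda>z. f z \<oplus>\<^bsub>D\<^esub> g z) \<in> fin_coeffs"
  by (rule fin_coeffsI[of _ "supp f \<union> supp g"]) (simp_all, auto simp: supp_def)

lemma neg_fin [simp]: "f \<in> fin_coeffs \<Longrightarrow> (\<lambda>z. \<ominus>\<^bsub>D\<^esub> f z) \<in> fin_coeffs"
  by (rule fin_coeffsI[of _ "supp f"]) (simp_all, auto simp: supp_def)

lemma smult_fin [simp]:
  "\<lbrakk>c \<in> carrier K; f \<in> fin_coeffs\<rbrakk> \<Longrightarrow> (\<lambda>z. c \<odot>\<^bsub>D\<^esub> f z) \<in> fin_coeffs"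
  by (rule fin_coeffsI[of _ "supp f"]) (simp_all, auto simp: supp_def smult_r_null)

lemma rep_fin: "\<lbrakk>s \<in> gwa_exprs K D \<alpha>; f \<in> fin_coeffs\<rbrakk> \<Longrightarrow> rep s f \<in> fin_coeffs"
  by (induction s arbitrary: f rule: gwa_exprs.induct) auto

section \<open>Right multiplication operators\<close>

text \<open>Every \<open>rep s\<close> is built from \<open>left_D\<close> and \<open>left_X\<close>
  by sums, negatives, scalars and composition, so a linear operator commuting with these two
  commutes with all of them. It is applied to \<open>right_X\<close> and
  \<open>right_D\<close>.\<close>

lemma rep_commute:
  assumes R: "\<And>f. f \<in> fin_coeffs \<Longrightarrow> R f \<in> fin_coeffs"
    and add: "\<And>f g. \<lbrakk>f \<in> fin_coeffs; g \<in> fin_coeffs\<rbrakk>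
      \<Longrightarrow> R (\<lambda>z. f z \<oplus>\<^bsub>D\<^esub> g z) = (\<lambda>z. R f z \<oplus>\<^bsub>D\<^esub> R g z)"
    and neg: "\<And>f. f \<in> fin_coeffs \<Longrightarrow> R (\<lambda>z. \<ominus>\<^bsub>D\<^esub> f z) = (\<lambda>z. \<ominus>\<^bsub>D\<^esub> R f z)"
    and smult: "\<And>c f. \<lbrakk>c \<in> carrier K; f \<in> fin_coeffs\<rbrakk>
      \<Longrightarrow> R (\<lambda>z. c \<odot>\<^bsub>D\<^esub> f z) = (\<lambda>z. c \<odot>\<^bsub>D\<^esub> R f z)"
    and left_D: "\<And>d f. \<lbrakk>d \<in> carrier D; f \<in> fin_coeffs\<rbrakk> \<Longrightarrow> R (left_D d f) = left_D d (R f)"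
    and left_X: "\<And>i \<epsilon> f. \<lbrakk>i \<in> Field \<alpha>; \<epsilon> \<in> {1, -1}; f \<in> fin_coeffs\<rbrakk>
      \<Longrightarrow> R (left_X i \<epsilon> f) = left_X i \<epsilon> (R f)"
    and "s \<in> gwa_exprs K D \<alpha>" "f \<in> fin_coeffs"
  shows "R (rep s f) = rep s (R f)"
  using assms(7,8)
  by (induction s arbitrary: f rule: gwa_exprs.induct)
    (simp_all add: R add neg smult left_D left_X rep_fin)

lemma left_D_right_D:
  "\<lbrakk>d \<in> carrier D; e \<in> carrier D; f \<in> fin_coeffs\<rbrakk>
    \<Longrightarrow> right_D d (left_D e f) = left_D e (right_D d f)"
  by (auto simp: left_D_def right_D_def D.m_assoc)

text \<open>Shifting an exponent by \<open>\<epsilon>\<close> at \<open>i\<close> composes its twist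
  with \<open>\<sigma>_pow i \<epsilon>\<close>, and \<open>left_coeff\<close> is central.\<close>

lemma left_X_right_D:
  assumes i: "i \<in> Field \<alpha>" and d: "d \<in> carrier D" and f: "f \<in> fin_coeffs"
  shows "right_D d (left_X i \<epsilon> f) = left_X i \<epsilon> (right_D d f)"
proof
  fix z
  let ?w = "z(i := z i - \<epsilon>)"
  show "right_D d (left_X i \<epsilon> f) z = left_X i \<epsilon> (right_D d f) z"
  proof (cases "z \<in> exponents (Field \<alpha>)")
    case True
    then have w: "?w \<in> exponents (Field \<alpha>)" by (rule exponents_update[OF _ i])
    have tw: "twist z d = \<sigma>_pow i \<epsilon> (twist ?w d)"
      using twist_update[OF w i d, of \<epsilon>] by (simp add: fun_upd_same del: fun_upd_apply)
    have "right_D d (left_X i \<epsilon> f) z =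
        \<sigma>_pow i \<epsilon> (f ?w) \<otimes>\<^bsub>D\<^esub> (left_coeff i \<epsilon> (z i - \<epsilon>) \<otimes>\<^bsub>D\<^esub> \<sigma>_pow i \<epsilon> (twist ?w d))"
      using True w i d f by (simp add: right_D_def left_X_def D.m_assoc tw del: fun_upd_apply)
    also have "\<dots> = \<sigma>_pow i \<epsilon> (f ?w) \<otimes>\<^bsub>D\<^esub> (\<sigma>_pow i \<epsilon> (twist ?w d) \<otimes>\<^bsub>D\<^esub> left_coeff i \<epsilon> (z i - \<epsilon>))"
      using w i d by (simp only: left_coeff_central twist_closed \<sigma>_pow_closed)
    also have "\<dots> = left_X i \<epsilon> (right_D d f) z"
      using w i d f by (simp add: right_D_def left_X_def \<sigma>_pow_mult D.m_assoc del: fun_upd_apply)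
    finally show ?thesis .
  next
    case False
    then have "?w \<notin> exponents (Field \<alpha>)" by (simp only: exponents_update_iff[OF i] not_False_eq_True)
    with False show ?thesis using i by (simp add: right_D_def left_X_def)
  qed
qed

lemma left_D_right_X:
  "\<lbrakk>d \<in> carrier D; i \<in> Field \<alpha>; f \<in> fin_coeffs\<rbrakk>
    \<Longrightarrow> right_X i \<eta> (left_D d f) = left_D d (right_X i \<eta> f)"
  by (auto simp: left_D_def right_X_def D.m_assoc)

text \<open>For \<open>i = j\<close> this rests on \<open>left_right_coeff\<close>. For
  \<open>i \<noteq> j\<close> the coefficients concern different coordinates, are central, and
  \<open>\<sigma>_pow i\<close> fixes the one at \<open>j\<close>.\<close>

lemma left_X_right_X:
  assumes i: "i \<in> Field \<alpha>" and j: "j \<in> Field \<alpha>" and \<epsilon>: "\<epsilon> \<in> {1, -1}" "\<eta> \<in> {1, -1}"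
    and f: "f \<in> fin_coeffs"
  shows "right_X j \<eta> (left_X i \<epsilon> f) = left_X i \<epsilon> (right_X j \<eta> f)"
proof
  fix z
  show "right_X j \<eta> (left_X i \<epsilon> f) z = left_X i \<epsilon> (right_X j \<eta> f) z"
  proof (cases "i = j")
    case True
    define n where "n = z i - \<epsilon> - \<eta>"
    let ?w = "z(i := n)"
    have "right_X i \<eta> (left_X i \<epsilon> f) z =
        \<sigma>_pow i \<epsilon> (f ?w) \<otimes>\<^bsub>D\<^esub> (left_coeff i \<epsilon> n \<otimes>\<^bsub>D\<^esub> right_coeff i \<eta> (n + \<epsilon>))"
      using i f by (simp add: left_X_def right_X_def D.m_assoc n_def algebra_simps)
    also have "\<dots> = \<sigma>_pow i \<epsilon> (f ?w) \<otimes>\<^bsub>D\<^esub> (\<sigma>_pow i \<epsilon> (right_coeff i \<eta> n) \<otimes>\<^bsub>D\<^esub> left_coeff i \<epsilon> (n + \<eta>))"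
      by (simp only: left_right_coeff[OF i \<epsilon>])
    also have "\<dots> = left_X i \<epsilon> (right_X i \<eta> f) z"
      using i f by (simp add: left_X_def right_X_def D.m_assoc n_def \<sigma>_pow_mult)
    finally show ?thesis using True by simp
  next
    case False
    let ?w = "z(i := z i - \<epsilon>, j := z j - \<eta>)"
    have w: "z(j := z j - \<eta>, i := z i - \<epsilon>) = ?w" using False by auto
    have "right_X j \<eta> (left_X i \<epsilon> f) z =
        \<sigma>_pow i \<epsilon> (f ?w) \<otimes>\<^bsub>D\<^esub> (left_coeff i \<epsilon> (z i - \<epsilon>) \<otimes>\<^bsub>D\<^esub> right_coeff j \<eta> (z j - \<eta>))"
      using i j f False by (simp add: left_X_def right_X_def D.m_assoc w)
    also have "\<dots> = \<sigma>_pow i \<epsilon> (f ?w) \<otimes>\<^bsub>D\<^esub> (right_coeff j \<eta> (z j - \<eta>) \<otimes>\<^bsub>D\<^esub> left_coeff i \<epsilon> (z i - \<epsilon>))"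
      using i j by (simp only: left_coeff_central right_coeff_closed)
    also have "\<dots> = left_X i \<epsilon> (right_X j \<eta> f) z"
      using i j f False by (simp add: left_X_def right_X_def D.m_assoc \<sigma>_pow_mult \<sigma>_pow_right_coeff)
    finally show ?thesis .
  qed
qed

lemma right_X_rep:
  assumes "i \<in> Field \<alpha>" "\<epsilon> \<in> {1, -1}" "s \<in> gwa_exprs K D \<alpha>" "f \<in> fin_coeffs"
  shows "right_X i \<epsilon> (rep s f) = rep s (right_X i \<epsilon> f)"
proof (rule rep_commute[OF _ _ _ _ _ _ assms(3,4)])
  show "right_X i \<epsilon> (left_X j \<eta> f) = left_X j \<eta> (right_X i \<epsilon> f)"
    if "j \<in> Field \<alpha>" "\<eta> \<in> {1, -1}" "f \<in> fin_coeffs" for j \<eta> f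
    using left_X_right_X that assms by blast
  show "right_X i \<epsilon> (\<lambda>z. c \<odot>\<^bsub>D\<^esub> f z) = (\<lambda>z. c \<odot>\<^bsub>D\<^esub> right_X i \<epsilon> f z)"
    if "c \<in> carrier K" "f \<in> fin_coeffs" for c f
    using that assms by (simp add: right_X_def smult_mult_left)
  show "right_X i \<epsilon> (\<lambda>z. f z \<oplus>\<^bsub>D\<^esub> g z) = (\<lambda>z. right_X i \<epsilon> f z \<oplus>\<^bsub>D\<^esub> right_X i \<epsilon> g z)"
    if "f \<in> fin_coeffs" "g \<in> fin_coeffs" for f g
    using that assms by (simp add: right_X_def D.l_distr)
  show "right_X i \<epsilon> (\<lambda>z. \<ominus>\<^bsub>D\<^esub> f z) = (\<lambda>z. \<ominus>\<^bsub>D\<^esub> right_X i \<epsilon> f z)" if "f \<in> fin_coeffs" for f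
    using that assms by (simp add: right_X_def D.l_minus)
qed (use assms in \<open>simp_all add: left_D_right_X\<close>)

lemma right_D_rep:
  assumes "d \<in> carrier D" "s \<in> gwa_exprs K D \<alpha>" "f \<in> fin_coeffs"
  shows "right_D d (rep s f) = rep s (right_D d f)"
proof (rule rep_commute[OF _ _ _ _ _ _ assms(2,3)])
  show "right_D d (\<lambda>z. c \<odot>\<^bsub>D\<^esub> f z) = (\<lambda>z. c \<odot>\<^bsub>D\<^esub> right_D d f z)"
    if "c \<in> carrier K" "f \<in> fin_coeffs" for c f
    using that assms by (auto simp: right_D_def smult_mult_left smult_r_null)
  show "right_D d (\<lambda>z. f z \<oplus>\<^bsub>D\<^esub> g z) = (\<lambda>z. right_D d f z \<oplus>\<^bsub>D\<^esub> right_D d g z)"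
    if "f \<in> fin_coeffs" "g \<in> fin_coeffs" for f g
    using that assms by (auto simp: right_D_def D.l_distr)
  show "right_D d (\<lambda>z. \<ominus>\<^bsub>D\<^esub> f z) = (\<lambda>z. \<ominus>\<^bsub>D\<^esub> right_D d f z)" if "f \<in> fin_coeffs" for f
    using that assms by (auto simp: right_D_def D.l_minus)
qed (use assms in \<open>simp_all add: left_D_right_D left_X_right_D\<close>)

text \<open>Together with \<open>right_D_rep\<close> this identifies \<open>right_D d\<close> with
  right multiplication by \<open>d\<close>: it turns \<open>right_D d (rep s unit_coeff)\<close>
  into \<open>rep s (rep (Base d) unit_coeff)\<close>. The next lemma does the same for the
  generators.\<close>

lemma left_D_unit_coeff: "d \<in> carrier D \<Longrightarrow> left_D d unit_coeff = right_D d unit_coeff"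
  by (auto simp: left_D_def right_D_def unit_coeff_def twist_0 zero_exponents)

lemma left_X_unit_coeff:
  assumes "i \<in> Field \<alpha>"
  shows "left_X i \<epsilon> unit_coeff = right_X i \<epsilon> unit_coeff"
proof
  fix z
  show "left_X i \<epsilon> unit_coeff z = right_X i \<epsilon> unit_coeff z"
  proof (cases "z(i := z i - \<epsilon>) = (\<lambda>_. 0)")
    case True
    then have "z i - \<epsilon> = 0" by (metis fun_upd_same)
    with True show ?thesis
      using assms by (simp add: left_X_def right_X_def unit_coeff_def left_coeff_def right_coeff_def)
  next
    case False
    then show ?thesis using assms by (simp add: left_X_def right_X_def unit_coeff_def)
  qed
qed

section \<open>The generalized Weyl algebra as a ring\<close>

abbreviation A :: "('k, ('k, 'd, 'i) gwa_expr set) module" where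
  "A \<equiv> gwa K D \<alpha> \<sigma> a"

definition cls :: "('k, 'd, 'i) gwa_expr \<Rightarrow> ('k, 'd, 'i) gwa_expr set" where
  "cls s = {t. gwa_cong K D \<alpha> \<sigma> a s t}"

lemma cls_eqI: "gwa_cong K D \<alpha> \<sigma> a s t \<Longrightarrow> cls s = cls t"
  unfolding cls_def by (blast intro: gwa_cong.sym gwa_cong.trans)

lemma cls_eqD: "\<lbrakk>s \<in> gwa_exprs K D \<alpha>; cls s = cls t\<rbrakk> \<Longrightarrow> gwa_cong K D \<alpha> \<sigma> a s t"
  unfolding cls_def by (blast intro: gwa_cong.refl gwa_cong.sym)

lemma carrier_gwa: "carrier A = cls ` gwa_exprs K D \<alpha>"
  by (auto simp: gwa_def Let_def quotient_def cls_def Image_def)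

lemma zero_gwa: "\<zero>\<^bsub>A\<^esub> = cls (Base \<zero>\<^bsub>D\<^esub>)" and one_gwa: "\<one>\<^bsub>A\<^esub> = cls (Base \<one>\<^bsub>D\<^esub>)"
  by (auto simp: gwa_def Let_def cls_def Image_def)

text \<open>All classes in the union coincide, so the operations of the quotient are computed on
  representatives.\<close>

lemma UN_cls:
  assumes "s \<in> gwa_exprs K D \<alpha>" "t \<in> gwa_exprs K D \<alpha>"
    and "\<And>s' t'. \<lbrakk>gwa_cong K D \<alpha> \<sigma> a s s'; gwa_cong K D \<alpha> \<sigma> a t t'\<rbrakk>
      \<Longrightarrow> gwa_cong K D \<alpha> \<sigma> a (F s t) (F s' t')"
  shows "(\<Union>s'\<in>cls s. \<Union>t'\<in>cls t. cls (F s' t')) = cls (F s t)"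
proof -
  have "cls (F s' t') = cls (F s t)" if "s' \<in> cls s" "t' \<in> cls t" for s' t'
    by (rule cls_eqI[symmetric], rule assms(3)) (use that in \<open>simp_all add: cls_def\<close>)
  moreover have "s \<in> cls s" "t \<in> cls t" using assms by (auto simp: cls_def intro: gwa_cong.refl)
  ultimately show ?thesis by blast
qed

lemma mult_cls:
  assumes "s \<in> gwa_exprs K D \<alpha>" "t \<in> gwa_exprs K D \<alpha>"
  shows "cls s \<otimes>\<^bsub>A\<^esub> cls t = cls (Mul s t)"
proof -
  have "cls s \<otimes>\<^bsub>A\<^esub> cls t = (\<Union>s'\<in>cls s. \<Union>t'\<in>cls t. cls (Mul s' t'))"
    by (simp add: gwa_def Let_def cls_def Image_def)
  then show ?thesis using UN_cls[of s t Mul] assms gwa_cong.mul by metis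
qed

lemma add_cls:
  assumes "s \<in> gwa_exprs K D \<alpha>" "t \<in> gwa_exprs K D \<alpha>"
  shows "cls s \<oplus>\<^bsub>A\<^esub> cls t = cls (Add s t)"
proof -
  have "cls s \<oplus>\<^bsub>A\<^esub> cls t = (\<Union>s'\<in>cls s. \<Union>t'\<in>cls t. cls (Add s' t'))"
    by (simp add: gwa_def Let_def cls_def Image_def)
  then show ?thesis using UN_cls[of s t Add] assms gwa_cong.add by metis
qed

text \<open>The axioms are read off from the clauses of the congruence. As classes are sets,
  \<open>equalityI\<close> is removed so that equations between them reach \<open>cls_eqI\<close>
  unsplit.\<close>

lemma ring_gwa: "ring A"
proof (rule ringI)
  show "abelian_group A"
  proof (rule abelian_groupI)
    fix x y z assume "x \<in> carrier A" "y \<in> carrier A" "z \<in> carrier A"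
    then show "x \<oplus>\<^bsub>A\<^esub> y \<oplus>\<^bsub>A\<^esub> z = x \<oplus>\<^bsub>A\<^esub> (y \<oplus>\<^bsub>A\<^esub> z)"
      by (auto simp: carrier_gwa add_cls gwa_exprs.intros intro!: cls_eqI gwa_cong.add_assoc del: equalityI)
  next
    fix x y assume "x \<in> carrier A" "y \<in> carrier A"
    then show "x \<oplus>\<^bsub>A\<^esub> y \<in> carrier A" "x \<oplus>\<^bsub>A\<^esub> y = y \<oplus>\<^bsub>A\<^esub> x"
      by (auto simp: carrier_gwa add_cls gwa_exprs.intros intro!: cls_eqI gwa_cong.add_comm del: equalityI)
  next
    show "\<zero>\<^bsub>A\<^esub> \<in> carrier A" by (simp add: carrier_gwa zero_gwa gwa_exprs.intros)
  next
    fix x assume x: "x \<in> carrier A"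
    then show "\<zero>\<^bsub>A\<^esub> \<oplus>\<^bsub>A\<^esub> x = x"
      by (auto simp: carrier_gwa zero_gwa add_cls gwa_exprs.intros intro!: cls_eqI gwa_cong.add_zero del: equalityI)
    from x obtain s where s: "s \<in> gwa_exprs K D \<alpha>" "x = cls s" by (auto simp: carrier_gwa)
    then have "cls (Neg s) \<oplus>\<^bsub>A\<^esub> x = \<zero>\<^bsub>A\<^esub>"
      by (auto simp: zero_gwa add_cls gwa_exprs.intros intro!: cls_eqI gwa_cong.add_neg del: equalityI)
    with s show "\<exists>y\<in>carrier A. y \<oplus>\<^bsub>A\<^esub> x = \<zero>\<^bsub>A\<^esub>" by (auto simp: carrier_gwa gwa_exprs.intros)
  qed
  show "monoid A"
  proof (rule monoidI)
    fix x y z assume "x \<in> carrier A" "y \<in> carrier A" "z \<in> carrier A"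
    then show "x \<otimes>\<^bsub>A\<^esub> y \<otimes>\<^bsub>A\<^esub> z = x \<otimes>\<^bsub>A\<^esub> (y \<otimes>\<^bsub>A\<^esub> z)"
      by (auto simp: carrier_gwa mult_cls gwa_exprs.intros intro!: cls_eqI gwa_cong.mul_assoc del: equalityI)
  next
    fix x assume x: "x \<in> carrier A"
    then show "\<one>\<^bsub>A\<^esub> \<otimes>\<^bsub>A\<^esub> x = x" "x \<otimes>\<^bsub>A\<^esub> \<one>\<^bsub>A\<^esub> = x"
      by (auto simp: carrier_gwa one_gwa mult_cls gwa_exprs.intros
          intro!: cls_eqI gwa_cong.one_mul gwa_cong.mul_one del: equalityI)
  next
    fix x y assume "x \<in> carrier A" "y \<in> carrier A"
    then show "x \<otimes>\<^bsub>A\<^esub> y \<in> carrier A" by (auto simp: carrier_gwa mult_cls gwa_exprs.intros)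
  qed (simp add: carrier_gwa one_gwa gwa_exprs.intros)
  fix x y z assume "x \<in> carrier A" "y \<in> carrier A" "z \<in> carrier A"
  then show "(x \<oplus>\<^bsub>A\<^esub> y) \<otimes>\<^bsub>A\<^esub> z = x \<otimes>\<^bsub>A\<^esub> z \<oplus>\<^bsub>A\<^esub> y \<otimes>\<^bsub>A\<^esub> z"
    "z \<otimes>\<^bsub>A\<^esub> (x \<oplus>\<^bsub>A\<^esub> y) = z \<otimes>\<^bsub>A\<^esub> x \<oplus>\<^bsub>A\<^esub> z \<otimes>\<^bsub>A\<^esub> y"
    by (auto simp: carrier_gwa mult_cls add_cls gwa_exprs.intros
        intro!: cls_eqI gwa_cong.distrib_left gwa_cong.distrib_right del: equalityI)
qed

sublocale A: ring A by (rule ring_gwa)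

section \<open>Generators and monomials in the algebra\<close>

definition base :: "'d \<Rightarrow> ('k, 'd, 'i) gwa_expr set" where
  "base d = cls (Base d)"

text \<open>The sign selects the generator, in line with \<open>left_X\<close>; any
  \<open>\<epsilon>\<close> other than 1 stands for \<open>XMinus i\<close>.\<close>

definition gen :: "'i \<Rightarrow> int \<Rightarrow> ('k, 'd, 'i) gwa_expr set" where
  "gen i \<epsilon> = cls (if \<epsilon> = 1 then XPlus i else XMinus i)"

lemma cls_closed [simp]: "s \<in> gwa_exprs K D \<alpha> \<Longrightarrow> cls s \<in> carrier A"
  by (simp add: carrier_gwa)

lemma base_closed [simp]: "d \<in> carrier D \<Longrightarrow> base d \<in> carrier A"
  by (simp add: base_def gwa_exprs.intros)

lemma gen_closed [simp]: "i \<in> Field \<alpha> \<Longrightarrow> gen i \<epsilon> \<in> carrier A"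
  by (simp add: gen_def gwa_exprs.intros)

lemma base_add: "\<lbrakk>d \<in> carrier D; e \<in> carrier D\<rbrakk> \<Longrightarrow> base (d \<oplus>\<^bsub>D\<^esub> e) = base d \<oplus>\<^bsub>A\<^esub> base e"
  by (auto simp: base_def add_cls gwa_exprs.intros intro!: cls_eqI gwa_cong.base_add del: equalityI)

lemma base_mult: "\<lbrakk>d \<in> carrier D; e \<in> carrier D\<rbrakk> \<Longrightarrow> base (d \<otimes>\<^bsub>D\<^esub> e) = base d \<otimes>\<^bsub>A\<^esub> base e"
  by (auto simp: base_def mult_cls gwa_exprs.intros intro!: cls_eqI gwa_cong.base_mul del: equalityI)

lemma base_one: "base \<one>\<^bsub>D\<^esub> = \<one>\<^bsub>A\<^esub>" and base_zero [simp]: "base \<zero>\<^bsub>D\<^esub> = \<zero>\<^bsub>A\<^esub>"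
  by (simp_all add: base_def one_gwa zero_gwa)

lemma gen_base:
  "\<lbrakk>i \<in> Field \<alpha>; \<epsilon> \<in> {1, -1}; d \<in> carrier D\<rbrakk>
    \<Longrightarrow> gen i \<epsilon> \<otimes>\<^bsub>A\<^esub> base d = base (\<sigma>_pow i \<epsilon> d) \<otimes>\<^bsub>A\<^esub> gen i \<epsilon>"
  using gwa_cong.plus_base[of i \<alpha> d D K \<sigma> a] gwa_cong.minus_base[of i \<alpha> d D K \<sigma> a]
  by (auto simp: gen_def base_def mult_cls gwa_exprs.intros \<sigma>_pow_1 \<sigma>_pow_minus_1
      intro!: cls_eqI del: equalityI)

lemma gen_gen_commute:
  "\<lbrakk>i \<in> Field \<alpha>; j \<in> Field \<alpha>; i \<noteq> j\<rbrakk> \<Longrightarrow> gen i \<epsilon> \<otimes>\<^bsub>A\<^esub> gen j \<eta> = gen j \<eta> \<otimes>\<^bsub>A\<^esub> gen i \<epsilon>"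
  by (auto simp: gen_def mult_cls gwa_exprs.intros
      intro!: cls_eqI gwa_cong.plus_plus gwa_cong.minus_minus gwa_cong.plus_minus
      gwa_cong.plus_minus[THEN gwa_cong.sym] del: equalityI)

text \<open>The exponent \<open>max \<epsilon> 0\<close> merges the relations
  \<open>X_i^+ X_i^- = \<sigma>_i(a_i)\<close> and \<open>X_i^- X_i^+ = a_i\<close>.\<close>

lemma gen_gen_cancel:
  assumes "i \<in> Field \<alpha>" "\<epsilon> \<in> {1, -1}"
  shows "gen i \<epsilon> \<otimes>\<^bsub>A\<^esub> gen i (-\<epsilon>) = base (\<sigma>_pow i (max \<epsilon> 0) (a i))"
  using assms a_carrier gwa_cong.plus_minus_same[of i \<alpha> K D \<sigma> a] gwa_cong.minus_plus_same[of i \<alpha> K D \<sigma> a]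
  by (auto simp: gen_def base_def mult_cls gwa_exprs.intros \<sigma>_pow_1 intro!: cls_eqI del: equalityI)

lemma cls_Neg:
  assumes "s \<in> gwa_exprs K D \<alpha>"
  shows "cls (Neg s) = \<ominus>\<^bsub>A\<^esub> cls s"
proof -
  have "cls (Neg s) \<oplus>\<^bsub>A\<^esub> cls s = \<zero>\<^bsub>A\<^esub>"
    using assms by (auto simp: zero_gwa add_cls gwa_exprs.intros intro!: cls_eqI gwa_cong.add_neg del: equalityI)
  then show ?thesis using assms A.minus_equality by (simp add: gwa_exprs.intros)
qed

text \<open>Scalars act through multiples of the identity of \<open>D\<close>, so in
  \<open>expand_rep\<close> they reduce to left multiplication by a base element.\<close>

lemma cls_Scal:
  assumes c: "c \<in> carrier K" and s: "s \<in> gwa_exprs K D \<alpha>"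
  shows "cls (Scal c s) = base (c \<odot>\<^bsub>D\<^esub> \<one>\<^bsub>D\<^esub>) \<otimes>\<^bsub>A\<^esub> cls s"
proof -
  have one: "Base \<one>\<^bsub>D\<^esub> \<in> gwa_exprs K D \<alpha>" by (simp add: gwa_exprs.intros)
  have "cls (Scal c s) = cls (Scal c (Mul (Base \<one>\<^bsub>D\<^esub>) s))"
    using c s by (intro cls_eqI gwa_cong.scal gwa_cong.one_mul[THEN gwa_cong.sym])
  also have "\<dots> = cls (Mul (Scal c (Base \<one>\<^bsub>D\<^esub>)) s)"
    using c s one by (intro cls_eqI gwa_cong.scal_mul_left[THEN gwa_cong.sym])
  also have "\<dots> = cls (Scal c (Base \<one>\<^bsub>D\<^esub>)) \<otimes>\<^bsub>A\<^esub> cls s"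
    using c s one by (simp add: mult_cls gwa_exprs.intros)
  also have "cls (Scal c (Base \<one>\<^bsub>D\<^esub>)) = base (c \<odot>\<^bsub>D\<^esub> \<one>\<^bsub>D\<^esub>)"
    unfolding base_def using c by (intro cls_eqI gwa_cong.base_scal[THEN gwa_cong.sym]) auto
  finally show ?thesis .
qed

definition gen_pow :: "'i \<Rightarrow> int \<Rightarrow> ('k, 'd, 'i) gwa_expr set" where
  "gen_pow i n = gen i (if n \<ge> 0 then 1 else -1) [^]\<^bsub>A\<^esub> nat \<bar>n\<bar>"

lemma gen_pow_closed [simp]: "i \<in> Field \<alpha> \<Longrightarrow> gen_pow i n \<in> carrier A"
  unfolding gen_pow_def by (intro A.nat_pow_closed) simp

lemma gen_pow_signed: "\<epsilon> \<in> {1, -1} \<Longrightarrow> gen_pow i (\<epsilon> * int k) = gen i \<epsilon> [^]\<^bsub>A\<^esub> k"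
  by (cases "k = 0") (auto simp: gen_pow_def simp del: pow_nat)

lemma gen_gen_pow:
  assumes i: "i \<in> Field \<alpha>" and \<epsilon>: "\<epsilon> \<in> {1, -1}"
  shows "gen i \<epsilon> \<otimes>\<^bsub>A\<^esub> gen_pow i n = base (left_coeff i \<epsilon> n) \<otimes>\<^bsub>A\<^esub> gen_pow i (n + \<epsilon>)"
proof (cases "\<epsilon> * n \<ge> 0")
  case True
  define k where "k = nat (\<epsilon> * n)"
  have n: "n = \<epsilon> * int k" "n + \<epsilon> = \<epsilon> * int (Suc k)" using True \<epsilon> by (auto simp: k_def)
  have "gen i \<epsilon> \<otimes>\<^bsub>A\<^esub> gen_pow i n = gen_pow i (n + \<epsilon>)"
    unfolding n(2) unfolding n(1) gen_pow_signed[OF \<epsilon>] using A.nat_pow_Suc2[of "gen i \<epsilon>" k] i by simp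
  then show ?thesis using True i by (simp add: left_coeff_def base_one)
next
  case False
  \<comment> \<open>One pair contracts; \<open>k\<close> counts the factors that remain.\<close>
  define k where "k = nat (-\<epsilon> * n) - 1"
  have n: "n = -\<epsilon> * int (Suc k)" "n + \<epsilon> = -\<epsilon> * int k" using False \<epsilon> by (auto simp: k_def)
  have \<epsilon>': "-\<epsilon> \<in> {1, -1}" using \<epsilon> by auto
  have "gen i \<epsilon> \<otimes>\<^bsub>A\<^esub> gen_pow i n = gen i \<epsilon> \<otimes>\<^bsub>A\<^esub> (gen i (-\<epsilon>) \<otimes>\<^bsub>A\<^esub> gen i (-\<epsilon>) [^]\<^bsub>A\<^esub> k)"
    unfolding n(1) gen_pow_signed[OF \<epsilon>'] using A.nat_pow_Suc2[of "gen i (-\<epsilon>)" k] i by simp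
  also have "\<dots> = gen i \<epsilon> \<otimes>\<^bsub>A\<^esub> gen i (-\<epsilon>) \<otimes>\<^bsub>A\<^esub> gen i (-\<epsilon>) [^]\<^bsub>A\<^esub> k"
    using i by (simp add: A.m_assoc)
  also have "\<dots> = base (left_coeff i \<epsilon> n) \<otimes>\<^bsub>A\<^esub> gen_pow i (n + \<epsilon>)"
    unfolding n(2) gen_pow_signed[OF \<epsilon>'] gen_gen_cancel[OF i \<epsilon>] using False by (simp add: left_coeff_def)
  finally show ?thesis .
qed

sublocale gens: commuting_powers A "Field \<alpha>" gen_pow
proof
  show "gen_pow i m \<otimes>\<^bsub>A\<^esub> gen_pow j n = gen_pow j n \<otimes>\<^bsub>A\<^esub> gen_pow i m"
    if "i \<in> Field \<alpha>" "j \<in> Field \<alpha>" "i \<noteq> j" for i j m n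
    unfolding gen_pow_def
    using that
    by (intro A.group_commutes_pow A.group_commutes_pow[symmetric] A.nat_pow_closed gen_gen_commute) auto
  show "gen_pow i 0 = \<one>\<^bsub>A\<^esub>" if "i \<in> Field \<alpha>" for i
    by (simp add: gen_pow_def)
qed simp

text \<open>The factor at \<open>i\<close> can be put in front of the monomial, so it alone meets
  the new generator.\<close>

lemma gen_monomial:
  assumes z: "z \<in> exponents (Field \<alpha>)" and i: "i \<in> Field \<alpha>" and \<epsilon>: "\<epsilon> \<in> {1, -1}"
  shows "gen i \<epsilon> \<otimes>\<^bsub>A\<^esub> gens.monomial z =
    base (left_coeff i \<epsilon> (z i)) \<otimes>\<^bsub>A\<^esub> gens.monomial (z(i := z i + \<epsilon>))"
proof -
  have c: "gens.monomial (z(i := 0)) \<in> carrier A"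
    by (rule gens.monomial_closed[OF exponents_update[OF z i]])
  have "gen i \<epsilon> \<otimes>\<^bsub>A\<^esub> gens.monomial z = gen i \<epsilon> \<otimes>\<^bsub>A\<^esub> gen_pow i (z i) \<otimes>\<^bsub>A\<^esub> gens.monomial (z(i := 0))"
    unfolding gens.monomial_split[OF z i] using i c by (simp only: A.m_assoc gen_closed gen_pow_closed)
  also have "\<dots> = base (left_coeff i \<epsilon> (z i)) \<otimes>\<^bsub>A\<^esub> (gen_pow i (z i + \<epsilon>) \<otimes>\<^bsub>A\<^esub> gens.monomial (z(i := 0)))"
    unfolding gen_gen_pow[OF i \<epsilon>]
    using i c by (simp only: A.m_assoc base_closed left_coeff_closed gen_pow_closed)
  also have "gen_pow i (z i + \<epsilon>) \<otimes>\<^bsub>A\<^esub> gens.monomial (z(i := 0)) = gens.monomial (z(i := z i + \<epsilon>))"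
    by (rule gens.monomial_update[OF z i, symmetric])
  finally show ?thesis .
qed

section \<open>From coefficient functions to elements of the algebra\<close>

definition expand :: "(('i \<Rightarrow> int) \<Rightarrow> 'd) \<Rightarrow> ('k, 'd, 'i) gwa_expr set" where
  "expand f = (\<Oplus>\<^bsub>A\<^esub>z\<in>supp f. base (f z) \<otimes>\<^bsub>A\<^esub> gens.monomial z)"

lemma term_closed:
  "\<lbrakk>f \<in> fin_coeffs; z \<in> exponents (Field \<alpha>)\<rbrakk> \<Longrightarrow> base (f z) \<otimes>\<^bsub>A\<^esub> gens.monomial z \<in> carrier A"
  using gens.monomial_closed by simp

text \<open>The supports of sums and of shifted functions are known only up to inclusion, so sums
  are compared over a larger finite set of exponents.\<close>

lemma expand_superset:
  assumes f: "f \<in> fin_coeffs" and S: "finite S" "supp f \<subseteq> S" "S \<subseteq> exponents (Field \<alpha>)"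
  shows "expand f = (\<Oplus>\<^bsub>A\<^esub>z\<in>S. base (f z) \<otimes>\<^bsub>A\<^esub> gens.monomial z)"
  unfolding expand_def
proof (rule A.add.finprod_mono_neutral_cong_left[OF S(1,2)])
  show "base (f z) \<otimes>\<^bsub>A\<^esub> gens.monomial z = \<zero>\<^bsub>A\<^esub>" if "z \<in> S - supp f" for z
    using that S(3) gens.monomial_closed[of z] by (auto simp: supp_def)
  show "(\<lambda>z. base (f z) \<otimes>\<^bsub>A\<^esub> gens.monomial z) \<in> S \<rightarrow> carrier A"
    using term_closed[OF f] S(3) by blast
qed simp

lemma expand_closed: "f \<in> fin_coeffs \<Longrightarrow> expand f \<in> carrier A"
  unfolding expand_def using term_closed fin_coeffs_exponents by (blast intro: A.finsum_closed)

lemma expand_unit_coeff: "expand unit_coeff = \<one>\<^bsub>A\<^esub>"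
proof -
  have "expand unit_coeff = (\<Oplus>\<^bsub>A\<^esub>z\<in>{\<lambda>_. 0}. base (unit_coeff z) \<otimes>\<^bsub>A\<^esub> gens.monomial z)"
    by (rule expand_superset[OF unit_coeff_fin]) (auto simp: supp_def unit_coeff_def zero_exponents)
  then show ?thesis by (simp add: unit_coeff_def base_one)
qed

lemma expand_zero: "supp f = {} \<Longrightarrow> expand f = \<zero>\<^bsub>A\<^esub>"
  by (simp add: expand_def)

lemma expand_add:
  assumes "f \<in> fin_coeffs" "g \<in> fin_coeffs"
  shows "expand (\<lambda>z. f z \<oplus>\<^bsub>D\<^esub> g z) = expand f \<oplus>\<^bsub>A\<^esub> expand g"
proof -
  let ?S = "supp f \<union> supp g"
  have S: "finite ?S" "?S \<subseteq> exponents (Field \<alpha>)" using assms by auto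
  have mono: "gens.monomial z \<in> carrier A" if "z \<in> ?S" for z
    using gens.monomial_closed S(2) that by blast
  have "expand (\<lambda>z. f z \<oplus>\<^bsub>D\<^esub> g z) = (\<Oplus>\<^bsub>A\<^esub>z\<in>?S. base (f z \<oplus>\<^bsub>D\<^esub> g z) \<otimes>\<^bsub>A\<^esub> gens.monomial z)"
    by (rule expand_superset[OF add_fin[OF assms] S(1) _ S(2)]) (auto simp: supp_def)
  also have "\<dots> = (\<Oplus>\<^bsub>A\<^esub>z\<in>?S. base (f z) \<otimes>\<^bsub>A\<^esub> gens.monomial z \<oplus>\<^bsub>A\<^esub> base (g z) \<otimes>\<^bsub>A\<^esub> gens.monomial z)"
    using assms mono by (intro A.finsum_cong') (auto simp: base_add A.l_distr)
  also have "\<dots> = (\<Oplus>\<^bsub>A\<^esub>z\<in>?S. base (f z) \<otimes>\<^bsub>A\<^esub> gens.monomial z) \<oplus>\<^bsub>A\<^esub>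
      (\<Oplus>\<^bsub>A\<^esub>z\<in>?S. base (g z) \<otimes>\<^bsub>A\<^esub> gens.monomial z)"
    using assms mono by (intro A.finsum_addf) auto
  also have "\<dots> = expand f \<oplus>\<^bsub>A\<^esub> expand g"
    using expand_superset[OF assms(1) S(1) _ S(2)] expand_superset[OF assms(2) S(1) _ S(2)] by simp
  finally show ?thesis .
qed

lemma expand_left_D:
  assumes d: "d \<in> carrier D" and f: "f \<in> fin_coeffs"
  shows "expand (left_D d f) = base d \<otimes>\<^bsub>A\<^esub> expand f"
proof -
  have mono: "gens.monomial z \<in> carrier A" if "z \<in> supp f" for z
    using gens.monomial_closed fin_coeffs_exponents[OF f] that by blast
  have "expand (left_D d f) = (\<Oplus>\<^bsub>A\<^esub>z\<in>supp f. base (left_D d f z) \<otimes>\<^bsub>A\<^esub> gens.monomial z)"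
    using d f supp_left_D[OF d f] by (intro expand_superset) auto
  also have "\<dots> = (\<Oplus>\<^bsub>A\<^esub>z\<in>supp f. base d \<otimes>\<^bsub>A\<^esub> (base (f z) \<otimes>\<^bsub>A\<^esub> gens.monomial z))"
    using d f mono by (intro A.finsum_cong') (auto simp: left_D_def base_mult A.m_assoc)
  also have "\<dots> = base d \<otimes>\<^bsub>A\<^esub> expand f"
    unfolding expand_def using d f mono by (intro A.finsum_rdistr[symmetric]) auto
  finally show ?thesis .
qed

lemma expand_left_X:
  assumes i: "i \<in> Field \<alpha>" and \<epsilon>: "\<epsilon> \<in> {1, -1}" and f: "f \<in> fin_coeffs"
  shows "expand (left_X i \<epsilon> f) = gen i \<epsilon> \<otimes>\<^bsub>A\<^esub> expand f"
proof -
  let ?s = "\<lambda>z. z(i := z i + \<epsilon>)"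
  have z: "z \<in> exponents (Field \<alpha>)" if "z \<in> supp f" for z
    using fin_coeffs_exponents[OF f] that by blast
  have mono: "gens.monomial z \<in> carrier A" "gens.monomial (?s z) \<in> carrier A" if "z \<in> supp f" for z
    using gens.monomial_closed exponents_update[OF z[OF that] i] z[OF that] by blast+
  have inj: "inj_on ?s (supp f)"
  proof (rule inj_on_inverseI)
    show "(\<lambda>z. z(i := z i - \<epsilon>)) (?s z) = z" for z by auto
  qed
  \<comment> \<open>The shifted support may exceed the support of the new function, but it is in
    bijection with \<open>supp f\<close>, which permits reindexing.\<close>
  have "expand (left_X i \<epsilon> f) = (\<Oplus>\<^bsub>A\<^esub>z\<in>?s ` supp f. base (left_X i \<epsilon> f z) \<otimes>\<^bsub>A\<^esub> gens.monomial z)"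
    using i f supp_left_X[OF i] shift_image_exponents[OF i f] by (intro expand_superset) auto
  also have "\<dots> = (\<Oplus>\<^bsub>A\<^esub>z\<in>supp f. base (left_X i \<epsilon> f (?s z)) \<otimes>\<^bsub>A\<^esub> gens.monomial (?s z))"
    using i f mono by (intro A.finsum_reindex[OF _ inj]) auto
  also have "\<dots> = (\<Oplus>\<^bsub>A\<^esub>z\<in>supp f. gen i \<epsilon> \<otimes>\<^bsub>A\<^esub> (base (f z) \<otimes>\<^bsub>A\<^esub> gens.monomial z))"
  proof (rule A.finsum_cong'[OF HOL.refl])
    show "(\<lambda>z. gen i \<epsilon> \<otimes>\<^bsub>A\<^esub> (base (f z) \<otimes>\<^bsub>A\<^esub> gens.monomial z)) \<in> supp f \<rightarrow> carrier A"
      using i f mono by auto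
    fix z assume zs: "z \<in> supp f"
    have "gen i \<epsilon> \<otimes>\<^bsub>A\<^esub> (base (f z) \<otimes>\<^bsub>A\<^esub> gens.monomial z) =
        gen i \<epsilon> \<otimes>\<^bsub>A\<^esub> base (f z) \<otimes>\<^bsub>A\<^esub> gens.monomial z"
      using i f mono[OF zs] by (simp add: A.m_assoc)
    also have "\<dots> = base (\<sigma>_pow i \<epsilon> (f z)) \<otimes>\<^bsub>A\<^esub> (gen i \<epsilon> \<otimes>\<^bsub>A\<^esub> gens.monomial z)"
      using i f mono[OF zs] by (simp add: gen_base[OF i \<epsilon>] A.m_assoc)
    also have "\<dots> = base (\<sigma>_pow i \<epsilon> (f z) \<otimes>\<^bsub>D\<^esub> left_coeff i \<epsilon> (z i)) \<otimes>\<^bsub>A\<^esub> gens.monomial (?s z)"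
      unfolding gen_monomial[OF z[OF zs] i \<epsilon>] using i f mono[OF zs] by (simp add: base_mult A.m_assoc)
    also have "\<sigma>_pow i \<epsilon> (f z) \<otimes>\<^bsub>D\<^esub> left_coeff i \<epsilon> (z i) = left_X i \<epsilon> f (?s z)"
      by (simp add: left_X_def)
    finally show "base (left_X i \<epsilon> f (?s z)) \<otimes>\<^bsub>A\<^esub> gens.monomial (?s z) =
        gen i \<epsilon> \<otimes>\<^bsub>A\<^esub> (base (f z) \<otimes>\<^bsub>A\<^esub> gens.monomial z)" by (rule HOL.sym)
  qed
  also have "\<dots> = gen i \<epsilon> \<otimes>\<^bsub>A\<^esub> expand f"
    unfolding expand_def using i f mono by (intro A.finsum_rdistr[symmetric]) auto
  finally show ?thesis .
qed

lemma base_neg: "d \<in> carrier D \<Longrightarrow> base (\<ominus>\<^bsub>D\<^esub> d) = \<ominus>\<^bsub>A\<^esub> base d"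
  using A.minus_equality[of "base (\<ominus>\<^bsub>D\<^esub> d)" "base d"] base_add[of "\<ominus>\<^bsub>D\<^esub> d" d] by (simp add: D.l_neg)

text \<open>\<open>expand\<close> turns the action of an expression into left multiplication by its
  class; by induction this reduces to base elements and generators.\<close>

lemma expand_rep:
  assumes "s \<in> gwa_exprs K D \<alpha>" "f \<in> fin_coeffs"
  shows "expand (rep s f) = cls s \<otimes>\<^bsub>A\<^esub> expand f"
  using assms
proof (induction s arbitrary: f rule: gwa_exprs.induct)
  case (1 d)
  then show ?case using expand_left_D by (simp add: base_def)
next
  case (2 i)
  then show ?case using expand_left_X[of i 1] by (simp add: gen_def)
next
  case (3 i)
  then show ?case using expand_left_X[of i "-1"] by (simp add: gen_def)
next
  case (4 s t)
  then show ?case by (simp add: expand_add rep_fin expand_closed A.l_distr flip: add_cls)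
next
  case (5 s)
  have neg: "(\<lambda>z. \<ominus>\<^bsub>D\<^esub> rep s f z) = left_D (\<ominus>\<^bsub>D\<^esub> \<one>\<^bsub>D\<^esub>) (rep s f)"
    using 5 rep_fin by (simp add: left_D_def D.l_minus)
  have "expand (rep (Neg s) f) = base (\<ominus>\<^bsub>D\<^esub> \<one>\<^bsub>D\<^esub>) \<otimes>\<^bsub>A\<^esub> (cls s \<otimes>\<^bsub>A\<^esub> expand f)"
    using 5 rep_fin expand_left_D[of "\<ominus>\<^bsub>D\<^esub> \<one>\<^bsub>D\<^esub>" "rep s f"] by (simp add: neg)
  also have "\<dots> = cls (Neg s) \<otimes>\<^bsub>A\<^esub> expand f"
    using 5 by (simp add: base_neg base_one cls_Neg A.l_minus expand_closed)
  finally show ?case .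
next
  case (6 s t)
  then show ?case by (simp add: rep_fin expand_closed A.m_assoc flip: mult_cls)
next
  case (7 c s)
  have smult: "(\<lambda>z. c \<odot>\<^bsub>D\<^esub> rep s f z) = left_D (c \<odot>\<^bsub>D\<^esub> \<one>\<^bsub>D\<^esub>) (rep s f)"
    using 7 rep_fin by (simp add: left_D_def smult_mult_left)
  have "expand (rep (Scal c s) f) = base (c \<odot>\<^bsub>D\<^esub> \<one>\<^bsub>D\<^esub>) \<otimes>\<^bsub>A\<^esub> (cls s \<otimes>\<^bsub>A\<^esub> expand f)"
    using 7 rep_fin expand_left_D[of "c \<odot>\<^bsub>D\<^esub> \<one>\<^bsub>D\<^esub>" "rep s f"] by (simp add: smult)
  also have "\<dots> = cls (Scal c s) \<otimes>\<^bsub>A\<^esub> expand f"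
    using 7 by (simp add: cls_Scal A.m_assoc expand_closed)
  finally show ?case .
qed

text \<open>The monomials span the algebra, and a class is recovered from its coefficients. In
  particular a nonzero class has nonempty support.\<close>

lemma expand_rep_unit_coeff: "s \<in> gwa_exprs K D \<alpha> \<Longrightarrow> expand (rep s unit_coeff) = cls s"
  by (simp add: expand_rep expand_unit_coeff)

section \<open>Products of translates of the \<open>a\<^sub>i\<close>\<close>

text \<open>The index set records which translates may occur, so that the exponents belonging to one
  \<open>i\<close> can be shifted and bounded.\<close>

inductive_set a_prods :: "('i \<times> int) set \<Rightarrow> 'd set" for S where
  one: "\<one>\<^bsub>D\<^esub> \<in> a_prods S"
| mult: "\<lbrakk>s \<in> a_prods S; (i, j) \<in> S\<rbrakk> \<Longrightarrow> s \<otimes>\<^bsub>D\<^esub> \<sigma>_pow i j (a i) \<in> a_prods S"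

lemma a_prods_mono: "\<lbrakk>s \<in> a_prods S; S \<subseteq> T\<rbrakk> \<Longrightarrow> s \<in> a_prods T"
  by (induction rule: a_prods.induct) (auto intro: a_prods.intros)

lemma a_prods_finite:
  assumes "s \<in> a_prods S"
  obtains T where "finite T" "T \<subseteq> S" "s \<in> a_prods T"
proof -
  have "\<exists>T. finite T \<and> T \<subseteq> S \<and> s \<in> a_prods T"
    using assms
  proof (induction rule: a_prods.induct)
    case one
    then show ?case by (meson a_prods.one empty_subsetI finite.emptyI)
  next
    case (mult s i j)
    then obtain T where T: "finite T" "T \<subseteq> S" "s \<in> a_prods T" by blast
    then have "s \<otimes>\<^bsub>D\<^esub> \<sigma>_pow i j (a i) \<in> a_prods (insert (i, j) T)"
      using a_prods_mono by (intro a_prods.mult) blast+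
    with T mult.hyps(2) show ?case by (meson finite.insertI insert_subset)
  qed
  then show ?thesis using that by blast
qed

lemma a_prods_closed: "\<lbrakk>s \<in> a_prods S; S \<subseteq> Field \<alpha> \<times> UNIV\<rbrakk> \<Longrightarrow> s \<in> carrier D"
  by (induction rule: a_prods.induct) (auto simp: a_carrier)

lemma a_prods_central:
  assumes "s \<in> a_prods S" "S \<subseteq> Field \<alpha> \<times> UNIV" "d \<in> carrier D"
  shows "s \<otimes>\<^bsub>D\<^esub> d = d \<otimes>\<^bsub>D\<^esub> s"
  using assms(1)
proof (induction rule: a_prods.induct)
  case one
  then show ?case using assms by simp
next
  case (mult s i j)
  have i: "i \<in> Field \<alpha>" and s: "s \<in> carrier D" and c: "\<sigma>_pow i j (a i) \<in> carrier D"
    using mult.hyps assms(2) a_prods_closed a_carrier by auto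
  have "s \<otimes>\<^bsub>D\<^esub> \<sigma>_pow i j (a i) \<otimes>\<^bsub>D\<^esub> d = s \<otimes>\<^bsub>D\<^esub> (\<sigma>_pow i j (a i) \<otimes>\<^bsub>D\<^esub> d)"
    using s c assms(3) by (simp add: D.m_assoc)
  also have "\<dots> = s \<otimes>\<^bsub>D\<^esub> d \<otimes>\<^bsub>D\<^esub> \<sigma>_pow i j (a i)"
    unfolding \<sigma>_pow_a_central[OF i assms(3)] using s c assms(3) by (simp add: D.m_assoc)
  also have "\<dots> = d \<otimes>\<^bsub>D\<^esub> (s \<otimes>\<^bsub>D\<^esub> \<sigma>_pow i j (a i))"
    unfolding mult.IH using s c assms(3) by (simp add: D.m_assoc)
  finally show ?case .
qed

lemma a_prods_mult:
  assumes "s \<in> a_prods S" "t \<in> a_prods S" "S \<subseteq> Field \<alpha> \<times> UNIV"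
  shows "s \<otimes>\<^bsub>D\<^esub> t \<in> a_prods S"
  using assms(2)
proof (induction rule: a_prods.induct)
  case one
  then show ?case using assms a_prods_closed by simp
next
  case (mult t i j)
  have "s \<otimes>\<^bsub>D\<^esub> t \<otimes>\<^bsub>D\<^esub> \<sigma>_pow i j (a i) \<in> a_prods S" using mult by (intro a_prods.mult)
  moreover have "s \<in> carrier D" "t \<in> carrier D" "\<sigma>_pow i j (a i) \<in> carrier D"
    using assms mult.hyps a_prods_closed a_carrier by auto
  ultimately show ?case by (simp add: D.m_assoc)
qed

text \<open>The factors are central and can be sorted. This separates the factors belonging to one
  index from the others.\<close>

lemma a_prods_split:
  assumes "s \<in> a_prods (S \<union> T)" "S \<subseteq> Field \<alpha> \<times> UNIV" "T \<subseteq> Field \<alpha> \<times> UNIV"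
  obtains t r where "t \<in> a_prods S" "r \<in> a_prods T" "s = t \<otimes>\<^bsub>D\<^esub> r"
proof -
  have "\<exists>t\<in>a_prods S. \<exists>r\<in>a_prods T. s = t \<otimes>\<^bsub>D\<^esub> r"
    using assms(1)
  proof (induction rule: a_prods.induct)
    case one
    have "\<one>\<^bsub>D\<^esub> = \<one>\<^bsub>D\<^esub> \<otimes>\<^bsub>D\<^esub> \<one>\<^bsub>D\<^esub>" by simp
    then show ?case using a_prods.one by blast
  next
    case (mult s i j)
    then obtain t r where tr: "t \<in> a_prods S" "r \<in> a_prods T" "s = t \<otimes>\<^bsub>D\<^esub> r" by blast
    let ?c = "\<sigma>_pow i j (a i)"
    have c: "i \<in> Field \<alpha>" "t \<in> carrier D" "r \<in> carrier D" "?c \<in> carrier D"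
      using tr mult.hyps(2) assms a_prods_closed a_carrier by auto
    have "s \<otimes>\<^bsub>D\<^esub> ?c = t \<otimes>\<^bsub>D\<^esub> (r \<otimes>\<^bsub>D\<^esub> ?c)" using c tr by (simp add: D.m_assoc)
    moreover have "s \<otimes>\<^bsub>D\<^esub> ?c = (t \<otimes>\<^bsub>D\<^esub> ?c) \<otimes>\<^bsub>D\<^esub> r"
      using c tr \<sigma>_pow_a_central[OF c(1,3), of j] by (simp add: D.m_assoc)
    ultimately show ?case using tr mult.hyps(2) a_prods.mult by blast
  qed
  then show ?thesis using that by blast
qed

text \<open>Only the factors belonging to \<open>i\<close> move, since \<open>\<sigma> i\<close>
  fixes every other \<open>a k\<close> and commutes with \<open>\<sigma> k\<close>.\<close>

lemma \<sigma>_pow_a_prods: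
  assumes i: "i \<in> Field \<alpha>" and S: "S \<subseteq> Field \<alpha> \<times> UNIV" and "s \<in> a_prods S"
  shows "\<sigma>_pow i m s \<in> a_prods ((\<lambda>(k, j). (k, if k = i then m + j else j)) ` S)"
  using assms(3)
proof (induction rule: a_prods.induct)
  case one
  then show ?case using i by (simp add: a_prods.one)
next
  case (mult s k j)
  let ?j = "if k = i then m + j else j"
  have k: "k \<in> Field \<alpha>" and s: "s \<in> carrier D" using mult.hyps S a_prods_closed by auto
  have "\<sigma>_pow i m (\<sigma>_pow k j (a k)) = \<sigma>_pow k ?j (a k)"
  proof (cases "k = i")
    case True
    then show ?thesis using i a_carrier by (simp add: \<sigma>_pow_\<sigma>_pow)
  next
    case False
    then show ?thesis using i k a_carrier \<sigma>_pow_commute[OF i k, of "a k" m j] by simp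
  qed
  then have "\<sigma>_pow i m (s \<otimes>\<^bsub>D\<^esub> \<sigma>_pow k j (a k)) = \<sigma>_pow i m s \<otimes>\<^bsub>D\<^esub> \<sigma>_pow k ?j (a k)"
    using i k s a_carrier by (simp only: \<sigma>_pow_mult \<sigma>_pow_closed)
  moreover have "(k, ?j) \<in> (\<lambda>(k, j). (k, if k = i then m + j else j)) ` S"
    using mult.hyps(2) by force
  ultimately show ?case using a_prods.mult[OF mult.IH] by (simp only:)
qed

lemma \<sigma>_pow_fixes_a_prods:
  assumes i: "i \<in> Field \<alpha>" and S: "S \<subseteq> (Field \<alpha> - {i}) \<times> UNIV" and "s \<in> a_prods S"
  shows "\<sigma>_pow i m s = s"
  using assms(3)
proof (induction rule: a_prods.induct)
  case one
  then show ?case using i by simp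
next
  case (mult s k j)
  have k: "k \<in> Field \<alpha>" "k \<noteq> i" and s: "s \<in> carrier D" using mult.hyps S a_prods_closed[of s S] by auto
  then show ?case
    using i a_carrier mult.IH \<sigma>_pow_commute[OF i k(1), of "a k" m j] by (simp add: \<sigma>_pow_mult)
qed

section \<open>Comaximal elements\<close>

definition comaximal :: "'d \<Rightarrow> 'd \<Rightarrow> bool" where
  "comaximal s t \<longleftrightarrow> (\<exists>x\<in>carrier D. \<exists>y\<in>carrier D. x \<otimes>\<^bsub>D\<^esub> s \<oplus>\<^bsub>D\<^esub> y \<otimes>\<^bsub>D\<^esub> t = \<one>\<^bsub>D\<^esub>)"

lemma comaximalI:
  "\<lbrakk>x \<in> carrier D; y \<in> carrier D; \<one>\<^bsub>D\<^esub> = x \<otimes>\<^bsub>D\<^esub> s \<oplus>\<^bsub>D\<^esub> y \<otimes>\<^bsub>D\<^esub> t\<rbrakk> \<Longrightarrow> comaximal s t"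
  unfolding comaximal_def by (intro bexI) (rule HOL.sym)

lemma comaximal_sym:
  assumes "comaximal s t" "s \<in> carrier D" "t \<in> carrier D"
  shows "comaximal t s"
proof -
  obtain x y where xy: "x \<in> carrier D" "y \<in> carrier D" "x \<otimes>\<^bsub>D\<^esub> s \<oplus>\<^bsub>D\<^esub> y \<otimes>\<^bsub>D\<^esub> t = \<one>\<^bsub>D\<^esub>"
    using assms(1) unfolding comaximal_def by blast
  then show ?thesis
    using assms(2,3) D.a_comm[of "x \<otimes>\<^bsub>D\<^esub> s" "y \<otimes>\<^bsub>D\<^esub> t"] by (intro comaximalI[of y x]) simp_all
qed

text \<open>Inserting the relation for \<open>s'\<close> after \<open>x s\<close> gives
  \<open>x s (x' s' + y' t) + y t = 1\<close>; centrality of \<open>s\<close> turns the leading term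
  into a multiple of \<open>s s'\<close>.\<close>

lemma comaximal_mult:
  assumes "comaximal s t" "comaximal s' t"
    and c: "s \<in> carrier D" "s' \<in> carrier D" "t \<in> carrier D"
    and central: "\<And>d. d \<in> carrier D \<Longrightarrow> s \<otimes>\<^bsub>D\<^esub> d = d \<otimes>\<^bsub>D\<^esub> s"
  shows "comaximal (s \<otimes>\<^bsub>D\<^esub> s') t"
proof -
  obtain x y where xy: "x \<in> carrier D" "y \<in> carrier D" "x \<otimes>\<^bsub>D\<^esub> s \<oplus>\<^bsub>D\<^esub> y \<otimes>\<^bsub>D\<^esub> t = \<one>\<^bsub>D\<^esub>"
    using assms(1) unfolding comaximal_def by blast
  obtain x' y' where xy': "x' \<in> carrier D" "y' \<in> carrier D" "x' \<otimes>\<^bsub>D\<^esub> s' \<oplus>\<^bsub>D\<^esub> y' \<otimes>\<^bsub>D\<^esub> t = \<one>\<^bsub>D\<^esub>"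
    using assms(2) unfolding comaximal_def by blast
  have "\<one>\<^bsub>D\<^esub> = x \<otimes>\<^bsub>D\<^esub> s \<otimes>\<^bsub>D\<^esub> (x' \<otimes>\<^bsub>D\<^esub> s' \<oplus>\<^bsub>D\<^esub> y' \<otimes>\<^bsub>D\<^esub> t) \<oplus>\<^bsub>D\<^esub> y \<otimes>\<^bsub>D\<^esub> t"
    using xy xy' c by simp
  also have "\<dots> = x \<otimes>\<^bsub>D\<^esub> (s \<otimes>\<^bsub>D\<^esub> x') \<otimes>\<^bsub>D\<^esub> s' \<oplus>\<^bsub>D\<^esub> (x \<otimes>\<^bsub>D\<^esub> s \<otimes>\<^bsub>D\<^esub> y' \<oplus>\<^bsub>D\<^esub> y) \<otimes>\<^bsub>D\<^esub> t"
    using xy(1,2) xy'(1,2) c by (simp add: D.r_distr D.l_distr D.m_assoc D.a_assoc)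
  also have "x \<otimes>\<^bsub>D\<^esub> (s \<otimes>\<^bsub>D\<^esub> x') \<otimes>\<^bsub>D\<^esub> s' = (x \<otimes>\<^bsub>D\<^esub> x') \<otimes>\<^bsub>D\<^esub> (s \<otimes>\<^bsub>D\<^esub> s')"
    using xy(1) xy'(1) c central[OF xy'(1)] by (simp add: D.m_assoc)
  finally show ?thesis
    by (rule comaximalI[rotated 2]) (use xy(1,2) xy'(1,2) c in simp_all)
qed

end

section \<open>Comaximal translates and cancellation in stable ideals\<close>

locale simple_gwa_datum = gwa_datum K D \<alpha> \<sigma> a
  for K :: "('k, 'm) ring_scheme" (structure) and D :: "('k, 'd, 'n) module_scheme" (structure)
    and \<alpha> :: "'i rel" and \<sigma> a +
  assumes nonempty: "Field \<alpha> \<noteq> {}"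
    and \<sigma>_simple: "\<lbrakk>ideal J D; sigma_stable K D \<alpha> \<sigma> J\<rbrakk> \<Longrightarrow> J = {\<zero>\<^bsub>D\<^esub>} \<or> J = carrier D"
    and outer: "outer_free K D \<alpha> \<sigma>"
    and a_comaximal: "\<lbrakk>i \<in> Field \<alpha>; (m::nat) \<ge> 1\<rbrakk> \<Longrightarrow>
      (carrier D #>\<^bsub>D\<^esub> a i) <+>\<^bsub>D\<^esub> (carrier D #>\<^bsub>D\<^esub> (\<sigma> i [^]\<^bsub>Aut K D\<^esub> m) (a i)) = carrier D"
begin

lemma one_not_zero: "\<one>\<^bsub>D\<^esub> \<noteq> \<zero>\<^bsub>D\<^esub>"
  using nonempty a_nonzero a_carrier D.one_zeroD by blast

text \<open>For \<open>j < k\<close>, apply \<open>\<sigma>_pow i j\<close> to the hypothesis with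
  \<open>m = k - j\<close>; the other order follows by symmetry.\<close>

lemma comaximal_translates:
  assumes i: "i \<in> Field \<alpha>" and "j \<noteq> k"
  shows "comaximal (\<sigma>_pow i j (a i)) (\<sigma>_pow i k (a i))"
proof -
  have less: "comaximal (\<sigma>_pow i j (a i)) (\<sigma>_pow i k (a i))" if "j < k" for j k
  proof -
    define m where "m = nat (k - j)"
    have m: "m \<ge> 1" "k = j + int m" using that by (auto simp: m_def)
    have "\<one>\<^bsub>D\<^esub> \<in> (carrier D #>\<^bsub>D\<^esub> a i) <+>\<^bsub>D\<^esub> (carrier D #>\<^bsub>D\<^esub> (\<sigma> i [^]\<^bsub>Aut K D\<^esub> m) (a i))"
      using a_comaximal[OF i m(1)] by simp
    then obtain x y where xy: "x \<in> carrier D" "y \<in> carrier D"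
      "\<one>\<^bsub>D\<^esub> = x \<otimes>\<^bsub>D\<^esub> a i \<oplus>\<^bsub>D\<^esub> y \<otimes>\<^bsub>D\<^esub> \<sigma>_pow i (int m) (a i)"
      unfolding set_add_def' r_coset_def \<sigma>_pow_nat by blast
    have "\<sigma>_pow i j \<one>\<^bsub>D\<^esub> = \<sigma>_pow i j (x \<otimes>\<^bsub>D\<^esub> a i \<oplus>\<^bsub>D\<^esub> y \<otimes>\<^bsub>D\<^esub> \<sigma>_pow i (int m) (a i))"
      using xy(3) by (rule arg_cong)
    then have "\<one>\<^bsub>D\<^esub> = \<sigma>_pow i j x \<otimes>\<^bsub>D\<^esub> \<sigma>_pow i j (a i) \<oplus>\<^bsub>D\<^esub> \<sigma>_pow i j y \<otimes>\<^bsub>D\<^esub> \<sigma>_pow i k (a i)"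
      using i xy(1,2) a_carrier m(2) by (simp add: \<sigma>_pow_add \<sigma>_pow_mult \<sigma>_pow_\<sigma>_pow)
    then show ?thesis by (rule comaximalI[rotated 2]) (use i xy(1,2) in simp_all)
  qed
  show ?thesis
  proof (cases "j < k")
    case True
    then show ?thesis by (rule less)
  next
    case False
    then have "k < j" using assms by simp
    then show ?thesis using comaximal_sym[OF less] i a_carrier by simp
  qed
qed

text \<open>Comaximality is multiplicative in each argument, so two nested inductions reduce the
  claim to single translates. Their exponents differ because \<open>J\<close> and \<open>J'\<close>
  are disjoint.\<close>

lemma comaximal_a_prods:
  assumes i: "i \<in> Field \<alpha>" and disj: "J \<inter> J' = {}"
    and "s \<in> a_prods ({i} \<times> J)" "t \<in> a_prods ({i} \<times> J')"
  shows "comaximal s t"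
  using assms(3)
proof (induction rule: a_prods.induct)
  have sub: "{i} \<times> L \<subseteq> Field \<alpha> \<times> UNIV" for L :: "int set" using i by auto
  have t: "t \<in> carrier D" using a_prods_closed[OF assms(4) sub] .
  have "\<one>\<^bsub>D\<^esub> \<otimes>\<^bsub>D\<^esub> \<one>\<^bsub>D\<^esub> \<oplus>\<^bsub>D\<^esub> \<zero>\<^bsub>D\<^esub> \<otimes>\<^bsub>D\<^esub> t = \<one>\<^bsub>D\<^esub>" using t by simp
  then show "comaximal \<one>\<^bsub>D\<^esub> t" unfolding comaximal_def by blast
next
  have sub: "{i} \<times> L \<subseteq> Field \<alpha> \<times> UNIV" for L :: "int set" using i by auto
  have t: "t \<in> carrier D" using a_prods_closed[OF assms(4) sub] .
  case (mult s k j)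
  then have [simp]: "k = i" and j: "j \<in> J" by auto
  have c: "\<sigma>_pow i j (a i) \<in> carrier D" using i a_carrier by simp
  have "comaximal t (\<sigma>_pow i j (a i))"
    using assms(4)
  proof (induction rule: a_prods.induct)
    case one
    have "\<one>\<^bsub>D\<^esub> \<otimes>\<^bsub>D\<^esub> \<one>\<^bsub>D\<^esub> \<oplus>\<^bsub>D\<^esub> \<zero>\<^bsub>D\<^esub> \<otimes>\<^bsub>D\<^esub> \<sigma>_pow i j (a i) = \<one>\<^bsub>D\<^esub>" using c by simp
    then show ?case unfolding comaximal_def by blast
  next
    case (mult t k l)
    then have "k = i" "l \<noteq> j" using j disj by auto
    then show ?case
      using comaximal_mult[OF mult.IH comaximal_translates[OF i \<open>l \<noteq> j\<close>]]
        a_prods_closed[OF mult.hyps(1) sub] a_prods_central[OF mult.hyps(1) sub] c i a_carrier by simp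
  qed
  then have "comaximal (\<sigma>_pow i j (a i)) t" using comaximal_sym t c by blast
  then show ?case
    using comaximal_mult[OF mult.IH] a_prods_closed[OF mult.hyps(1) sub]
      a_prods_central[OF mult.hyps(1) sub] c t by simp
qed

text \<open>The degree-zero components of elements of an ideal of the generalized Weyl algebra, with
  prescribed support, are closed under \<open>c \<mapsto> X\<^sub>i\<^sup>+ c X\<^sub>i\<^sup>-\<close> and \<open>c \<mapsto> X\<^sub>i\<^sup>- c X\<^sub>i\<^sup>+\<close>.\<close>

definition X_stable :: "'d set \<Rightarrow> bool" where
  "X_stable C \<longleftrightarrow> (\<forall>i\<in>Field \<alpha>. \<forall>\<epsilon>\<in>{1, -1}. \<forall>c\<in>C. \<sigma>_pow i \<epsilon> c \<otimes>\<^bsub>D\<^esub> \<sigma>_pow i (max \<epsilon> 0) (a i) \<in> C)"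

context
  fixes C
  assumes C: "ideal C D" and stable: "X_stable C"
begin

interpretation C: ideal C D by (rule C)

text \<open>One use of stability shifts the factors belonging to \<open>i\<close> by
  \<open>\<epsilon>\<close>, adds a factor with exponent \<open>max \<epsilon> 0\<close>, and leaves
  \<open>r\<close> alone.\<close>

lemma X_stable_step:
  assumes i: "i \<in> Field \<alpha>" and \<epsilon>: "\<epsilon> \<in> {1, -1}" and r: "r \<in> carrier D" "\<sigma>_pow i \<epsilon> r = r"
    and t: "t \<in> a_prods ({i} \<times> J)" "t \<otimes>\<^bsub>D\<^esub> r \<in> C"
  obtains t' where "t' \<in> a_prods ({i} \<times> insert (max \<epsilon> 0) ((+) \<epsilon> ` J))" "t' \<otimes>\<^bsub>D\<^esub> r \<in> C"
proof
  let ?S = "{i} \<times> insert (max \<epsilon> 0) ((+) \<epsilon> ` J)" and ?c = "\<sigma>_pow i (max \<epsilon> 0) (a i)"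
  have sub: "{i} \<times> J \<subseteq> Field \<alpha> \<times> UNIV" using i by auto
  have tc: "t \<in> carrier D" "\<sigma>_pow i \<epsilon> t \<in> carrier D" "?c \<in> carrier D"
    using a_prods_closed[OF t(1) sub] i a_carrier by auto
  have "\<sigma>_pow i \<epsilon> t \<in> a_prods ?S"
    using \<sigma>_pow_a_prods[OF i sub t(1), of \<epsilon>] by (rule a_prods_mono) auto
  then show "\<sigma>_pow i \<epsilon> t \<otimes>\<^bsub>D\<^esub> ?c \<in> a_prods ?S" by (rule a_prods.mult) simp
  have "\<sigma>_pow i \<epsilon> (t \<otimes>\<^bsub>D\<^esub> r) \<otimes>\<^bsub>D\<^esub> ?c \<in> C" using stable i \<epsilon> t(2) unfolding X_stable_def by blast
  also have "\<sigma>_pow i \<epsilon> (t \<otimes>\<^bsub>D\<^esub> r) \<otimes>\<^bsub>D\<^esub> ?c = \<sigma>_pow i \<epsilon> t \<otimes>\<^bsub>D\<^esub> (r \<otimes>\<^bsub>D\<^esub> ?c)"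
    using i tc r by (simp add: \<sigma>_pow_mult D.m_assoc)
  also have "\<dots> = \<sigma>_pow i \<epsilon> t \<otimes>\<^bsub>D\<^esub> ?c \<otimes>\<^bsub>D\<^esub> r"
    unfolding \<sigma>_pow_a_central[OF i r(1), symmetric] using tc r by (simp add: D.m_assoc)
  finally show "\<sigma>_pow i \<epsilon> t \<otimes>\<^bsub>D\<^esub> ?c \<otimes>\<^bsub>D\<^esub> r \<in> C" .
qed

text \<open>Each use of \<open>X_stable_step\<close> with \<open>\<epsilon> = 1\<close> raises the
  lower bound by one, and the added factors have exponent 1; so the bound 1 is reached after
  \<open>n\<close> steps.\<close>

lemma X_stable_up:
  assumes i: "i \<in> Field \<alpha>" and r: "r \<in> carrier D" "\<And>m. \<sigma>_pow i m r = r"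
  shows "\<lbrakk>t \<in> a_prods ({i} \<times> {1 - int n..}); t \<otimes>\<^bsub>D\<^esub> r \<in> C\<rbrakk> \<Longrightarrow> \<exists>t'\<in>a_prods ({i} \<times> {1..}). t' \<otimes>\<^bsub>D\<^esub> r \<in> C"
proof (induction n arbitrary: t)
  case 0
  then show ?case by auto
next
  case (Suc n)
  obtain t' where t': "t' \<in> a_prods ({i} \<times> insert (max 1 0) ((+) 1 ` {1 - int (Suc n)..}))" "t' \<otimes>\<^bsub>D\<^esub> r \<in> C"
    using X_stable_step[OF i _ r(1) r(2) Suc.prems, of 1] by auto
  have "t' \<in> a_prods ({i} \<times> {1 - int n..})" by (rule a_prods_mono[OF t'(1)]) auto
  then show ?case using Suc.IH t'(2) by blast
qed

text \<open>For \<open>\<epsilon> = -1\<close> the added factors have exponent 0. The final range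
  \<open>{..0}\<close> is disjoint from the range \<open>{1..}\<close> of the upward direction, as
  comaximality requires.\<close>

lemma X_stable_down:
  assumes i: "i \<in> Field \<alpha>" and r: "r \<in> carrier D" "\<And>m. \<sigma>_pow i m r = r"
  shows "\<lbrakk>t \<in> a_prods ({i} \<times> {..int n}); t \<otimes>\<^bsub>D\<^esub> r \<in> C\<rbrakk> \<Longrightarrow> \<exists>t'\<in>a_prods ({i} \<times> {..0}). t' \<otimes>\<^bsub>D\<^esub> r \<in> C"
proof (induction n arbitrary: t)
  case 0
  then show ?case by auto
next
  case (Suc n)
  obtain t' where t': "t' \<in> a_prods ({i} \<times> insert (max (-1) 0) ((+) (-1) ` {..int (Suc n)}))" "t' \<otimes>\<^bsub>D\<^esub> r \<in> C"
    using X_stable_step[OF i _ r(1) r(2) Suc.prems, of "-1"] by auto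
  have "t' \<in> a_prods ({i} \<times> {..int n})" by (rule a_prods_mono[OF t'(1)]) auto
  then show ?case using Suc.IH t'(2) by blast
qed

text \<open>Shifting up and shifting down yield multipliers \<open>u\<close> and \<open>v\<close>
  with disjoint ranges of exponents. These are comaximal, and \<open>x u + y v = 1\<close> gives
  \<open>r = x (u r) + y (v r)\<close>.\<close>

lemma X_stable_cancel:
  assumes i: "i \<in> Field \<alpha>" and r: "r \<in> carrier D" "\<And>m. \<sigma>_pow i m r = r"
    and t: "t \<in> a_prods ({i} \<times> UNIV)" "t \<otimes>\<^bsub>D\<^esub> r \<in> C"
  shows "r \<in> C"
proof -
  obtain T where T: "finite T" "T \<subseteq> {i} \<times> UNIV" "t \<in> a_prods T" using a_prods_finite[OF t(1)] .
  have fin: "finite ((\<lambda>p. nat \<bar>snd p\<bar>) ` T)" using T(1) by simp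
  \<comment> \<open>A common bound for the finitely many exponents makes both shifting lemmas
    applicable.\<close>
  from finite_nat_bounded[OF this] obtain n where n: "(\<lambda>p. nat \<bar>snd p\<bar>) ` T \<subseteq> {..<n}" ..
  have "T \<subseteq> {i} \<times> {1 - int n..} \<inter> {i} \<times> {..int n}"
  proof
    fix p assume "p \<in> T"
    then have "fst p = i" "nat \<bar>snd p\<bar> < n" using T(2) n by auto
    then show "p \<in> {i} \<times> {1 - int n..} \<inter> {i} \<times> {..int n}" by (cases p) auto
  qed
  then have "t \<in> a_prods ({i} \<times> {1 - int n..})" "t \<in> a_prods ({i} \<times> {..int n})"
    using a_prods_mono[OF T(3)] by simp_all
  then obtain u v where u: "u \<in> a_prods ({i} \<times> {1..})" "u \<otimes>\<^bsub>D\<^esub> r \<in> C"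
    and v: "v \<in> a_prods ({i} \<times> {..0})" "v \<otimes>\<^bsub>D\<^esub> r \<in> C"
    using X_stable_up[OF i r _ t(2)] X_stable_down[OF i r _ t(2)] by meson
  have "comaximal u v" by (rule comaximal_a_prods[OF i _ u(1) v(1)]) auto
  then obtain x y where xy: "x \<in> carrier D" "y \<in> carrier D" "x \<otimes>\<^bsub>D\<^esub> u \<oplus>\<^bsub>D\<^esub> y \<otimes>\<^bsub>D\<^esub> v = \<one>\<^bsub>D\<^esub>"
    unfolding comaximal_def by blast
  have uv: "u \<in> carrier D" "v \<in> carrier D" using u(1) v(1) i a_prods_closed by auto
  have "r = (x \<otimes>\<^bsub>D\<^esub> u \<oplus>\<^bsub>D\<^esub> y \<otimes>\<^bsub>D\<^esub> v) \<otimes>\<^bsub>D\<^esub> r" using xy(3) r by simp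
  also have "\<dots> = x \<otimes>\<^bsub>D\<^esub> (u \<otimes>\<^bsub>D\<^esub> r) \<oplus>\<^bsub>D\<^esub> y \<otimes>\<^bsub>D\<^esub> (v \<otimes>\<^bsub>D\<^esub> r)"
    using xy(1,2) uv r by (simp add: D.l_distr D.m_assoc)
  also have "\<dots> \<in> C" by (rule C.a_closed[OF C.I_l_closed[OF u(2) xy(1)] C.I_l_closed[OF v(2) xy(2)]])
  finally show ?thesis .
qed

text \<open>The indices occurring in \<open>s\<close> are removed one at a time. Once the factors
  belonging to \<open>i\<close> are split off, the rest is fixed by all
  \<open>\<sigma>_pow i m\<close>, as \<open>X_stable_cancel\<close> demands.\<close>

lemma X_stable_one:
  assumes "s \<in> a_prods (Field \<alpha> \<times> UNIV)" "s \<in> C"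
  shows "\<one>\<^bsub>D\<^esub> \<in> C"
proof -
  have "\<one>\<^bsub>D\<^esub> \<in> C" if "finite F" "F \<subseteq> Field \<alpha>" "s \<in> a_prods (F \<times> UNIV)" "s \<in> C" for F s
    using that
  proof (induction F arbitrary: s rule: finite_induct)
    case empty
    then have "s = \<one>\<^bsub>D\<^esub>" by (auto elim: a_prods.cases)
    with empty show ?case by simp
  next
    case (insert i F)
    have i: "i \<in> Field \<alpha>" and F: "F \<subseteq> Field \<alpha>" using insert.prems by auto
    have "insert i F \<times> UNIV = {i} \<times> (UNIV :: int set) \<union> F \<times> UNIV" by auto
    then have "s \<in> a_prods ({i} \<times> UNIV \<union> F \<times> UNIV)" using insert.prems by simp
    then obtain t r where tr: "t \<in> a_prods ({i} \<times> UNIV)" "r \<in> a_prods (F \<times> UNIV)" "s = t \<otimes>\<^bsub>D\<^esub> r"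
      by (rule a_prods_split) (use i F in auto)
    have r: "r \<in> carrier D" using a_prods_closed[OF tr(2)] F by auto
    have fix_r: "\<sigma>_pow i m r = r" for m
      using \<sigma>_pow_fixes_a_prods[OF i _ tr(2)] F insert.hyps(2) by auto
    have "r \<in> C" using X_stable_cancel[OF i r fix_r tr(1)] tr(3) insert.prems by simp
    then show ?case using insert.IH[OF F tr(2)] by simp
  qed
  moreover obtain T where T: "finite T" "T \<subseteq> Field \<alpha> \<times> UNIV" "s \<in> a_prods T"
    using a_prods_finite[OF assms(1)] .
  moreover have "s \<in> a_prods (fst ` T \<times> UNIV)" by (rule a_prods_mono[OF T(3)]) force
  moreover have "finite (fst ` T)" "fst ` T \<subseteq> Field \<alpha>" using T(1,2) by auto
  ultimately show ?thesis using assms(2) by blast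
qed

text \<open>The preimage of \<open>C\<close> under localization at the products of the translates of the \<open>a\<^sub>i\<close>.\<close>

lemma X_stable_saturation:
  defines "C' \<equiv> {d \<in> carrier D. \<exists>s\<in>a_prods (Field \<alpha> \<times> UNIV). s \<otimes>\<^bsub>D\<^esub> d \<in> C}"
  shows "C' = {\<zero>\<^bsub>D\<^esub>} \<or> \<one>\<^bsub>D\<^esub> \<in> C"
proof -
  let ?P = "a_prods (Field \<alpha> \<times> UNIV)"
  have P: "s \<in> carrier D" "\<And>d. d \<in> carrier D \<Longrightarrow> s \<otimes>\<^bsub>D\<^esub> d = d \<otimes>\<^bsub>D\<^esub> s" if "s \<in> ?P" for s
    using a_prods_closed[OF that] a_prods_central[OF that] by auto
  have C'I: "d \<in> C'" if "d \<in> carrier D" "s \<in> ?P" "s \<otimes>\<^bsub>D\<^esub> d \<in> C" for d s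
    using that unfolding C'_def by blast
  have l: "x \<otimes>\<^bsub>D\<^esub> d \<in> C'" and r: "d \<otimes>\<^bsub>D\<^esub> x \<in> C'" if "d \<in> C'" "x \<in> carrier D" for d x
  proof -
    obtain s where s: "d \<in> carrier D" "s \<in> ?P" "s \<otimes>\<^bsub>D\<^esub> d \<in> C" using \<open>d \<in> C'\<close> unfolding C'_def by blast
    have "s \<otimes>\<^bsub>D\<^esub> (x \<otimes>\<^bsub>D\<^esub> d) = x \<otimes>\<^bsub>D\<^esub> s \<otimes>\<^bsub>D\<^esub> d"
      using P(2)[OF s(2) that(2)] s(1) P(1)[OF s(2)] that(2) by (simp flip: D.m_assoc)
    also have "\<dots> = x \<otimes>\<^bsub>D\<^esub> (s \<otimes>\<^bsub>D\<^esub> d)" using s P(1)[OF s(2)] that by (simp add: D.m_assoc)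
    also have "\<dots> \<in> C" by (rule C.I_l_closed[OF s(3) that(2)])
    finally show "x \<otimes>\<^bsub>D\<^esub> d \<in> C'" using s that by (intro C'I) auto
    have "s \<otimes>\<^bsub>D\<^esub> (d \<otimes>\<^bsub>D\<^esub> x) = s \<otimes>\<^bsub>D\<^esub> d \<otimes>\<^bsub>D\<^esub> x" using s P(1)[OF s(2)] that by (simp add: D.m_assoc)
    also have "\<dots> \<in> C" by (rule C.I_r_closed[OF s(3) that(2)])
    finally show "d \<otimes>\<^bsub>D\<^esub> x \<in> C'" using s that by (intro C'I) auto
  qed
  have "ideal C' D"
  proof (rule idealI[OF D.ring_axioms _ l r])
    show "subgroup C' (add_monoid D)"
    proof (rule D.add.subgroupI)
      show "C' \<subseteq> carrier D" unfolding C'_def by blast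
      have "\<zero>\<^bsub>D\<^esub> \<in> C'" by (rule C'I[OF _ a_prods.one]) auto
      then show "C' \<noteq> {}" by blast
      fix d assume d: "d \<in> C'"
      then have "(\<ominus>\<^bsub>D\<^esub> \<one>\<^bsub>D\<^esub>) \<otimes>\<^bsub>D\<^esub> d \<in> C'" using l by simp
      moreover have "(\<ominus>\<^bsub>D\<^esub> \<one>\<^bsub>D\<^esub>) \<otimes>\<^bsub>D\<^esub> d = \<ominus>\<^bsub>D\<^esub> d" using d unfolding C'_def by (simp add: D.l_minus)
      ultimately show "\<ominus>\<^bsub>D\<^esub> d \<in> C'" by simp
      fix e assume e: "e \<in> C'"
      obtain s where s: "d \<in> carrier D" "s \<in> ?P" "s \<otimes>\<^bsub>D\<^esub> d \<in> C" using d unfolding C'_def by blast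
      obtain t where t: "e \<in> carrier D" "t \<in> ?P" "t \<otimes>\<^bsub>D\<^esub> e \<in> C" using e unfolding C'_def by blast
      have st: "s \<in> carrier D" "t \<in> carrier D" using P s t by auto
      \<comment> \<open>The product of the two multipliers serves for the sum.\<close>
      have "s \<otimes>\<^bsub>D\<^esub> t \<otimes>\<^bsub>D\<^esub> (d \<oplus>\<^bsub>D\<^esub> e) = s \<otimes>\<^bsub>D\<^esub> t \<otimes>\<^bsub>D\<^esub> d \<oplus>\<^bsub>D\<^esub> s \<otimes>\<^bsub>D\<^esub> t \<otimes>\<^bsub>D\<^esub> e"
        using s t st by (simp add: D.r_distr)
      also have "s \<otimes>\<^bsub>D\<^esub> t \<otimes>\<^bsub>D\<^esub> d = t \<otimes>\<^bsub>D\<^esub> (s \<otimes>\<^bsub>D\<^esub> d)"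
        using P(2)[OF s(2) st(2)] s t st by (simp add: D.m_assoc)
      also have "s \<otimes>\<^bsub>D\<^esub> t \<otimes>\<^bsub>D\<^esub> e = s \<otimes>\<^bsub>D\<^esub> (t \<otimes>\<^bsub>D\<^esub> e)" using t st by (simp add: D.m_assoc)
      finally have "s \<otimes>\<^bsub>D\<^esub> t \<otimes>\<^bsub>D\<^esub> (d \<oplus>\<^bsub>D\<^esub> e) \<in> C"
        by (simp only: C.a_closed[OF C.I_l_closed[OF s(3) st(2)] C.I_l_closed[OF t(3) st(1)]])
      then show "d \<oplus>\<^bsub>D\<^esub> e \<in> C'" using s t by (intro C'I[OF _ a_prods_mult]) auto
    qed
  qed
  moreover have "sigma_stable K D \<alpha> \<sigma> C'"
  proof -
    have step: "\<sigma>_pow i \<epsilon> d \<in> C'" if i: "i \<in> Field \<alpha>" and \<epsilon>: "\<epsilon> \<in> {1, -1}" and "d \<in> C'" for i \<epsilon> d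
    proof -
      obtain s where s: "d \<in> carrier D" "s \<in> ?P" "s \<otimes>\<^bsub>D\<^esub> d \<in> C" using \<open>d \<in> C'\<close> unfolding C'_def by blast
      let ?c = "\<sigma>_pow i (max \<epsilon> 0) (a i)"
      have c: "?c \<in> carrier D" "s \<in> carrier D" using i a_carrier P s by auto
      \<comment> \<open>Stability puts a multiple of \<open>\<sigma>_pow i \<epsilon> d\<close> into
        \<open>C\<close>, and its multiplier, \<open>\<sigma>_pow i \<epsilon> s\<close> times
        \<open>?c\<close>, is again an allowed product.\<close>
      have "\<sigma>_pow i \<epsilon> (s \<otimes>\<^bsub>D\<^esub> d) \<otimes>\<^bsub>D\<^esub> ?c \<in> C" using stable i \<epsilon> s unfolding X_stable_def by blast
      also have "\<sigma>_pow i \<epsilon> (s \<otimes>\<^bsub>D\<^esub> d) \<otimes>\<^bsub>D\<^esub> ?c = \<sigma>_pow i \<epsilon> s \<otimes>\<^bsub>D\<^esub> (\<sigma>_pow i \<epsilon> d \<otimes>\<^bsub>D\<^esub> ?c)"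
        using i c s by (simp add: \<sigma>_pow_mult D.m_assoc)
      also have "\<sigma>_pow i \<epsilon> d \<otimes>\<^bsub>D\<^esub> ?c = ?c \<otimes>\<^bsub>D\<^esub> \<sigma>_pow i \<epsilon> d"
        using \<sigma>_pow_a_central[OF i \<sigma>_pow_closed[OF i s(1)]] by (rule HOL.sym)
      also have "\<sigma>_pow i \<epsilon> s \<otimes>\<^bsub>D\<^esub> (?c \<otimes>\<^bsub>D\<^esub> \<sigma>_pow i \<epsilon> d) = \<sigma>_pow i \<epsilon> s \<otimes>\<^bsub>D\<^esub> ?c \<otimes>\<^bsub>D\<^esub> \<sigma>_pow i \<epsilon> d"
        using i c s by (simp add: D.m_assoc)
      finally have "\<sigma>_pow i \<epsilon> s \<otimes>\<^bsub>D\<^esub> ?c \<otimes>\<^bsub>D\<^esub> \<sigma>_pow i \<epsilon> d \<in> C" .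
      moreover have "\<sigma>_pow i \<epsilon> s \<in> ?P"
        using \<sigma>_pow_a_prods[OF i subset_refl s(2), of \<epsilon>] by (rule a_prods_mono) auto
      then have "\<sigma>_pow i \<epsilon> s \<otimes>\<^bsub>D\<^esub> ?c \<in> ?P" using i by (intro a_prods.mult) auto
      ultimately show ?thesis using i s by (intro C'I) auto
    qed
    have "\<sigma>_pow i j d \<in> C'" if i: "i \<in> Field \<alpha>" and d: "d \<in> C'" for i j d
    proof (induction j rule: int_induct[where k = 0])
      case base
      then show ?case using d unfolding C'_def by simp
    next
      case (step1 j)
      then show ?case
        using step[OF i _ step1(2), of 1] d \<sigma>_pow_\<sigma>_pow[OF i, of d 1 j] unfolding C'_def
        by (simp add: add.commute)
    next
      case (step2 j)
      then show ?case
        using step[OF i _ step2(2), of "-1"] d \<sigma>_pow_\<sigma>_pow[OF i, of d "-1" j] unfolding C'_def by simp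
    qed
    moreover have "C' \<subseteq> carrier D" unfolding C'_def by blast
    ultimately show ?thesis unfolding sigma_stable_def \<sigma>_pow_def by blast
  qed
  ultimately have "C' = {\<zero>\<^bsub>D\<^esub>} \<or> C' = carrier D" by (rule \<sigma>_simple)
  moreover have "\<one>\<^bsub>D\<^esub> \<in> C" if "C' = carrier D"
  proof -
    have "\<one>\<^bsub>D\<^esub> \<in> C'" using that by simp
    then obtain s where "s \<in> ?P" "s \<otimes>\<^bsub>D\<^esub> \<one>\<^bsub>D\<^esub> \<in> C" unfolding C'_def by blast
    then show ?thesis using X_stable_one P by simp
  qed
  ultimately show ?thesis by blast
qed

text \<open>With the empty product as multiplier, \<open>c\<close> lies in the saturation of
  \<open>C\<close>, which is therefore not zero.\<close>

lemma X_stable_nonzero: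
  assumes "c \<in> C" "c \<noteq> \<zero>\<^bsub>D\<^esub>"
  shows "\<one>\<^bsub>D\<^esub> \<in> C"
proof -
  have "c \<in> carrier D" "\<one>\<^bsub>D\<^esub> \<otimes>\<^bsub>D\<^esub> c \<in> C" using assms C.Icarr by auto
  then show ?thesis using X_stable_saturation assms(2) a_prods.one by blast
qed

end

text \<open>The saturation of the zero ideal consists of the elements killed by some product. As 1
  is not in the zero ideal, this saturation is zero.\<close>

lemma a_prods_regular:
  assumes s: "s \<in> a_prods (Field \<alpha> \<times> UNIV)" and d: "d \<in> carrier D" and "s \<otimes>\<^bsub>D\<^esub> d = \<zero>\<^bsub>D\<^esub>"
  shows "d = \<zero>\<^bsub>D\<^esub>"
proof -
  have "X_stable {\<zero>\<^bsub>D\<^esub>}" unfolding X_stable_def using a_carrier by auto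
  from X_stable_saturation[OF D.zeroideal this] show ?thesis using assms one_not_zero by auto
qed

section \<open>Simplicity\<close>

lemma right_coeff_regular:
  assumes i: "i \<in> Field \<alpha>" and d: "d \<in> carrier D" "d \<otimes>\<^bsub>D\<^esub> right_coeff i \<epsilon> n = \<zero>\<^bsub>D\<^esub>"
  shows "d = \<zero>\<^bsub>D\<^esub>"
proof -
  have "\<one>\<^bsub>D\<^esub> \<otimes>\<^bsub>D\<^esub> \<sigma>_pow i m (a i) \<in> a_prods (Field \<alpha> \<times> UNIV)" for m
    using i by (intro a_prods.intros) auto
  then have "right_coeff i \<epsilon> n \<in> a_prods (Field \<alpha> \<times> UNIV)"
    using i a_carrier by (simp add: right_coeff_def a_prods.one)
  moreover have "right_coeff i \<epsilon> n \<otimes>\<^bsub>D\<^esub> d = \<zero>\<^bsub>D\<^esub>" using right_coeff_central[OF i d(1)] d(2) by simp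
  ultimately show ?thesis using a_prods_regular d(1) by blast
qed

text \<open>A coefficient that commutes with all generators is zero or a unit, by \<open>\<sigma>\<close>-simplicity; if it
  also twists \<open>D\<close> like \<open>X\<^sup>z\<close>, then \<open>\<sigma>\<^sup>z\<close> is inner.\<close>

lemma twisting_coeff_trivial:
  assumes z: "z \<in> exponents (Field \<alpha>)" and u: "u \<in> carrier D" "u \<noteq> \<zero>\<^bsub>D\<^esub>"
    and comm: "\<And>d. d \<in> carrier D \<Longrightarrow> d \<otimes>\<^bsub>D\<^esub> u = u \<otimes>\<^bsub>D\<^esub> twist z d"
    and fixed: "\<And>i. i \<in> Field \<alpha> \<Longrightarrow> \<sigma> i u = u"
  shows "z = (\<lambda>_. 0)"
proof -
  define U where "U = (\<lambda>d. d \<otimes>\<^bsub>D\<^esub> u) ` carrier D"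
  \<comment> \<open>This is for closure of \<open>D u\<close> under right multiplication: every
    \<open>d\<close> is some \<open>twist z d'\<close>, and \<open>u\<close> times
    \<open>twist z d'\<close> is \<open>d'\<close> times \<open>u\<close>.\<close>
  have surj: "\<exists>e\<in>carrier D. twist z e = d" if "d \<in> carrier D" for d
  proof
    let ?g = "inv\<^bsub>Aut K D\<^esub> (twist z)"
    have g: "?g \<in> carrier (Aut K D)" using twist_Aut[OF z] by simp
    show "?g d \<in> carrier D" using ring_hom_closed[OF Aut_ring_hom[OF g] that] .
    show "twist z (?g d) = d"
      using mult_Aut_apply[OF twist_Aut[OF z] g that] that twist_Aut[OF z] by (simp add: one_Aut)
  qed
  have "ideal U D"
  proof (rule idealI[OF D.ring_axioms])
    show "subgroup U (add_monoid D)"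
    proof (rule D.add.subgroupI)
      show "U \<subseteq> carrier D" "U \<noteq> {}" using u by (auto simp: U_def)
      fix x y assume x: "x \<in> U" and y: "y \<in> U"
      then obtain d e where de: "d \<in> carrier D" "x = d \<otimes>\<^bsub>D\<^esub> u" "e \<in> carrier D" "y = e \<otimes>\<^bsub>D\<^esub> u"
        unfolding U_def by blast
      have "\<ominus>\<^bsub>D\<^esub> x = (\<ominus>\<^bsub>D\<^esub> d) \<otimes>\<^bsub>D\<^esub> u" "x \<oplus>\<^bsub>D\<^esub> y = (d \<oplus>\<^bsub>D\<^esub> e) \<otimes>\<^bsub>D\<^esub> u"
        using de u by (simp_all add: D.l_minus D.l_distr)
      then show "\<ominus>\<^bsub>D\<^esub> x \<in> U" "x \<oplus>\<^bsub>D\<^esub> y \<in> U" unfolding U_def using de by auto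
    qed
    fix x d assume "x \<in> U" and d: "d \<in> carrier D"
    then obtain e where e: "e \<in> carrier D" "x = e \<otimes>\<^bsub>D\<^esub> u" unfolding U_def by blast
    obtain d' where d': "d' \<in> carrier D" "twist z d' = d" using surj[OF d] by blast
    have "d \<otimes>\<^bsub>D\<^esub> x = (d \<otimes>\<^bsub>D\<^esub> e) \<otimes>\<^bsub>D\<^esub> u" using d e u by (simp add: D.m_assoc)
    then show "d \<otimes>\<^bsub>D\<^esub> x \<in> U" unfolding U_def using d e by blast
    have "x \<otimes>\<^bsub>D\<^esub> d = e \<otimes>\<^bsub>D\<^esub> (u \<otimes>\<^bsub>D\<^esub> twist z d')" using d e u d' by (simp add: D.m_assoc)
    also have "\<dots> = (e \<otimes>\<^bsub>D\<^esub> d') \<otimes>\<^bsub>D\<^esub> u"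
      unfolding comm[OF d'(1), symmetric] using e u d' by (simp add: D.m_assoc)
    finally show "x \<otimes>\<^bsub>D\<^esub> d \<in> U" unfolding U_def using d' e by blast
  qed
  moreover have "sigma_stable K D \<alpha> \<sigma> U"
  proof -
    have "\<sigma>_pow i j (d \<otimes>\<^bsub>D\<^esub> u) = \<sigma>_pow i j d \<otimes>\<^bsub>D\<^esub> u" if "i \<in> Field \<alpha>" "d \<in> carrier D" for i j d
      using that u \<sigma>_pow_fixes[OF that(1) u(1) fixed[OF that(1)]] by (simp add: \<sigma>_pow_mult)
    then have "\<sigma>_pow i j ` U \<subseteq> U" if "i \<in> Field \<alpha>" for i j
      using that unfolding U_def by auto
    moreover have "U \<subseteq> carrier D" using u by (auto simp: U_def)
    ultimately show ?thesis unfolding sigma_stable_def \<sigma>_pow_def by blast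
  qed
  ultimately have "U = {\<zero>\<^bsub>D\<^esub>} \<or> U = carrier D" by (rule \<sigma>_simple)
  moreover have "\<one>\<^bsub>D\<^esub> \<otimes>\<^bsub>D\<^esub> u \<in> U" unfolding U_def by (rule imageI) simp
  then have "u \<in> U" using u by simp
  ultimately have "\<one>\<^bsub>D\<^esub> \<in> U" using u by auto
  then obtain v where v: "v \<in> carrier D" "v \<otimes>\<^bsub>D\<^esub> u = \<one>\<^bsub>D\<^esub>" unfolding U_def by force
  have tv: "twist z v \<in> carrier D" using z v by simp
  have uv': "u \<otimes>\<^bsub>D\<^esub> twist z v = \<one>\<^bsub>D\<^esub>" using comm[OF v(1)] v by simp
  \<comment> \<open>\<open>v\<close> is a left inverse of \<open>u\<close> and
    \<open>twist z v\<close> a right inverse, so they coincide.\<close>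
  have "v = v \<otimes>\<^bsub>D\<^esub> (u \<otimes>\<^bsub>D\<^esub> twist z v)" using uv' v by simp
  also have "\<dots> = twist z v" using v u tv by (simp flip: D.m_assoc)
  finally have uv: "u \<otimes>\<^bsub>D\<^esub> v = \<one>\<^bsub>D\<^esub>" using uv' by simp
  have vU: "v \<in> Units D" unfolding Units_def using u v uv by blast
  have inv: "inv\<^bsub>D\<^esub> v = u" using D.inv_unique'[OF v(1) u(1) v(2) uv] by (rule HOL.sym)
  have "twist z d = v \<otimes>\<^bsub>D\<^esub> d \<otimes>\<^bsub>D\<^esub> inv\<^bsub>D\<^esub> v" if "d \<in> carrier D" for d
  proof -
    have "v \<otimes>\<^bsub>D\<^esub> d \<otimes>\<^bsub>D\<^esub> u = (v \<otimes>\<^bsub>D\<^esub> u) \<otimes>\<^bsub>D\<^esub> twist z d"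
      using v(1) u that z comm[OF that] by (simp add: D.m_assoc)
    then show ?thesis using that z by (simp add: inv v(2))
  qed
  then have "twist z = (\<lambda>d\<in>carrier D. v \<otimes>\<^bsub>D\<^esub> d \<otimes>\<^bsub>D\<^esub> inv\<^bsub>D\<^esub> v)"
    using Aut_extensional[OF twist_Aut[OF z]] by (auto simp: extensional_def)
  then have "twist z \<in> Inn D" unfolding Inn_def using vU by blast
  then show ?thesis using twist_not_inner[OF outer z] by blast
qed

section \<open>Two-sided ideals as sets of coefficient functions\<close>

context
  fixes J :: "(('i \<Rightarrow> int) \<Rightarrow> 'd) set"
  assumes J_fin: "J \<subseteq> fin_coeffs"
    and J_add: "\<And>f g. \<lbrakk>f \<in> J; g \<in> J\<rbrakk> \<Longrightarrow> (\<lambda>z. f z \<oplus>\<^bsub>D\<^esub> g z) \<in> J"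
    and J_left_D: "\<And>d f. \<lbrakk>d \<in> carrier D; f \<in> J\<rbrakk> \<Longrightarrow> left_D d f \<in> J"
    and J_right_D: "\<And>d f. \<lbrakk>d \<in> carrier D; f \<in> J\<rbrakk> \<Longrightarrow> right_D d f \<in> J"
    and J_left_X: "\<And>i \<epsilon> f. \<lbrakk>i \<in> Field \<alpha>; \<epsilon> \<in> {1, -1}; f \<in> J\<rbrakk> \<Longrightarrow> left_X i \<epsilon> f \<in> J"
    and J_right_X: "\<And>i \<epsilon> f. \<lbrakk>i \<in> Field \<alpha>; \<epsilon> \<in> {1, -1}; f \<in> J\<rbrakk> \<Longrightarrow> right_X i \<epsilon> f \<in> J"
begin

lemma J_neg: "f \<in> J \<Longrightarrow> (\<lambda>z. \<ominus>\<^bsub>D\<^esub> f z) \<in> J"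
  using J_left_D[of "\<ominus>\<^bsub>D\<^esub> \<one>\<^bsub>D\<^esub>" f] J_fin fin_coeffs_closed[of f]
  by (auto simp: left_D_def D.l_minus)

lemma J_diff: "\<lbrakk>f \<in> J; g \<in> J\<rbrakk> \<Longrightarrow> (\<lambda>z. f z \<ominus>\<^bsub>D\<^esub> g z) \<in> J"
  unfolding a_minus_def by (rule J_add[OF _ J_neg])

text \<open>Right multiplication by the generator pointing towards 0 moves the tracked exponent,
  whose coefficient survives because the contraction factors are regular. Shifting never enlarges
  the number of exponents in the support.\<close>

lemma move_to_zero:
  assumes "z \<in> exponents (Field \<alpha>)"
  shows "\<lbrakk>f \<in> J; z \<in> supp f\<rbrakk> \<Longrightarrow> \<exists>g\<in>J. (\<lambda>_. 0) \<in> supp g \<and> card (supp g) \<le> card (supp f)"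
  using assms
proof (induction arbitrary: f rule: exponents_induct)
  case zero
  then show ?case by blast
next
  case (Suc z i)
  let ?g = "right_X i (-1) f"
  have f: "f \<in> fin_coeffs" using J_fin Suc.prems by blast
  have g: "?g \<in> J" using J_right_X Suc by simp
  have "?g z \<noteq> \<zero>\<^bsub>D\<^esub>"
    using right_coeff_regular[OF \<open>i \<in> Field \<alpha>\<close> fin_coeffs_closed[OF f], of "z(i := z i + 1)" "-1" "z i + 1"]
      Suc.prems(2) by (auto simp: right_X_def supp_def simp del: fun_upd_apply)
  then obtain h where h: "h \<in> J" "(\<lambda>_. 0) \<in> supp h" "card (supp h) \<le> card (supp ?g)"
    using Suc.IH[OF g] by (auto simp: supp_def)
  have "card (supp ?g) \<le> card ((\<lambda>z. z(i := z i + -1)) ` supp f)"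
    using f by (intro card_mono supp_right_X \<open>i \<in> Field \<alpha>\<close>) simp
  also have "\<dots> \<le> card (supp f)" using f by (intro card_image_le) simp
  finally show ?case using h by (meson order_trans)
next
  case (pred z i)
  let ?g = "right_X i 1 f"
  have f: "f \<in> fin_coeffs" using J_fin pred.prems by blast
  have g: "?g \<in> J" using J_right_X pred by simp
  have "?g z \<noteq> \<zero>\<^bsub>D\<^esub>"
    using right_coeff_regular[OF \<open>i \<in> Field \<alpha>\<close> fin_coeffs_closed[OF f], of "z(i := z i - 1)" 1 "z i - 1"]
      pred.prems(2) by (auto simp: right_X_def supp_def simp del: fun_upd_apply)
  then obtain h where h: "h \<in> J" "(\<lambda>_. 0) \<in> supp h" "card (supp h) \<le> card (supp ?g)"
    using pred.IH[OF g] by (auto simp: supp_def)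
  have "card (supp ?g) \<le> card ((\<lambda>z. z(i := z i + 1)) ` supp f)"
    using f by (intro card_mono supp_right_X \<open>i \<in> Field \<alpha>\<close>) simp
  also have "\<dots> \<le> card (supp f)" using f by (intro card_image_le) simp
  finally show ?case using h by (meson order_trans)
qed

text \<open>In \<open>X_i^\<epsilon> g X_i^(-\<epsilon>)\<close> the two shifts cancel, so the
  support stays within that of \<open>g\<close>. The constant term becomes the expression in
  \<open>X_stable\<close>.\<close>

lemma constant_terms_X_stable:
  defines "C \<equiv> \<lambda>T. {f (\<lambda>_. 0) | f. f \<in> J \<and> supp f \<subseteq> T}"
  assumes "f \<in> J"
  shows "ideal (C (supp f)) D" "X_stable (C (supp f))"
proof -
  let ?T = "supp f" and ?o = "\<lambda>_. 0 :: int"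
  have fin: "g \<in> fin_coeffs" if "g \<in> J" for g using that J_fin by blast
  have CI: "g ?o \<in> C ?T" if "g \<in> J" "supp g \<subseteq> ?T" for g using that unfolding C_def by blast
  show "ideal (C ?T) D"
  proof (rule idealI[OF D.ring_axioms])
    show "subgroup (C ?T) (add_monoid D)"
    proof (rule D.add.subgroupI)
      show "C ?T \<subseteq> carrier D" unfolding C_def using fin by auto
      show "C ?T \<noteq> {}" using CI[OF assms(2)] by blast
      fix x y assume "x \<in> C ?T" "y \<in> C ?T"
      then obtain g h where gh: "g \<in> J" "supp g \<subseteq> ?T" "x = g ?o" "h \<in> J" "supp h \<subseteq> ?T" "y = h ?o"
        unfolding C_def by blast
      have "supp (\<lambda>z. \<ominus>\<^bsub>D\<^esub> g z) \<subseteq> supp g" by (auto simp: supp_def)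
      then have "supp (\<lambda>z. \<ominus>\<^bsub>D\<^esub> g z) \<subseteq> ?T" using gh(2) by blast
      then show "\<ominus>\<^bsub>D\<^esub> x \<in> C ?T" using CI[OF J_neg[OF gh(1)]] gh by simp
      have "supp (\<lambda>z. g z \<oplus>\<^bsub>D\<^esub> h z) \<subseteq> supp g \<union> supp h" by (auto simp: supp_def)
      then have "supp (\<lambda>z. g z \<oplus>\<^bsub>D\<^esub> h z) \<subseteq> ?T" using gh(2,5) by blast
      then show "x \<oplus>\<^bsub>D\<^esub> y \<in> C ?T" using CI[OF J_add[OF gh(1,4)]] gh by simp
    qed
    fix x d assume "x \<in> C ?T" and d: "d \<in> carrier D"
    then obtain g where g: "g \<in> J" "supp g \<subseteq> ?T" "x = g ?o" unfolding C_def by blast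
    have "left_D d g ?o \<in> C ?T" "right_D d g ?o \<in> C ?T"
      using CI[OF J_left_D[OF d g(1)]] CI[OF J_right_D[OF d g(1)]]
        supp_left_D[OF d fin[OF g(1)]] supp_right_D[OF d fin[OF g(1)]] g(2) by auto
    then show "d \<otimes>\<^bsub>D\<^esub> x \<in> C ?T" "x \<otimes>\<^bsub>D\<^esub> d \<in> C ?T"
      using d by (simp_all add: g(3) left_D_def right_D_def zero_exponents twist_0)
  qed
  show "X_stable (C ?T)"
    unfolding X_stable_def
  proof (intro ballI)
    fix i \<epsilon> c assume i: "i \<in> Field \<alpha>" and \<epsilon>: "\<epsilon> \<in> {1, -1::int}" and "c \<in> C ?T"
    then obtain g where g: "g \<in> J" "supp g \<subseteq> ?T" "c = g ?o" unfolding C_def by blast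
    have \<epsilon>': "-\<epsilon> \<in> {1, -1}" using \<epsilon> by auto
    let ?h = "left_X i \<epsilon> (right_X i (-\<epsilon>) g)"
    have h: "?h \<in> J" using J_left_X[OF i \<epsilon> J_right_X[OF i \<epsilon>' g(1)]] .
    have "supp ?h \<subseteq> (\<lambda>z. z(i := z i + \<epsilon>)) ` (\<lambda>z. z(i := z i + -\<epsilon>)) ` supp g"
      using supp_left_X[OF i] supp_right_X[OF i] by (meson image_mono order_trans)
    also have "\<dots> = supp g" by (simp add: image_image)
    finally have "?h ?o \<in> C ?T" using CI[OF h] g(2) by blast
    \<comment> \<open>The right factor takes the constant term to exponent
      \<open>-\<epsilon>\<close> without contraction; the left factor brings it back and contributes
      the translate of \<open>a i\<close>.\<close>
    moreover have "?h ?o = \<sigma>_pow i \<epsilon> c \<otimes>\<^bsub>D\<^esub> \<sigma>_pow i (max \<epsilon> 0) (a i)"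
    proof -
      have 0: "(\<lambda>_. 0)(i := (0::int)) = (\<lambda>_. 0)" by auto
      show ?thesis
        using i \<epsilon> fin[OF g(1)] by (auto simp: left_X_def right_X_def left_coeff_def right_coeff_def g(3) 0)
    qed
    ultimately show "\<sigma>_pow i \<epsilon> c \<otimes>\<^bsub>D\<^esub> \<sigma>_pow i (max \<epsilon> 0) (a i) \<in> C ?T" by simp
  qed
qed

lemma unit_coeff_mem:
  assumes "f \<in> J" "supp f \<noteq> {}"
  shows "unit_coeff \<in> J"
proof -
  let ?o = "\<lambda>_. 0 :: int"
  have fin: "g \<in> fin_coeffs" if "g \<in> J" for g using that J_fin by blast
  obtain f0 where f0: "f0 \<in> J" "supp f0 \<noteq> {}"
    and min: "\<And>g. \<lbrakk>g \<in> J; supp g \<noteq> {}\<rbrakk> \<Longrightarrow> card (supp f0) \<le> card (supp g)"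
    using ex_has_least_nat[of "\<lambda>f. f \<in> J \<and> supp f \<noteq> {}" f "\<lambda>f. card (supp f)"] assms by blast
  then obtain z0 where z0: "z0 \<in> supp f0" by blast
  then have "z0 \<in> exponents (Field \<alpha>)" using fin_coeffs_exponents[OF fin[OF f0(1)]] by blast
  \<comment> \<open>Moving to 0 does not enlarge the support, so \<open>f1\<close> has minimal
    support as well.\<close>
  then obtain f1 where f1: "f1 \<in> J" "?o \<in> supp f1" "card (supp f1) \<le> card (supp f0)"
    using move_to_zero f0(1) z0 by blast
  let ?T = "supp f1"
  have T: "finite ?T" using fin[OF f1(1)] by simp
  have small: "supp g = {}" if "g \<in> J" "supp g \<subseteq> S" "card S < card ?T" "finite S" for g S
    using min[OF that(1)] card_mono[OF that(4,2)] that(3) f1(3) by fastforce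
  have "f1 ?o \<noteq> \<zero>\<^bsub>D\<^esub>" using f1(2) by (simp add: supp_def)
  then have "\<one>\<^bsub>D\<^esub> \<in> {f ?o | f. f \<in> J \<and> supp f \<subseteq> ?T}"
    using X_stable_nonzero[OF constant_terms_X_stable[OF f1(1)], of "f1 ?o"] f1(1) by blast
  then obtain y where y: "y \<in> J" "supp y \<subseteq> ?T" "y ?o = \<one>\<^bsub>D\<^esub>" by force
  have yc: "y z \<in> carrier D" for z using fin[OF y(1)] by simp
  have D_comm: "d \<otimes>\<^bsub>D\<^esub> y z = y z \<otimes>\<^bsub>D\<^esub> twist z d"
    if d: "d \<in> carrier D" and z: "z \<in> exponents (Field \<alpha>)" for d z
  proof -
    \<comment> \<open>The commutator of \<open>d\<close> and \<open>y\<close>. Since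
      \<open>y\<close> has constant term 1 and the twist at 0 is the identity, its constant term
      vanishes and minimality makes it zero.\<close>
    let ?g = "\<lambda>z. left_D d y z \<ominus>\<^bsub>D\<^esub> right_D d y z"
    have "supp ?g \<subseteq> ?T - {?o}"
    proof
      fix w assume w: "w \<in> supp ?g"
      have "w \<noteq> ?o"
        using w d y(3) by (auto simp: supp_def left_D_def right_D_def twist_0 zero_exponents D.minus_eq D.r_neg)
      moreover have "w \<in> supp y"
        using w d by (auto simp: supp_def left_D_def right_D_def D.minus_eq split: if_splits)
      ultimately show "w \<in> ?T - {?o}" using y(2) by blast
    qed
    moreover have "card (?T - {?o}) < card ?T" using T f1(2) by (rule card_Diff1_less)
    ultimately have "supp ?g = {}" using T d y(1) J_diff J_left_D J_right_D by (intro small[of ?g "?T - {?o}"]) auto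
    then have "?g z = \<zero>\<^bsub>D\<^esub>" by (auto simp: supp_def)
    then show ?thesis using z d yc by (simp add: left_D_def right_D_def)
  qed
  have X_comm: "\<sigma>_pow i \<epsilon> (y z) \<otimes>\<^bsub>D\<^esub> left_coeff i \<epsilon> (z i) = y z \<otimes>\<^bsub>D\<^esub> right_coeff i \<epsilon> (z i)"
    if i: "i \<in> Field \<alpha>" and \<epsilon>: "\<epsilon> \<in> {1, -1}" for i \<epsilon> z
  proof -
    \<comment> \<open>The commutator of a generator and \<open>y\<close> is supported in the shift
      of \<open>?T\<close>. At the shift of 0 neither product contracts and both coefficients are 1,
      so that exponent drops out.\<close>
    let ?g = "\<lambda>z. left_X i \<epsilon> y z \<ominus>\<^bsub>D\<^esub> right_X i \<epsilon> y z" and ?s = "\<lambda>z. z(i := z i + \<epsilon>)"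
    have "supp ?g \<subseteq> ?s ` ?T - {?s ?o}"
    proof
      fix w assume w: "w \<in> supp ?g"
      have 0: "(\<lambda>_. 0)(i := (0::int)) = ?o" by auto
      have "w \<noteq> ?s ?o"
        using w i y(3)
        by (auto simp: supp_def left_X_def right_X_def left_coeff_def right_coeff_def 0 D.minus_eq D.r_neg)
      moreover have "w \<in> supp (left_X i \<epsilon> y) \<union> supp (right_X i \<epsilon> y)"
        using w by (auto simp: supp_def D.minus_eq)
      then have "w \<in> ?s ` supp y" using supp_left_X[OF i] supp_right_X[OF i] by blast
      ultimately show "w \<in> ?s ` ?T - {?s ?o}" using y(2) by blast
    qed
    moreover have "card (?s ` ?T - {?s ?o}) < card (?s ` ?T)"
      by (rule card_Diff1_less[OF finite_imageI[OF T] imageI[OF f1(2)]])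
    then have "card (?s ` ?T - {?s ?o}) < card ?T" using card_image_le[OF T, of ?s] by linarith
    ultimately have "supp ?g = {}"
      using T y(1) i \<epsilon> J_diff J_left_X J_right_X by (intro small[of ?g "?s ` ?T - {?s ?o}"]) auto
    then have "?g (?s z) = \<zero>\<^bsub>D\<^esub>" by (auto simp: supp_def)
    then show ?thesis using i yc by (simp add: left_X_def right_X_def)
  qed
  have only: "z = ?o" if z: "z \<in> supp y" for z
  proof (rule twisting_coeff_trivial[of z "y z"])
    show ze: "z \<in> exponents (Field \<alpha>)" using z fin_coeffs_exponents[OF fin[OF y(1)]] by blast
    show "y z \<in> carrier D" "y z \<noteq> \<zero>\<^bsub>D\<^esub>" using yc z by (auto simp: supp_def)
    show "d \<otimes>\<^bsub>D\<^esub> y z = y z \<otimes>\<^bsub>D\<^esub> twist z d" if "d \<in> carrier D" for d using D_comm[OF that ze] .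
    fix i assume i: "i \<in> Field \<alpha>"
    show "\<sigma> i (y z) = y z"
    \<comment> \<open>The sign is chosen to point away from 0, so that both coefficients in
      \<open>X_comm\<close> are 1 and \<open>y z\<close> is fixed by
      \<open>\<sigma>_pow i \<epsilon>\<close>.\<close>
    proof (cases "z i \<ge> 0")
      case True
      then show ?thesis
        using X_comm[OF i, of 1 z] i yc \<sigma>_pow_closed[OF i yc, of 1 z] by (simp add: left_coeff_def right_coeff_def \<sigma>_pow_1)
    next
      case False
      then have "\<sigma>_pow i (-1) (y z) = y z"
        using X_comm[OF i, of "-1" z] i yc by (simp add: left_coeff_def right_coeff_def)
      then have "\<sigma>_pow i 1 (y z) = \<sigma>_pow i 1 (\<sigma>_pow i (-1) (y z))" by simp
      then show ?thesis using \<sigma>_pow_\<sigma>_pow[OF i yc, of 1 "-1" z] yc by (simp add: \<sigma>_pow_1[OF i])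
    qed
  qed
  have "y z = unit_coeff z" for z
    using only[of z] y(3) by (cases "z = ?o") (auto simp: unit_coeff_def supp_def)
  then have "y = unit_coeff" ..
  then show ?thesis using y(1) by simp
qed

end

text \<open>The ideal is carried to coefficient functions by
  \<open>s \<mapsto> rep s unit_coeff\<close>, where \<open>unit_coeff_mem\<close> applies;
  \<open>expand\<close> carries the result back.\<close>

lemma simple_ring_gwa: "simple_ring (gwa K D \<alpha> \<sigma> a)"
  unfolding simple_ring_def
proof (intro conjI allI impI)
  let ?E = "gwa_exprs K D \<alpha>" and ?u = "unit_coeff"
  show "ring A" by (rule ring_gwa)
  have "\<one>\<^bsub>A\<^esub> \<noteq> \<zero>\<^bsub>A\<^esub>"
  proof
    assume "\<one>\<^bsub>A\<^esub> = \<zero>\<^bsub>A\<^esub>"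
    then have "gwa_cong K D \<alpha> \<sigma> a (Base \<one>\<^bsub>D\<^esub>) (Base \<zero>\<^bsub>D\<^esub>)"
      by (intro cls_eqD) (simp_all add: one_gwa zero_gwa gwa_exprs.intros)
    then have "rep (Base \<one>\<^bsub>D\<^esub>) ?u = rep (Base \<zero>\<^bsub>D\<^esub>) ?u"
      by (rule rep_cong) (rule fin_coeffs_range[OF unit_coeff_fin])
    then have "left_D \<one>\<^bsub>D\<^esub> ?u (\<lambda>_. 0) = left_D \<zero>\<^bsub>D\<^esub> ?u (\<lambda>_. 0)" by simp
    then show False using one_not_zero by (simp add: left_D_def unit_coeff_def)
  qed
  then show "carrier A \<noteq> {\<zero>\<^bsub>A\<^esub>}" using A.one_closed by blast
  fix J assume J: "ideal J A"
  interpret J: ideal J A by (rule J)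
  let ?J = "{rep s ?u | s. s \<in> ?E \<and> cls s \<in> J}"
  have JI: "rep s ?u \<in> ?J" if "s \<in> ?E" "cls s \<in> J" for s using that by blast
  show "J = {\<zero>\<^bsub>A\<^esub>} \<or> J = carrier A"
  proof (cases "J = {\<zero>\<^bsub>A\<^esub>}")
    case False
    then obtain x where "x \<in> J" "x \<noteq> \<zero>\<^bsub>A\<^esub>" using J.zero_closed by blast
    moreover from J.Icarr[OF this(1)] obtain s where "s \<in> ?E" "x = cls s"
      unfolding carrier_gwa by blast
    ultimately have s: "s \<in> ?E" "cls s \<in> J" "cls s \<noteq> \<zero>\<^bsub>A\<^esub>" by simp_all
    have nz: "supp (rep s ?u) \<noteq> {}" using expand_zero expand_rep_unit_coeff s by force
    have "?u \<in> ?J"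
    proof (rule unit_coeff_mem[of ?J])
      show "?J \<subseteq> fin_coeffs" using rep_fin by auto
      show "rep s ?u \<in> ?J" using JI s by blast
      show "supp (rep s ?u) \<noteq> {}" by (rule nz)
    next
      fix f g assume "f \<in> ?J" "g \<in> ?J"
      then obtain s t where st: "s \<in> ?E" "cls s \<in> J" "f = rep s ?u" "t \<in> ?E" "cls t \<in> J" "g = rep t ?u"
        by blast
      then have "cls (Add s t) \<in> J" using J.a_closed by (simp flip: add_cls)
      then show "(\<lambda>z. f z \<oplus>\<^bsub>D\<^esub> g z) \<in> ?J" using JI[of "Add s t"] st by (simp add: gwa_exprs.intros)
    next
      \<comment> \<open>Right multiplication by \<open>t\<close> alters the function on which
        \<open>rep s\<close> acts; \<open>right_D_rep\<close> and \<open>right_X_rep\<close> rewrite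
        this as an operator applied to \<open>rep s ?u\<close>.\<close>
      have mult: "rep t (rep s ?u) \<in> ?J" "rep s (rep t ?u) \<in> ?J"
        if "s \<in> ?E" "cls s \<in> J" "t \<in> ?E" for s t
        using JI[of "Mul t s"] JI[of "Mul s t"] that J.I_l_closed[of "cls s" "cls t"]
          J.I_r_closed[of "cls s" "cls t"] by (simp_all add: gwa_exprs.intros flip: mult_cls)
      {
        fix d f assume d: "d \<in> carrier D" and "f \<in> ?J"
        then obtain s where s: "s \<in> ?E" "cls s \<in> J" "f = rep s ?u" by blast
        have d': "Base d \<in> ?E" using d by (rule gwa_exprs.intros)
        show "left_D d f \<in> ?J" using mult(1)[OF s(1,2) d'] s(3) by simp
        show "right_D d f \<in> ?J"
          using mult(2)[OF s(1,2) d'] s(3) right_D_rep[OF d s(1) unit_coeff_fin] d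
          by (simp add: left_D_unit_coeff)
      }
      fix i \<epsilon> f assume i: "i \<in> Field \<alpha>" and \<epsilon>: "\<epsilon> \<in> {1, -1::int}" and "f \<in> ?J"
      then obtain s where s: "s \<in> ?E" "cls s \<in> J" "f = rep s ?u" by blast
      obtain t where t: "t \<in> ?E" "rep t = left_X i \<epsilon>"
      proof (cases "\<epsilon> = 1")
        case True
        then show ?thesis using that[of "XPlus i"] i by (simp add: gwa_exprs.intros fun_eq_iff)
      next
        case False
        then show ?thesis using that[of "XMinus i"] i \<epsilon> by (simp add: gwa_exprs.intros fun_eq_iff)
      qed
      show "left_X i \<epsilon> f \<in> ?J" using mult(1)[OF s(1,2) t(1)] s(3) t(2) by simp
      show "right_X i \<epsilon> f \<in> ?J"
        using mult(2)[OF s(1,2) t(1)] s(3) t(2) right_X_rep[OF i \<epsilon> s(1) unit_coeff_fin]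
        by (simp add: left_X_unit_coeff[OF i])
    qed
    then obtain t where "t \<in> ?E" "cls t \<in> J" "rep t ?u = ?u" by auto
    \<comment> \<open>The class of \<open>t\<close> is recovered from its coefficients, which are
      those of 1.\<close>
    then have "\<one>\<^bsub>A\<^esub> \<in> J" using expand_rep_unit_coeff[of t] expand_unit_coeff by simp
    then show ?thesis using J.one_imp_carrier by blast
  qed simp
qed

end

theorem theorem6p9:
  fixes K :: "('k, 'm) ring_scheme" and D :: "('k, 'd, 'n) module_scheme"
    and \<alpha> :: "'i rel" and \<sigma> :: "'i \<Rightarrow> 'd \<Rightarrow> 'd" and a :: "'i \<Rightarrow> 'd"
  assumes "gwa_datum K D \<alpha> \<sigma> a"
    and "infinite (Field \<alpha>)"
    and "\<And>J. \<lbrakk>ideal J D; sigma_stable K D \<alpha> \<sigma> J\<rbrakk> \<Longrightarrow> J = {\<zero>\<^bsub>D\<^esub>} \<or> J = carrier D"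
    and "outer_free K D \<alpha> \<sigma>"
    and "\<And>i m::nat. \<lbrakk>i \<in> Field \<alpha>; m \<ge> 1\<rbrakk> \<Longrightarrow>
           (carrier D #>\<^bsub>D\<^esub> a i) <+>\<^bsub>D\<^esub> (carrier D #>\<^bsub>D\<^esub> (\<sigma> i [^]\<^bsub>Aut K D\<^esub> m) (a i)) = carrier D"
  shows "simple_ring (gwa K D \<alpha> \<sigma> a)"
proof -
  have "Field \<alpha> \<noteq> {}" using assms(2) by auto
  then have "simple_gwa_datum K D \<alpha> \<sigma> a"
    by (intro simple_gwa_datum.intro simple_gwa_datum_axioms.intro assms)
  then show ?thesis by (rule simple_gwa_datum.simple_ring_gwa)
qed

end
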